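(* Let $T>0$, $\sigma>0$, $\varepsilon=1$, $x_0\in\mathbb T^2$, $w=e_1$, $x_c(t)=x_0+tw$. Let $u_n$ be the smooth divergence-free coefficients on $[0,T]\times\mathbb T^2$ defined in the context. For a smooth coefficient $u$ let $\mathcal U_u(T)\in\mathcal L(\mathcal H_2)$ be the terminal evolution operator $X_0\mapsto X(T)$ of the planar Maxwell--Ohm system with coefficient $u$; write $\mathcal U_n(T)=\mathcal U_{u_n}(T)$ and let $\mathcal U_0(T)$ be the operator for the zero coefficient. Then $$\|\mathcal U_n(T)-\mathcal U_0(T)\|_{\mathcal L(\mathcal H_2)}\longrightarrow\infty.$$ Consequently, there exists one fixed nonzero initial state $X_*\in\mathcal H_2$ such that $$\sup_n\|\mathcal U_n(T)X_*-\mathcal U_0(T)X_*\|_{\mathcal H_2}=\infty.$$ In particular, for this $X_*$ the map $u\mapsto\mathcal U_u(T)X_*$, from smooth coefficients equipped with the $L^2(0,T;H^1(\mathbb T^2))$ topology into $\mathcal H_2$, is discontinuous at $u=0$.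
   Context: $\mathbb T^2=(\mathbb R/2\pi\mathbb Z)^2$; $R(z_1,z_2)=(z_2,-z_1)$. States are $X=(E,b)$, $E$ $\mathbb R^2$-valued and $b$ real-valued; with $\varepsilon=1$, $\|X\|_{\mathcal H_2}^2=\|E\|_{L^2}^2+\|b\|_{L^2}^2$. The planar Maxwell--Ohm system with coefficient $v$ is $$\partial_tE-R\nabla b=-j,\qquad \partial_tb+\operatorname{curl}E=0,\qquad j=\sigma(E+bRv),\qquad \operatorname{curl}E=\partial_1E_2-\partial_2E_1.$$ Solutions are the unique mild energy solutions $X\in C([0,T];\mathcal H_2)$: $X(t)=S(t)X_0+\int_0^tS(t-s)(-\sigma b(s)Rv(s),0)\,ds$, with $S$ the contraction semigroup on $\mathcal H_2$ generated by $(E,b)\mapsto(R\nabla b-\sigma E,-\operatorname{curl}E)$ on its maximal domain. Coefficients $u_n$: fix $r_0>0$ such that the closed disk of radius $r_0$ about the origin lies in one coordinate chart of $\mathbb T^2$. Fix $\Theta\in C^\infty(\mathbb R;[0,1])$ with $\Theta(z)=0$ for $z\le0$, $\Theta(z)=z$ for $\frac14\le z\le\frac34$, $\Theta(z)=1$ for $z\ge1$, with $|\Theta'|+|\Theta''|\le C$ and $\Theta(z)\le Cz$ on $[0,1]$. For $L\ge2$ let $\chi_L(r)=\Theta(L^{-1}\log(r_0/r))$ for $0<r<r_0$, $\chi_L(r)=0$ for $r\ge r_0$, $\chi_L(0)=1$. For $A\ge1$ set $\psi_{A,L}(x)=-A(Rw\cdot x)\chi_L(|x|)$ and $W_{A,L}=R\nabla\psi_{A,L}$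 (extended by zero to $\mathbb T^2$). With $\delta_n=e^{-n}$ ($n\ge1$), $A_n(t)=1+\frac{2}{\sigma(t+\delta_n)}$ and $L_n(t)=n+A_n(t)^2$, set $u_n(t,x)=W_{A_n(t),L_n(t)}(x-x_c(t))$. These are smooth, divergence-free, and tend to $0$ strongly in $L^2(0,T;H^1(\mathbb T^2))$. *)

theory Defs
  imports "HOL-Analysis.Analysis"
begin

section \<open>The torus and smoothness\<close>

text \<open>
  Functions on \<open>(\<real>/2\<pi>\<int>)\<^sup>2\<close> are functions on the plane that are \<open>2\<pi>\<close>-periodic in each coordinate.
  Integrals over the torus are integrals over one period cell with respect to (unnormalised)
  Lebesgue measure; points of the torus are given by representatives in the plane.
\<close>

definition periodic :: "(real^2 \<Rightarrow> 'a) \<Rightarrow> bool" where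
  "periodic f \<longleftrightarrow> (\<forall>x i. f (x + axis i (2 * pi)) = f x)"

definition cell :: "(real^2) set" where
  "cell = cbox 0 (\<chi> i. 2 * pi)"

text \<open>The representative of \<open>x\<close> modulo \<open>2\<pi>\<int>\<^sup>2\<close> that lies in \<open>[-\<pi>, \<pi>)\<^sup>2\<close>.\<close>

definition wrap :: "real^2 \<Rightarrow> real^2" where
  "wrap x = (\<chi> i. x $ i - 2 * pi * real_of_int \<lfloor>(x $ i + pi) / (2 * pi)\<rfloor>)"

fun C_on :: "nat \<Rightarrow> 'a::real_normed_vector set \<Rightarrow> ('a \<Rightarrow> 'b::real_normed_vector) \<Rightarrow> bool" where
  "C_on 0 U f \<longleftrightarrow> continuous_on U f"
| "C_on (Suc k) U f \<longleftrightarrow>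
     (\<forall>x\<in>U. f differentiable (at x)) \<and> (\<forall>v. C_on k U (\<lambda>x. frechet_derivative f (at x) v))"

text \<open>Meant for open sets \<open>U\<close> in finite-dimensional spaces.\<close>

definition smooth_on :: "'a::real_normed_vector set \<Rightarrow> ('a \<Rightarrow> 'b::real_normed_vector) \<Rightarrow> bool" where
  "smooth_on U f \<longleftrightarrow> (\<forall>k. C_on k U f)"

definition partial :: "2 \<Rightarrow> (real^2 \<Rightarrow> 'b::real_normed_vector) \<Rightarrow> real^2 \<Rightarrow> 'b" where
  "partial i f x = frechet_derivative f (at x) (axis i 1)"

definition grad :: "(real^2 \<Rightarrow> real) \<Rightarrow> real^2 \<Rightarrow> real^2" where
  "grad f x = (\<chi> i. partial i f x)"

definition rot :: "real^2 \<Rightarrow> real^2" where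
  "rot z = vector [z $ 2, - (z $ 1)]"


section \<open>The Hilbert space \<open>L\<^sup>2\<close> of the torus\<close>

definition square_integrable :: "(real^2 \<Rightarrow> 'a::euclidean_space) \<Rightarrow> bool" where
  "square_integrable f \<longleftrightarrow> periodic f \<and> f \<in> borel_measurable lborel \<and>
     set_integrable lborel cell (\<lambda>x. (norm (f x))\<^sup>2)"

definition L2_rel :: "(real^2 \<Rightarrow> 'a::euclidean_space) \<Rightarrow> (real^2 \<Rightarrow> 'a) \<Rightarrow> bool" where
  "L2_rel f g \<longleftrightarrow> square_integrable f \<and> square_integrable g \<and>
     (AE x in lborel. x \<in> cell \<longrightarrow> f x = g x)"

lemma square_integrable_zero: "square_integrable (\<lambda>x. 0)"
  by (simp add: square_integrable_def periodic_def set_integrable_def)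

lemma square_integrable_scaleR:
  "square_integrable f \<Longrightarrow> square_integrable (\<lambda>x. c *\<^sub>R f x)"
  by (auto simp: square_integrable_def periodic_def power_mult_distrib)

lemma set_integrable_inner:
  assumes "square_integrable f" "square_integrable g"
  shows "set_integrable lborel cell (\<lambda>x. f x \<bullet> g x)"
proof -
  have i: "set_integrable lborel cell (\<lambda>x. (norm (f x))\<^sup>2 + (norm (g x))\<^sup>2)"
    using assms by (intro set_integral_add) (auto simp: square_integrable_def)
  have m: "f \<in> borel_measurable lborel" "g \<in> borel_measurable lborel"
    using assms by (auto simp: square_integrable_def)
  have "norm (f x \<bullet> g x) \<le> norm ((norm (f x))\<^sup>2 + (norm (g x))\<^sup>2)" for x
  proof -
    have "\<bar>f x \<bullet> g x\<bar> \<le> norm (f x) * norm (g x)" by (rule Cauchy_Schwarz_ineq2)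
    also have "\<dots> \<le> (norm (f x))\<^sup>2 + (norm (g x))\<^sup>2"
      using sum_squares_bound[of "norm (f x)" "norm (g x)"] zero_le_power2[of "norm (f x)"]
        zero_le_power2[of "norm (g x)"] mult_nonneg_nonneg[of "norm (f x)" "norm (g x)"]
      by (simp only: norm_ge_zero power2_eq_square mult.assoc)
    finally show ?thesis by simp
  qed
  moreover have "set_borel_measurable lborel cell (\<lambda>x. f x \<bullet> g x)"
    using m unfolding set_borel_measurable_def cell_def by measurable
  ultimately show ?thesis
    by (intro set_integrable_bound[OF i]) auto
qed

lemma square_integrable_add:
  assumes "square_integrable f" "square_integrable g"
  shows "square_integrable (\<lambda>x. f x + g x)"
proof -
  have "set_integrable lborel cell
     (\<lambda>x. (norm (f x))\<^sup>2 + (norm (g x))\<^sup>2 + (f x \<bullet> g x + f x \<bullet> g x))"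
    using assms set_integrable_inner[OF assms]
    by (intro set_integral_add) (auto simp: square_integrable_def)
  then have "set_integrable lborel cell (\<lambda>x. (norm (f x + g x))\<^sup>2)"
    by (simp add: power2_norm_eq_inner inner_add_left inner_add_right inner_commute algebra_simps)
  with assms show ?thesis
    by (auto simp: square_integrable_def periodic_def)
qed

lemma square_integrable_minus: "square_integrable f \<Longrightarrow> square_integrable (\<lambda>x. - f x)"
  using square_integrable_scaleR[of f "-1"] by simp

lemma square_integrable_diff:
  "square_integrable f \<Longrightarrow> square_integrable g \<Longrightarrow> square_integrable (\<lambda>x. f x - g x)"
  using square_integrable_add[OF _ square_integrable_minus, of f g] by simp

lemma L2_rel_refl: "square_integrable f \<Longrightarrow> L2_rel f f"
  by (simp add: L2_rel_def)

quotient_type (overloaded) 'a L2 = "real^2 \<Rightarrow> 'a::euclidean_space" / partial: L2_rel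
proof (rule part_equivpI)
  show "\<exists>f::real^2 \<Rightarrow> 'a. L2_rel f f"
    using L2_rel_refl[OF square_integrable_zero] by blast
  show "symp (L2_rel :: (real^2 \<Rightarrow> 'a) \<Rightarrow> _)"
    by (rule sympI) (auto simp: L2_rel_def elim: AE_mp)
  show "transp (L2_rel :: (real^2 \<Rightarrow> 'a) \<Rightarrow> _)"
    by (rule transpI) (auto simp: L2_rel_def elim!: AE_mp)
qed

instantiation L2 :: (euclidean_space) real_vector
begin

lift_definition zero_L2 :: "'a L2" is "\<lambda>x. 0"
  by (rule L2_rel_refl[OF square_integrable_zero])

lift_definition plus_L2 :: "'a L2 \<Rightarrow> 'a L2 \<Rightarrow> 'a L2" is "\<lambda>f g x. f x + g x"
  by (auto simp: L2_rel_def square_integrable_add elim!: AE_mp)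

lift_definition scaleR_L2 :: "real \<Rightarrow> 'a L2 \<Rightarrow> 'a L2" is "\<lambda>c f x. c *\<^sub>R f x"
  by (auto simp: L2_rel_def square_integrable_scaleR elim!: AE_mp)

lift_definition uminus_L2 :: "'a L2 \<Rightarrow> 'a L2" is "\<lambda>f x. - f x"
  by (auto simp: L2_rel_def square_integrable_minus elim!: AE_mp)

lift_definition minus_L2 :: "'a L2 \<Rightarrow> 'a L2 \<Rightarrow> 'a L2" is "\<lambda>f g x. f x - g x"
  by (auto simp: L2_rel_def square_integrable_diff elim!: AE_mp)

instance
proof
  fix f g h :: "'a L2" and a b :: real
  show "f + g + h = f + (g + h)"
    by transfer (auto simp: L2_rel_def square_integrable_add add.assoc)
  show "f + g = g + f"
    by transfer (auto simp: L2_rel_def square_integrable_add add.commute)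
  show "0 + f = f"
    by transfer (auto simp: L2_rel_def)
  show "- f + f = 0"
    by transfer (auto simp: L2_rel_def square_integrable_zero)
  show "f - g = f + - g"
    by transfer (auto simp: L2_rel_def square_integrable_diff)
  show "a *\<^sub>R (f + g) = a *\<^sub>R f + a *\<^sub>R g"
    by transfer
      (auto simp: L2_rel_def square_integrable_add square_integrable_scaleR scaleR_add_right)
  show "(a + b) *\<^sub>R f = a *\<^sub>R f + b *\<^sub>R f"
    by transfer
      (auto simp: L2_rel_def square_integrable_add square_integrable_scaleR scaleR_add_left
        simp flip: scaleR_add_left)
  show "a *\<^sub>R b *\<^sub>R f = (a * b) *\<^sub>R f"
    by transfer (auto simp: L2_rel_def square_integrable_scaleR)
  show "1 *\<^sub>R f = f"
    by transfer (auto simp: L2_rel_def)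
qed

end

instantiation L2 :: (euclidean_space) real_inner
begin

lift_definition inner_L2 :: "'a L2 \<Rightarrow> 'a L2 \<Rightarrow> real" is
  "\<lambda>f g. set_lebesgue_integral lborel cell (\<lambda>x. f x \<bullet> g x)"
proof -
  fix f1 f2 g1 g2 :: "real^2 \<Rightarrow> 'a"
  assume "L2_rel f1 f2" "L2_rel g1 g2"
  then have ae: "AE x in lborel. x \<in> cell \<longrightarrow> f1 x \<bullet> g1 x = f2 x \<bullet> g2 x"
    and m: "f1 \<in> borel_measurable lborel" "g1 \<in> borel_measurable lborel"
       "f2 \<in> borel_measurable lborel" "g2 \<in> borel_measurable lborel"
    by (auto simp: L2_rel_def square_integrable_def elim!: AE_mp)
  show "set_lebesgue_integral lborel cell (\<lambda>x. f1 x \<bullet> g1 x) =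
        set_lebesgue_integral lborel cell (\<lambda>x. f2 x \<bullet> g2 x)"
    unfolding set_lebesgue_integral_def
  proof (rule integral_cong_AE)
    show "AE x in lborel. indicat_real cell x *\<^sub>R (f1 x \<bullet> g1 x) = indicat_real cell x *\<^sub>R (f2 x \<bullet> g2 x)"
      using ae by eventually_elim (auto simp: indicator_def)
  qed (use m in \<open>auto simp: cell_def\<close>)
qed

definition "norm (f :: 'a L2) = sqrt (f \<bullet> f)"

definition "dist (f :: 'a L2) g = norm (f - g)"

definition "sgn (f :: 'a L2) = f /\<^sub>R norm f"

definition [code del]:
  "(uniformity :: ('a L2 \<times> 'a L2) filter) = (INF e\<in>{0<..}. principal {(x, y). dist x y < e})"

definition [code del]:
  "open (U :: 'a L2 set) \<longleftrightarrow> (\<forall>x\<in>U. eventually (\<lambda>(x', y). x' = x \<longrightarrow> y \<in> U) uniformity)"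

instance
proof
  fix f g h :: "'a L2" and r :: real and U :: "'a L2 set"
  show "sgn f = f /\<^sub>R norm f"
    by (rule sgn_L2_def)
  show "dist f g = norm (f - g)"
    by (rule dist_L2_def)
  show "(uniformity :: ('a L2 \<times> 'a L2) filter) =
      (INF e\<in>{0<..}. principal {(x, y). dist x y < e})"
    by (rule uniformity_L2_def)
  show "open U = (\<forall>x\<in>U. \<forall>\<^sub>F (x', y) in uniformity. x' = x \<longrightarrow> y \<in> U)"
    by (rule open_L2_def)
  show "f \<bullet> g = g \<bullet> f"
    by transfer (simp add: inner_commute)
  show "(f + g) \<bullet> h = f \<bullet> h + g \<bullet> h"
    by transfer
      (auto simp: L2_rel_def inner_add_left intro!: set_integral_add(2) set_integrable_inner)
  show "(r *\<^sub>R f) \<bullet> g = r * (f \<bullet> g)"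
    by transfer simp
  show "0 \<le> f \<bullet> f"
    by transfer (simp add: set_lebesgue_integral_def)
  show "f \<bullet> f = 0 \<longleftrightarrow> f = 0"
  proof transfer
    fix f :: "real^2 \<Rightarrow> 'a"
    assume "L2_rel f f"
    then have f: "square_integrable f" by (simp add: L2_rel_def)
    have "integrable lborel (\<lambda>x. indicat_real cell x *\<^sub>R (f x \<bullet> f x))"
      using set_integrable_inner[OF f f] by (simp add: set_integrable_def)
    then have "set_lebesgue_integral lborel cell (\<lambda>x. f x \<bullet> f x) = 0 \<longleftrightarrow>
        (AE x in lborel. indicat_real cell x *\<^sub>R (f x \<bullet> f x) = 0)"
      unfolding set_lebesgue_integral_def
      by (intro integral_nonneg_eq_0_iff_AE) auto
    also have "\<dots> \<longleftrightarrow> (AE x in lborel. x \<in> cell \<longrightarrow> f x = 0)"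
      by (intro AE_cong) (auto simp: indicator_def)
    finally show "set_lebesgue_integral lborel cell (\<lambda>x. f x \<bullet> f x) = 0 \<longleftrightarrow> L2_rel f (\<lambda>x. 0)"
      using f by (simp add: L2_rel_def square_integrable_zero)
  qed
  show "norm f = sqrt (f \<bullet> f)"
    by (rule norm_L2_def)
qed

end

text \<open>The energy space: the norm of a pair is \<open>sqrt ((norm E)\<^sup>2 + (norm b)\<^sup>2)\<close>.\<close>

type_synonym H2 = "(real^2) L2 \<times> real L2"

text \<open>
  Below, \<^const>\<open>rep_L2\<close> picks a representative of a class and \<^const>\<open>abs_L2\<close> forms the class of a
  square-integrable function (its value at any other function is irrelevant).
\<close>


section \<open>The damped Maxwell operator and its semigroup\<close>

definition test_function :: "(real^2 \<Rightarrow> real) \<Rightarrow> bool" where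
  "test_function \<phi> \<longleftrightarrow> smooth_on UNIV \<phi> \<and> periodic \<phi>"

definition weak_grad :: "real L2 \<Rightarrow> (real^2) L2 \<Rightarrow> bool" where
  "weak_grad b G \<longleftrightarrow> (\<forall>\<phi> i. test_function \<phi> \<longrightarrow>
     (LINT x:cell|lborel. rep_L2 b x * partial i \<phi> x) =
     - (LINT x:cell|lborel. rep_L2 G x $ i * \<phi> x))"

definition weak_curl :: "(real^2) L2 \<Rightarrow> real L2 \<Rightarrow> bool" where
  "weak_curl E c \<longleftrightarrow> (\<forall>\<phi>. test_function \<phi> \<longrightarrow>
     (LINT x:cell|lborel. rep_L2 E x $ 2 * partial 1 \<phi> x - rep_L2 E x $ 1 * partial 2 \<phi> x) =
     - (LINT x:cell|lborel. rep_L2 c x * \<phi> x))"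

definition rot_L2 :: "(real^2) L2 \<Rightarrow> (real^2) L2" where
  "rot_L2 G = abs_L2 (\<lambda>x. rot (rep_L2 G x))"

text \<open>
  The graph of \<open>(E, b) \<mapsto> (R \<nabla>b - \<sigma> E, - curl E)\<close> on the maximal domain, i.e. all states for which
  the distributions \<open>\<nabla>b\<close> and \<open>curl E\<close> are in \<open>L\<^sup>2\<close>.
\<close>

definition maxwell_ohm_graph :: "real \<Rightarrow> (H2 \<times> H2) set" where
  "maxwell_ohm_graph \<sigma> =
     {((E, b), (rot_L2 G - \<sigma> *\<^sub>R E, - c)) | E b G c. weak_grad b G \<and> weak_curl E c}"

text \<open>\<open>S\<close> (of which only the values at \<open>t \<ge> 0\<close> matter) is a strongly continuous semigroup of
  contractions whose infinitesimal generator has exactly the graph \<open>A\<close>.\<close>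

definition contraction_semigroup_generated_by ::
    "(real \<Rightarrow> 'a::real_normed_vector \<Rightarrow>\<^sub>L 'a) \<Rightarrow> ('a \<times> 'a) set \<Rightarrow> bool" where
  "contraction_semigroup_generated_by S A \<longleftrightarrow>
     S 0 = id_blinfun \<and>
     (\<forall>s\<ge>0. \<forall>t\<ge>0. S (s + t) = S s o\<^sub>L S t) \<and>
     (\<forall>X. continuous_on {0..} (\<lambda>t. blinfun_apply (S t) X)) \<and>
     (\<forall>t\<ge>0. norm (S t) \<le> 1) \<and>
     (\<forall>X Y. (X, Y) \<in> A \<longleftrightarrow>
        ((\<lambda>h. (blinfun_apply (S h) X - X) /\<^sub>R h) \<longlongrightarrow> Y) (at_right 0))"


section \<open>Coefficients and mild solutions\<close>

text \<open>
  A time-dependent coefficient is a function of \<open>t\<close> and \<open>x\<close>; only its values at \<open>t \<in> [0, T]\<close> matter.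
  Smoothness on the closed time interval means smooth extendability across its end points.
\<close>

definition smooth_coeff :: "real \<Rightarrow> (real \<Rightarrow> real^2 \<Rightarrow> real^2) \<Rightarrow> bool" where
  "smooth_coeff T u \<longleftrightarrow>
     (\<forall>t\<in>{0..T}. periodic (u t)) \<and>
     (\<exists>U v. open U \<and> {0..T} \<times> UNIV \<subseteq> U \<and> smooth_on U v \<and>
        (\<forall>t\<in>{0..T}. \<forall>x. v (t, x) = u t x))"

definition L2H1_norm :: "real \<Rightarrow> (real \<Rightarrow> real^2 \<Rightarrow> real^2) \<Rightarrow> real" where
  "L2H1_norm T u = sqrt (LINT t:{0..T}|lborel. LINT x:cell|lborel.
     (norm (u t x))\<^sup>2 + (\<Sum>i\<in>UNIV. (norm (partial i (u t) x))\<^sup>2))"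

definition ohm_source :: "real \<Rightarrow> (real^2 \<Rightarrow> real^2) \<Rightarrow> real L2 \<Rightarrow> (real^2) L2" where
  "ohm_source \<sigma> v b = abs_L2 (\<lambda>x. - (\<sigma> * rep_L2 b x) *\<^sub>R rot (v x))"

text \<open>
  For smooth \<open>v\<close> the integrand of the variation-of-constants formula is norm continuous in \<open>s\<close>, so
  the (Henstock-Kurzweil) integral below is the usual Hilbert-space valued one.
\<close>

definition mild_solution ::
    "(real \<Rightarrow> H2 \<Rightarrow>\<^sub>L H2) \<Rightarrow> real \<Rightarrow> real \<Rightarrow> (real \<Rightarrow> real^2 \<Rightarrow> real^2) \<Rightarrow> H2 \<Rightarrow> (real \<Rightarrow> H2) \<Rightarrow> bool" where
  "mild_solution S \<sigma> T v X0 X \<longleftrightarrow>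
     continuous_on {0..T} X \<and>
     (\<forall>t\<in>{0..T}.
        ((\<lambda>s. blinfun_apply (S (t - s)) (ohm_source \<sigma> (v s) (snd (X s)), 0))
           has_integral (X t - blinfun_apply (S t) X0)) {0..t})"

text \<open>
  The bounded operator \<open>X0 \<mapsto> X(T)\<close>. Mild solutions are unique only as functions on \<open>[0, T]\<close>, so the
  description singles out the terminal value and not the function \<open>X\<close>.
\<close>

definition evolution ::
    "(real \<Rightarrow> H2 \<Rightarrow>\<^sub>L H2) \<Rightarrow> real \<Rightarrow> real \<Rightarrow> (real \<Rightarrow> real^2 \<Rightarrow> real^2) \<Rightarrow> H2 \<Rightarrow>\<^sub>L H2" where
  "evolution S \<sigma> T v =
     Blinfun (\<lambda>X0. THE Y. \<exists>X. mild_solution S \<sigma> T v X0 X \<and> Y = X T)"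


section \<open>The coefficients \<open>u\<^sub>n\<close>\<close>

definition dir :: "real^2" where
  "dir = axis 1 1"

definition log_cutoff :: "(real \<Rightarrow> real) \<Rightarrow> real \<Rightarrow> real \<Rightarrow> real \<Rightarrow> real" where
  "log_cutoff \<Theta> r0 L r =
     (if r = 0 then 1 else if r < r0 then \<Theta> (ln (r0 / r) / L) else 0)"

definition stream :: "(real \<Rightarrow> real) \<Rightarrow> real \<Rightarrow> real \<Rightarrow> real \<Rightarrow> real^2 \<Rightarrow> real" where
  "stream \<Theta> r0 A L x = - A * (rot dir \<bullet> x) * log_cutoff \<Theta> r0 L (norm x)"

text \<open>
  For \<open>r0 < \<pi>\<close> the field \<open>R \<nabla>\<psi>\<close> vanishes near the boundary of \<open>[-\<pi>, \<pi>)\<^sup>2\<close>; its extension by zero to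
  the torus is its composition with \<^const>\<open>wrap\<close>.
\<close>

definition pulse :: "(real \<Rightarrow> real) \<Rightarrow> real \<Rightarrow> real \<Rightarrow> real \<Rightarrow> real^2 \<Rightarrow> real^2" where
  "pulse \<Theta> r0 A L x = rot (grad (stream \<Theta> r0 A L) (wrap x))"

definition delta_n :: "nat \<Rightarrow> real" where
  "delta_n n = exp (- real n)"

definition A_n :: "real \<Rightarrow> nat \<Rightarrow> real \<Rightarrow> real" where
  "A_n \<sigma> n t = 1 + 2 / (\<sigma> * (t + delta_n n))"

definition L_n :: "real \<Rightarrow> nat \<Rightarrow> real \<Rightarrow> real" where
  "L_n \<sigma> n t = real n + (A_n \<sigma> n t)\<^sup>2"

definition u_n ::
    "(real \<Rightarrow> real) \<Rightarrow> real \<Rightarrow> real \<Rightarrow> real^2 \<Rightarrow> nat \<Rightarrow> real \<Rightarrow> real^2 \<Rightarrow> real^2" where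
  "u_n \<Theta> r0 \<sigma> x0 n t x = pulse \<Theta> r0 (A_n \<sigma> n t) (L_n \<sigma> n t) (x - (x0 + t *\<^sub>R dir))"

end

theory Submission
  imports Defs
begin

text \<open>
  In its core the coefficient \<open>u\<^sub>n\<close> is the constant vector \<open>A\<^sub>n(t) e\<^sub>1\<close>, and the core moves in the
  direction \<open>e\<^sub>1\<close> with the speed of light. A wave packet of high frequency \<open>N\<close> with \<open>E = (0, f)\<close> and
  \<open>b = f\<close> moves along the same ray, hence never leaves the core. For \<open>E\<^sub>2 = b = f\<close> the sum of the two
  relevant equations is \<open>2 (\<partial>\<^sub>t + \<partial>\<^sub>1) f = \<sigma> (A\<^sub>n - 1) f\<close>: the term \<open>b Rv\<close> in Ohm's law turns damping
  into growth, at the rate \<open>\<sigma> (A\<^sub>n(t) - 1) / 2 = 1 / (t + \<delta>\<^sub>n)\<close>. The amplitude \<open>(t + \<delta>\<^sub>n) / \<delta>\<^sub>n\<close> is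
  affine in time and reaches \<open>(T + \<delta>\<^sub>n) / \<delta>\<^sub>n\<close>, of the order of \<open>e\<^sup>n\<close>.

  The packet is not an exact solution. Two explicit correctors of size \<open>1/N\<close> reduce its residual to
  \<open>O(1/N)\<close> (\<open>packet_residual\<close>), and Duhamel's formula with Gronwall's inequality
  (\<open>approximate_solution\<close>) shows that, for fixed \<open>n\<close> and \<open>N\<close> tending to infinity, the mild solution
  follows the packet. The \<open>L\<^sup>2\<close> norm of the leading part stays away from zero as \<open>N\<close> grows
  (\<open>mass_lower_bound\<close>). This gives \<open>norm_evolution_lower_bound\<close> and, for the coefficients
  \<open>u\<^sub>n\<close>, \<open>norm_evolution_u_n\<close>: the norm of the evolution operator is at least
  \<open>(T + \<delta>\<^sub>n) / (5 \<delta>\<^sub>n)\<close>. For the zero coefficient the evolution is a contraction, so the norms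
  of the differences tend to infinity. Since \<open>L\<^sup>2\<close> of the torus is complete, the principle of uniform
  boundedness (\<open>uniform_boundedness\<close>) yields one initial state along which they are unbounded.

  The large amplitude is cheap in \<open>H\<^sup>1\<close> because the logarithmic cut-off in two dimensions has small
  Dirichlet energy: in the annulus between the radii \<open>r0 e\<^sup>-\<^sup>L\<close> and \<open>r0\<close> the gradient of the field is
  of size \<open>A / (L \<rho>)\<close> at distance \<open>\<rho>\<close> from the centre, and the integral of \<open>\<rho>\<^sup>-\<^sup>2\<close> over the annulus is
  proportional to \<open>L\<close>, so the squared norm at each time is at most a multiple of \<open>A\<^sup>2 / L\<close>
  (\<open>integral_energy_le\<close>). With \<open>L = n + A\<^sup>2\<close> this is bounded by \<open>1\<close> and tends to zero pointwise for
  \<open>t > 0\<close>; by dominated convergence \<open>u\<^sub>n\<close> tends to zero in \<open>L\<^sup>2(0, T; H\<^sup>1)\<close>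
  (\<open>L2H1_norm_u_n_tendsto\<close>). As the \<open>u\<^sub>n\<close> are smooth (\<open>smooth_coeff_u_n\<close>), continuity at zero fails for
  the state found before.
\<close>

section \<open>Completeness of \<open>L\<^sup>2\<close>\<close>

lemma square_integrable_rep: "square_integrable (rep_L2 f)"
  using Quotient_rep_reflp[OF Quotient_L2, of f] by (simp add: L2_rel_def)

lemma abs_rep_L2: "abs_L2 (rep_L2 f) = f"
  using Quotient_abs_rep[OF Quotient_L2] .

lemma L2_rel_rep_abs: "square_integrable f \<Longrightarrow> L2_rel (rep_L2 (abs_L2 f)) f"
  by (rule Quotient_rep_abs[OF Quotient_L2 L2_rel_refl])

lemma AE_rep_abs:
  assumes "square_integrable f"
  shows "AE x in lborel. x \<in> cell \<longrightarrow> rep_L2 (abs_L2 f) x = f x"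
  using L2_rel_rep_abs[OF assms] by (simp add: L2_rel_def)

lemma abs_L2_eqI:
  assumes "square_integrable f" "square_integrable g" "AE x in lborel. x \<in> cell \<longrightarrow> f x = g x"
  shows "abs_L2 f = abs_L2 g"
  using Quotient_rel_abs[OF Quotient_L2, of f g] assms by (simp add: L2_rel_def)

lemma abs_L2_add: "square_integrable f \<Longrightarrow> square_integrable g \<Longrightarrow>
    abs_L2 f + abs_L2 g = abs_L2 (\<lambda>x. f x + g x)"
  by (rule plus_L2.abs_eq) (simp_all add: L2_rel_refl)

lemma abs_L2_diff: "square_integrable f \<Longrightarrow> square_integrable g \<Longrightarrow>
    abs_L2 f - abs_L2 g = abs_L2 (\<lambda>x. f x - g x)"
  by (rule minus_L2.abs_eq) (simp_all add: L2_rel_refl)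

lemma abs_L2_minus: "square_integrable f \<Longrightarrow> - abs_L2 f = abs_L2 (\<lambda>x. - f x)"
  by (rule uminus_L2.abs_eq) (simp_all add: L2_rel_refl)

lemma abs_L2_scaleR: "square_integrable f \<Longrightarrow> c *\<^sub>R abs_L2 f = abs_L2 (\<lambda>x. c *\<^sub>R f x)"
  by (rule scaleR_L2.abs_eq) (simp_all add: L2_rel_refl)

lemma inner_abs_L2: "square_integrable f \<Longrightarrow> square_integrable g \<Longrightarrow>
    abs_L2 f \<bullet> abs_L2 g = (LINT x:cell|lborel. f x \<bullet> g x)"
  by (rule inner_L2.abs_eq) (simp_all add: L2_rel_refl)

lemma norm_abs_L2: "square_integrable f \<Longrightarrow>
    (norm (abs_L2 f))\<^sup>2 = (LINT x:cell|lborel. (norm (f x))\<^sup>2)"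
  by (simp add: power2_norm_eq_inner inner_abs_L2)

lemma cell_in_borel [measurable]: "cell \<in> sets borel"
  by (simp add: cell_def)

lemma emeasure_cell: "emeasure lborel cell = ennreal (4 * pi\<^sup>2)"
  unfolding cell_def
  by (subst emeasure_lborel_cbox_eq)
     (auto simp: Basis_vec_def inner_axis prod.distrib power2_eq_square axis_eq_axis
        simp flip: UNIV_2 intro!: arg_cong[where f=ennreal]
        , (subst prod.UNION_disjoint | simp add: axis_eq_axis UNIV_2 inner_axis)+)

lemma measure_cell: "measure lborel cell = 4 * pi\<^sup>2"
  by (simp add: measure_def emeasure_cell)

lemma set_integrable_cell_const: "set_integrable lborel cell (\<lambda>x. c::real)"
  unfolding set_integrable_def
  by (intro integrable_scaleR_left integrable_real_indicator) (auto simp: emeasure_cell)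

lemma square_integrable_bounded:
  assumes "periodic f" "f \<in> borel_measurable borel" "\<And>x. norm (f x) \<le> M"
  shows "square_integrable f"
proof -
  have "set_integrable lborel cell (\<lambda>x. (norm (f x))\<^sup>2)"
  proof (rule set_integrable_bound[OF set_integrable_cell_const[of "M\<^sup>2"]])
    show "set_borel_measurable lborel cell (\<lambda>x. (norm (f x))\<^sup>2)"
      using assms(2) unfolding set_borel_measurable_def by measurable
    show "AE x in lborel. x \<in> cell \<longrightarrow> norm ((norm (f x))\<^sup>2) \<le> norm (M\<^sup>2)"
      using assms(3) by (auto intro!: AE_I2 power_mono)
  qed
  with assms show ?thesis by (simp add: square_integrable_def)
qed

lemma norm_abs_L2_le:
  assumes "square_integrable f" "\<And>x. norm (f x) \<le> M"
  shows "norm (abs_L2 f) \<le> 2 * pi * M"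
proof -
  have "M \<ge> 0" using assms(2)[of 0] norm_ge_zero order_trans by blast
  have "(norm (abs_L2 f))\<^sup>2 \<le> (LINT x:cell|lborel. M\<^sup>2)"
    unfolding norm_abs_L2[OF assms(1)] using assms
    by (intro set_integral_mono set_integrable_cell_const)
       (auto simp: square_integrable_def intro!: power_mono)
  also have "\<dots> = (2 * pi * M)\<^sup>2"
    by (simp add: set_lebesgue_integral_def measure_cell power_mult_distrib)
  finally show ?thesis
    by (rule power2_le_imp_le) (use \<open>M \<ge> 0\<close> in auto)
qed

text \<open>On the cell, which has finite measure, convergence in \<open>L\<^sup>2\<close> dominates convergence in \<open>L\<^sup>1\<close>.\<close>

lemma L1_le_L2:
  assumes "square_integrable f"
  shows "set_integrable lborel cell f"
    and "(LINT x:cell|lborel. norm (f x)) \<le> 2 * pi * norm (abs_L2 f)"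
proof -
  have si: "square_integrable (\<lambda>x. norm (f x))"
    using assms by (auto simp: square_integrable_def periodic_def)
  have s1: "square_integrable (\<lambda>x. 1 :: real)"
    by (rule square_integrable_bounded) (auto simp: periodic_def)
  have i: "set_integrable lborel cell (\<lambda>x. norm (f x))"
    using set_integrable_inner[OF si s1] by simp
  have [measurable]: "f \<in> borel_measurable borel"
    using assms by (simp add: square_integrable_def)
  have "set_borel_measurable lborel cell f"
    unfolding set_borel_measurable_def by measurable
  then show "set_integrable lborel cell f"
    by (rule set_integrable_bound[OF i]) auto
  have n1: "norm (abs_L2 (\<lambda>x. 1 :: real)) \<le> 2 * pi"
    using norm_abs_L2_le[OF s1, of 1] by simp
  have n2: "norm (abs_L2 (\<lambda>x. norm (f x))) = norm (abs_L2 f)"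
    using norm_abs_L2[OF si] norm_abs_L2[OF assms]
    by (auto intro!: power2_eq_imp_eq[of "norm (abs_L2 (\<lambda>x. norm (f x)))"])
  have "(LINT x:cell|lborel. norm (f x)) = abs_L2 (\<lambda>x. norm (f x)) \<bullet> abs_L2 (\<lambda>x. 1 :: real)"
    by (simp add: inner_abs_L2[OF si s1])
  also have "\<dots> \<le> norm (abs_L2 (\<lambda>x. norm (f x))) * norm (abs_L2 (\<lambda>x. 1 :: real))"
    by (rule norm_cauchy_schwarz)
  also have "\<dots> \<le> norm (abs_L2 f) * (2 * pi)"
    unfolding n2 using n1 by (rule mult_left_mono) simp
  finally show "(LINT x:cell|lborel. norm (f x)) \<le> 2 * pi * norm (abs_L2 f)"
    by (simp add: mult.commute)
qed

text \<open>Riesz--Fischer: an \<open>L\<^sup>2\<close>-Cauchy sequence is \<open>L\<^sup>1\<close>-Cauchy on the cell, so a subsequence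
  converges almost everywhere; Fatou's lemma identifies the pointwise limit as the limit in
  \<open>L\<^sup>2\<close>. The pointwise limit inherits periodicity.\<close>

instance L2 :: (euclidean_space) banach
proof
  fix X :: "nat \<Rightarrow> 'a L2"
  assume X: "Cauchy X"
  define F where "F n = rep_L2 (X n)" for n
  have F: "square_integrable (F n)" "abs_L2 (F n) = X n" for n
    by (auto simp: F_def square_integrable_rep abs_rep_L2)
  have Fm [measurable]: "F n \<in> borel_measurable borel" for n
    using F(1)[of n] by (simp add: square_integrable_def)
  define s where "s n x = indicat_real cell x *\<^sub>R F n x" for n x
  have s_int: "integrable lborel (s n)" for n
    using L1_le_L2(1)[OF F(1)[of n]] by (simp add: s_def[abs_def] set_integrable_def)
  have s_diff: "(LINT x|lborel. norm (s i x - s j x)) \<le> 2 * pi * norm (X i - X j)" for i j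
  proof -
    have "(LINT x|lborel. norm (s i x - s j x)) = (LINT x:cell|lborel. norm (F i x - F j x))"
      unfolding set_lebesgue_integral_def s_def by (simp flip: scaleR_diff_right)
    also have "\<dots> \<le> 2 * pi * norm (X i - X j)"
      using L1_le_L2(2)[OF square_integrable_diff[OF F(1)[of i] F(1)[of j]]]
      by (simp add: F(2) flip: abs_L2_diff[OF F(1)[of i] F(1)[of j]])
    finally show ?thesis .
  qed
  have "\<exists>N. \<forall>i\<ge>N. \<forall>j\<ge>N. (LINT x|lborel. norm (s i x - s j x)) < e" if "e > 0" for e
  proof -
    have "e / (2 * pi) > 0" using that by simp
    then obtain N where "\<forall>i\<ge>N. \<forall>j\<ge>N. dist (X i) (X j) < e / (2 * pi)"
      using X unfolding Cauchy_def by blast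
    then have "\<forall>i\<ge>N. \<forall>j\<ge>N. 2 * pi * norm (X i - X j) < e"
      by (auto simp: dist_norm field_simps)
    then show ?thesis using s_diff by (meson order_le_less_trans)
  qed
  then obtain r where r: "strict_mono r" and cauchy: "AE x in lborel. Cauchy (\<lambda>i. s (r i) x)"
    by (rule cauchy_L1_AE_cauchy_subseq[OF s_int])
  define g where "g x = lim (\<lambda>k. F (r k) x)" for x
  have gm [measurable]: "g \<in> borel_measurable borel"
    unfolding g_def[abs_def] by (rule borel_measurable_lim_metric) measurable
  have gp: "periodic g"
    using F(1) by (simp add: g_def periodic_def square_integrable_def)
  have glim: "AE x in lborel. x \<in> cell \<longrightarrow> (\<lambda>k. F (r k) x) \<longlonglongrightarrow> g x"
    using cauchy by eventually_elim
      (auto simp: s_def g_def convergent_LIMSEQ_iff[symmetric] Cauchy_convergent_iff)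
  have est: "set_integrable lborel cell (\<lambda>x. (norm (g x - F i x))\<^sup>2)
      \<and> (LINT x:cell|lborel. (norm (g x - F i x))\<^sup>2) \<le> e\<^sup>2"
    if e: "e > 0" and N: "\<And>j. j \<ge> N \<Longrightarrow> norm (X i - X j) \<le> e" for i N e
  proof -
    let ?h = "\<lambda>x. indicat_real cell x * (norm (g x - F i x))\<^sup>2"
    let ?hk = "\<lambda>k x. ennreal (indicat_real cell x * (norm (F (r k) x - F i x))\<^sup>2)"
    have "(\<integral>\<^sup>+x. ennreal (?h x) \<partial>lborel) \<le> (\<integral>\<^sup>+x. liminf (\<lambda>k. ?hk k x) \<partial>lborel)"
    proof (intro nn_integral_mono_AE, use glim in eventually_elim)
      fix x assume *: "x \<in> cell \<longrightarrow> (\<lambda>k. F (r k) x) \<longlonglongrightarrow> g x"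
      have "(\<lambda>k. indicat_real cell x * (norm (F (r k) x - F i x))\<^sup>2) \<longlonglongrightarrow> ?h x"
        using * by (cases "x \<in> cell") (auto intro!: tendsto_intros)
      then have "(\<lambda>k. ?hk k x) \<longlonglongrightarrow> ennreal (?h x)"
        by (rule tendsto_ennrealI)
      then show "ennreal (?h x) \<le> liminf (\<lambda>k. ?hk k x)"
        using lim_imp_Liminf[OF sequentially_bot] by fastforce
    qed
    also have "\<dots> \<le> liminf (\<lambda>k. \<integral>\<^sup>+x. ?hk k x \<partial>lborel)"
      by (rule nn_integral_liminf) measurable
    also have "\<dots> \<le> liminf (\<lambda>k. ennreal (e\<^sup>2))"
    proof (intro Liminf_mono eventually_sequentiallyI)
      fix k assume k: "N \<le> k"
      have sid: "square_integrable (\<lambda>x. F (r k) x - F i x)"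
        by (intro square_integrable_diff F)
      have "(\<integral>\<^sup>+x. ?hk k x \<partial>lborel) = ennreal (LINT x:cell|lborel. (norm (F (r k) x - F i x))\<^sup>2)"
        unfolding set_lebesgue_integral_def using sid
        by (subst nn_integral_eq_integral) (auto simp: square_integrable_def set_integrable_def)
      also have "\<dots> = ennreal ((norm (X (r k) - X i))\<^sup>2)"
        by (simp add: norm_abs_L2[OF sid, symmetric] F(2) flip: abs_L2_diff[OF F(1)[of "r k"] F(1)[of i]])
      also have "\<dots> \<le> ennreal (e\<^sup>2)"
        using N[of "r k"] seq_suble[OF r, of k] k
        by (intro ennreal_leI power_mono) (auto simp: norm_minus_commute)
      finally show "(\<integral>\<^sup>+x. ?hk k x \<partial>lborel) \<le> ennreal (e\<^sup>2)" .
    qed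
    also have "\<dots> = ennreal (e\<^sup>2)" by (simp add: lim_imp_Liminf)
    finally have le: "(\<integral>\<^sup>+x. ennreal (?h x) \<partial>lborel) \<le> ennreal (e\<^sup>2)" .
    have int: "integrable lborel ?h"
      by (rule integrableI_bounded) (use le in \<open>auto simp: le_less_trans abs_mult\<close>)
    have "ennreal (integral\<^sup>L lborel ?h) \<le> ennreal (e\<^sup>2)"
      using le by (subst nn_integral_eq_integral[symmetric]) (auto intro: int)
    then have "integral\<^sup>L lborel ?h \<le> e\<^sup>2" by simp
    with int show ?thesis by (simp add: set_integrable_def set_lebesgue_integral_def)
  qed
  have cau: "\<exists>N. \<forall>i\<ge>N. \<forall>j\<ge>N. norm (X i - X j) \<le> e" if "e > 0" for e
    using X that unfolding Cauchy_def dist_norm by (meson less_imp_le)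
  have sd: "square_integrable (\<lambda>x. g x - F i x)" if "i \<ge> N" "\<forall>i\<ge>N. \<forall>j\<ge>N. norm (X i - X j) \<le> 1" for i N
    unfolding square_integrable_def using est[of 1 N i] that gp F(1)[of i]
    by (auto simp: periodic_def square_integrable_def)
  obtain N1 where N1: "\<forall>i\<ge>N1. \<forall>j\<ge>N1. norm (X i - X j) \<le> 1" using cau[of 1] by auto
  have sg: "square_integrable g"
    using square_integrable_add[OF sd[OF order_refl N1] F(1)[of N1]] by simp
  have "X \<longlonglongrightarrow> abs_L2 g"
  proof (rule LIMSEQ_I)
    fix e :: real assume e: "e > 0"
    obtain N where N: "\<forall>i\<ge>N. \<forall>j\<ge>N. norm (X i - X j) \<le> e / 2" using cau[of "e/2"] e by auto
    have "norm (X i - abs_L2 g) < e" if i: "i \<ge> N" for i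
    proof -
      have "(norm (abs_L2 g - X i))\<^sup>2 = (LINT x:cell|lborel. (norm (g x - F i x))\<^sup>2)"
        using norm_abs_L2[OF square_integrable_diff[OF sg F(1)[of i]]]
        by (simp add: F(2) flip: abs_L2_diff[OF sg F(1)[of i]])
      also have "\<dots> \<le> (e / 2)\<^sup>2"
        using est[of "e/2" N i] N i e by auto
      finally have "norm (abs_L2 g - X i) \<le> e / 2"
        by (rule power2_le_imp_le) (use e in simp)
      then show ?thesis using e by (simp add: norm_minus_commute)
    qed
    then show "\<exists>N. \<forall>i\<ge>N. norm (X i - abs_L2 g) < e" by blast
  qed
  then show "convergent X" by (auto simp: convergent_def)
qed

section \<open>Periodic functions\<close>

definition lat :: "int^2 \<Rightarrow> real^2" where
  "lat k = (\<chi> i. 2 * pi * real_of_int (k $ i))"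

text \<open>The period cell with corner \<open>y\<close>, half-open so that its translates by the lattice are
  disjoint and cover the plane; the closed cell differs from it by a null set.\<close>

definition fcell :: "real^2 \<Rightarrow> (real^2) set" where
  "fcell y = {x. \<forall>i. y $ i \<le> x $ i \<and> x $ i < y $ i + 2 * pi}"

lemma periodic_axis_int:
  assumes "periodic f"
  shows "f (x + axis i (2 * pi * real_of_int m)) = f x"
proof (induction m rule: int_induct[where k=0])
  case base
  have "axis i (0::real) = (0 :: real^2)" by (simp add: vec_eq_iff axis_def)
  then show ?case by (simp only: of_int_0 mult_zero_right add_0_right)
next
  case (step1 m)
  have "axis i (2 * pi * real_of_int (m + 1)) = axis i (2 * pi * real_of_int m) + axis i (2 * pi)"
    by (simp add: vec_eq_iff axis_def algebra_simps)
  with step1 show ?case using assms unfolding periodic_def by (metis add.assoc)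
next
  case (step2 m)
  have "axis i (2 * pi * real_of_int m) = axis i (2 * pi * real_of_int (m - 1)) + axis i (2 * pi)"
    by (simp add: vec_eq_iff axis_def algebra_simps)
  with step2 show ?case using assms unfolding periodic_def by (metis add.assoc)
qed

lemma periodic_add:
  assumes "periodic f"
  shows "f (x + axis i (2 * pi) + y) = f (x + y)"
proof -
  have "x + axis i (2 * pi) + y = (x + y) + axis i (2 * pi)" by (simp add: ac_simps)
  then show ?thesis using assms by (simp only: periodic_def)
qed

lemma periodic_shift: "periodic f \<Longrightarrow> periodic (\<lambda>x. f (x + y))"
  unfolding periodic_def[of "\<lambda>x. f (x + y)"] using periodic_add[of f] by blast

lemma periodic_lat:
  assumes "periodic f"
  shows "f (x + lat k) = f x"
proof -
  have "x + lat k = x + axis 1 (2 * pi * real_of_int (k $ 1)) + axis 2 (2 * pi * real_of_int (k $ 2))"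
    by (simp add: vec_eq_iff axis_def lat_def forall_2)
  then show ?thesis by (simp only: periodic_axis_int[OF assms])
qed

lemma lat_minus: "lat (- k) = - lat k"
  by (simp add: lat_def vec_eq_iff)

lemma ex1_lat_fcell: "\<exists>!k. x + lat k \<in> fcell y"
proof
  let ?k = "(\<chi> i. - \<lfloor>(x $ i - y $ i) / (2 * pi)\<rfloor>) :: int^2"
  have *: "m = - \<lfloor>a / (2 * pi)\<rfloor> \<longleftrightarrow> 0 \<le> a + 2 * pi * real_of_int m \<and> a + 2 * pi * real_of_int m < 2 * pi"
    for a m
  proof -
    have "m = - \<lfloor>a / (2 * pi)\<rfloor> \<longleftrightarrow> \<lfloor>a / (2 * pi)\<rfloor> = - m" by auto
    also have "\<dots> \<longleftrightarrow> - real_of_int m \<le> a / (2 * pi) \<and> a / (2 * pi) < - real_of_int m + 1"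
      by (auto simp: floor_eq_iff)
    also have "\<dots> \<longleftrightarrow> 0 \<le> a + 2 * pi * real_of_int m \<and> a + 2 * pi * real_of_int m < 2 * pi"
      by (auto simp: field_simps)
    finally show ?thesis .
  qed
  show "x + lat ?k \<in> fcell y"
    using *[of "?k $ i" "x $ i - y $ i" for i] by (auto simp: fcell_def lat_def algebra_simps)
  fix k assume "x + lat k \<in> fcell y"
  then have "k $ i = ?k $ i" for i
    using *[of "k $ i" "x $ i - y $ i"] by (auto simp: fcell_def lat_def algebra_simps)
  then show "k = ?k" by (simp add: vec_eq_iff)
qed

lemma fcell_0_subset: "fcell 0 \<subseteq> cell"
  by (auto simp: fcell_def cell_def mem_box_cart less_imp_le)

lemma fcell_in_borel [measurable]: "fcell y \<in> sets borel"
  unfolding fcell_def by measurable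

lemma ex_lat_cell: "\<exists>k. x + lat k \<in> cell"
  using ex1_lat_fcell[of x 0] fcell_0_subset by blast

lemma AE_cell_fcell: "AE x in lborel. x \<in> cell \<longleftrightarrow> x \<in> fcell 0"
proof -
  have "negligible (cbox (0::real^2) (\<chi> i. 2 * pi) - box 0 (\<chi> i. 2 * pi))"
    by (rule negligible_frontier_interval)
  then have "cbox (0::real^2) (\<chi> i. 2 * pi) - box 0 (\<chi> i. 2 * pi) \<in> null_sets lborel"
    by (simp add: negligible_iff_null_sets null_sets_completion_iff)
  then have "AE x in lborel. x \<notin> cbox (0::real^2) (\<chi> i. 2 * pi) - box 0 (\<chi> i. 2 * pi)"
    by (rule AE_not_in)
  then show ?thesis
    by eventually_elim (auto simp: cell_def fcell_def mem_box_cart less_imp_le)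
qed

lemma nn_integral_translate:
  fixes f :: "'a::euclidean_space \<Rightarrow> ennreal"
  assumes [measurable]: "f \<in> borel_measurable borel"
  shows "(\<integral>\<^sup>+x. f (x + c) \<partial>lborel) = (\<integral>\<^sup>+x. f x \<partial>lborel)"
proof -
  have "(\<integral>\<^sup>+x. f x \<partial>lborel) = (\<integral>\<^sup>+x. f x \<partial>distr lborel borel ((+) c))"
    by (simp only: lborel_distr_plus)
  also have "\<dots> = (\<integral>\<^sup>+x. f (c + x) \<partial>lborel)"
    by (rule nn_integral_distr) auto
  finally show ?thesis by (simp add: add.commute)
qed

text \<open>Each point has exactly one lattice translate in either of two fundamental cells; summing over
  the lattice exchanges the two cells.\<close>

lemma nn_integral_fcell:
  assumes [measurable]: "f \<in> borel_measurable borel" and p: "periodic f"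
  shows "(\<integral>\<^sup>+x. f x * indicator (fcell y) x \<partial>lborel) = (\<integral>\<^sup>+x. f x * indicator (fcell z) x \<partial>lborel)"
proof -
  have one: "(\<integral>\<^sup>+k. indicator (fcell y) (x + lat k) \<partial>count_space UNIV) = (1::ennreal)" for x y
  proof -
    obtain k0 where "\<And>k. x + lat k \<in> fcell y \<longleftrightarrow> k = k0" using ex1_lat_fcell[of x y] by metis
    then have "(\<lambda>k. indicator (fcell y) (x + lat k) :: ennreal) = indicator {k0}"
      by (auto simp: fun_eq_iff indicator_def)
    then show ?thesis by simp
  qed
  have one': "(\<integral>\<^sup>+k. indicator (fcell y) (x - lat k) \<partial>count_space UNIV) = (1::ennreal)" for x y
  proof -
    obtain k0 where k0: "\<And>k. x + lat k \<in> fcell y \<longleftrightarrow> k = k0" using ex1_lat_fcell[of x y] by metis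
    have "x - lat k \<in> fcell y \<longleftrightarrow> k = - k0" for k
      using k0[of "- k"] by (auto simp: lat_minus minus_equation_iff)
    then have "(\<lambda>k. indicator (fcell y) (x - lat k) :: ennreal) = indicator {- k0}"
      by (auto simp: fun_eq_iff indicator_def)
    then show ?thesis by simp
  qed
  have "(\<integral>\<^sup>+x. f x * indicator (fcell y) x \<partial>lborel)
      = (\<integral>\<^sup>+x. (\<integral>\<^sup>+k. f x * indicator (fcell y) x * indicator (fcell z) (x + lat k) \<partial>count_space UNIV) \<partial>lborel)"
    by (simp add: nn_integral_cmult one)
  also have "\<dots> = (\<integral>\<^sup>+k. (\<integral>\<^sup>+x. f x * indicator (fcell y) x * indicator (fcell z) (x + lat k) \<partial>lborel) \<partial>count_space UNIV)"
    by (rule nn_integral_count_space_nn_integral) auto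
  also have "\<dots> = (\<integral>\<^sup>+k. (\<integral>\<^sup>+x. f x * indicator (fcell z) x * indicator (fcell y) (x - lat k) \<partial>lborel) \<partial>count_space UNIV)"
  proof (rule nn_integral_cong)
    fix k :: "int^2"
    have "f (x - lat k) = f x" for x
      using periodic_lat[OF p, of x "- k"] by (simp add: lat_minus)
    then show "(\<integral>\<^sup>+x. f x * indicator (fcell y) x * indicator (fcell z) (x + lat k) \<partial>lborel)
        = (\<integral>\<^sup>+x. f x * indicator (fcell z) x * indicator (fcell y) (x - lat k) \<partial>lborel)"
      using nn_integral_translate[of "\<lambda>x. f x * indicator (fcell y) x * indicator (fcell z) (x + lat k)" "- lat k"]
      by (simp add: mult_ac)
  qed
  also have "\<dots> = (\<integral>\<^sup>+x. (\<integral>\<^sup>+k. f x * indicator (fcell z) x * indicator (fcell y) (x - lat k) \<partial>count_space UNIV) \<partial>lborel)"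
    by (rule nn_integral_count_space_nn_integral[symmetric]) auto
  also have "\<dots> = (\<integral>\<^sup>+x. f x * indicator (fcell z) x \<partial>lborel)"
    by (simp add: nn_integral_cmult one')
  finally show ?thesis .
qed

lemma nn_integral_cell_fcell:
  assumes [measurable]: "f \<in> borel_measurable borel" and p: "periodic f"
  shows "(\<integral>\<^sup>+x. f x * indicator cell x \<partial>lborel) = (\<integral>\<^sup>+x. f x * indicator (fcell y) x \<partial>lborel)"
proof -
  have "(\<integral>\<^sup>+x. f x * indicator cell x \<partial>lborel) = (\<integral>\<^sup>+x. f x * indicator (fcell 0) x \<partial>lborel)"
    by (rule nn_integral_cong_AE, use AE_cell_fcell in eventually_elim) (simp add: indicator_def)
  then show ?thesis using nn_integral_fcell[OF assms, of 0 y] by simp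
qed

lemma nn_integral_cell_shift:
  assumes [measurable]: "f \<in> borel_measurable borel" and p: "periodic f"
  shows "(\<integral>\<^sup>+x. f (x + y) * indicator cell x \<partial>lborel) = (\<integral>\<^sup>+x. f x * indicator cell x \<partial>lborel)"
proof -
  have "periodic (\<lambda>x. f (x + y))"
    by (rule periodic_shift[OF p])
  then have "(\<integral>\<^sup>+x. f (x + y) * indicator cell x \<partial>lborel) = (\<integral>\<^sup>+x. f (x + y) * indicator (fcell (- y)) x \<partial>lborel)"
    by (intro nn_integral_cell_fcell) auto
  also have "\<dots> = (\<integral>\<^sup>+x. f (x + y) * indicator (fcell 0) (x + y) \<partial>lborel)"
  proof -
    have "(- y $ i \<le> x $ i \<and> x $ i < - y $ i + 2 * pi)
        \<longleftrightarrow> (0 \<le> x $ i + y $ i \<and> x $ i + y $ i < 0 + 2 * pi)" for x i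
      by linarith
    then have "indicator (fcell (- y)) x = (indicator (fcell 0) (x + y) :: ennreal)" for x
      by (simp add: indicator_def fcell_def)
    then show ?thesis by simp
  qed
  also have "\<dots> = (\<integral>\<^sup>+x. f x * indicator (fcell 0) x \<partial>lborel)"
    by (rule nn_integral_translate) auto
  also have "\<dots> = (\<integral>\<^sup>+x. f x * indicator cell x \<partial>lborel)"
    by (rule nn_integral_cell_fcell[symmetric]) (use p in auto)
  finally show ?thesis .
qed

lemma integral_cell_shift_nonneg:
  fixes f :: "real^2 \<Rightarrow> real"
  assumes [measurable]: "f \<in> borel_measurable borel" and p: "periodic f" and nn: "\<And>x. 0 \<le> f x"
  shows "(LINT x:cell|lborel. f (x + y)) = (LINT x:cell|lborel. f x)"
proof -
  have *: "ennreal (indicat_real cell x * c) = ennreal c * indicator cell x" for x c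
    by (simp add: indicator_def)
  have "periodic (\<lambda>x. ennreal (f x))" using p by (simp add: periodic_def)
  from nn_integral_cell_shift[OF _ this, of y] show ?thesis
    unfolding set_lebesgue_integral_def
    by (subst (1 2) integral_eq_nn_integral) (auto simp: nn *)
qed

lemma periodic_bounded:
  fixes f :: "real^2 \<Rightarrow> 'a::real_normed_vector"
  assumes "continuous_on UNIV f" "periodic f"
  obtains M where "\<And>x. norm (f x) \<le> M" "M \<ge> 0"
proof -
  have "compact (f ` cell)"
    using continuous_on_subset[OF assms(1)] by (intro compact_continuous_image) (auto simp: cell_def)
  then obtain M where M: "\<forall>y\<in>f ` cell. norm y \<le> M" using compact_imp_bounded bounded_iff by metis
  have "norm (f x) \<le> M" for x
  proof -
    obtain k where "x + lat k \<in> cell" using ex_lat_cell by blast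
    then have "norm (f (x + lat k)) \<le> M" using M by blast
    then show ?thesis by (simp add: periodic_lat[OF assms(2)])
  qed
  moreover from this[of 0] have "M \<ge> 0" using norm_ge_zero order_trans by blast
  ultimately show ?thesis using that by blast
qed

lemma square_integrable_continuous:
  fixes f :: "real^2 \<Rightarrow> 'a::euclidean_space"
  assumes "continuous_on UNIV f" "periodic f"
  shows "square_integrable f"
  by (rule periodic_bounded[OF assms])
     (rule square_integrable_bounded[OF assms(2)], auto intro: borel_measurable_continuous_onI assms)

lemma integral_cell_shift:
  fixes f :: "real^2 \<Rightarrow> real"
  assumes c: "continuous_on UNIV f" and p: "periodic f"
  shows "(LINT x:cell|lborel. f (x + y)) = (LINT x:cell|lborel. f x)"
proof -
  obtain M where M: "\<And>x. norm (f x) \<le> M" using periodic_bounded[OF c p] by metis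
  have p': "periodic (\<lambda>x. f (x + y))"
    by (rule periodic_shift[OF p])
  have c': "continuous_on UNIV (\<lambda>x. f (x + y))"
    by (rule continuous_on_compose2[OF c]) (auto intro!: continuous_intros)
  have i: "set_integrable lborel cell f" "set_integrable lborel cell (\<lambda>x. f (x + y))"
    using L1_le_L2(1)[OF square_integrable_continuous] c p c' p' by auto
  have "(LINT x:cell|lborel. f (x + y) + M) = (LINT x:cell|lborel. f x + M)"
  proof (rule integral_cell_shift_nonneg[where f="\<lambda>x. f x + M"])
    show "(\<lambda>x. f x + M) \<in> borel_measurable borel"
      by (intro borel_measurable_continuous_onI continuous_intros c)
    show "0 \<le> f x + M" for x using M[of x] by auto
  qed (use p in \<open>simp add: periodic_def\<close>)
  then show ?thesis
    by (simp add: set_integral_add(2)[OF i(1) set_integrable_cell_const]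
        set_integral_add(2)[OF i(2) set_integrable_cell_const])
qed

section \<open>Weak derivatives of classically differentiable periodic functions\<close>

text \<open>The integral over the cell is invariant under translation, so the integrals of the
  difference quotients vanish; they are bounded by the mean value theorem and converge to the
  derivative.\<close>

lemma integral_cell_derivative:
  fixes f g :: "real^2 \<Rightarrow> real"
  assumes p: "periodic f" and c: "continuous_on UNIV f" and cg: "continuous_on UNIV g"
    and d: "\<And>x. ((\<lambda>s. f (x + s *\<^sub>R e)) has_real_derivative g x) (at 0)"
  shows "(LINT x:cell|lborel. g x) = 0"
proof -
  have pg: "periodic g"
    unfolding periodic_def
  proof (intro allI)
    fix x i
    have "(\<lambda>s. f (x + axis i (2 * pi) + s *\<^sub>R e)) = (\<lambda>s. f (x + s *\<^sub>R e))"
      by (simp only: periodic_add[OF p])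
    then show "g (x + axis i (2 * pi)) = g x"
      using DERIV_unique[OF d[of "x + axis i (2 * pi)"]] d[of x] by simp
  qed
  obtain M where M: "\<And>x. norm (g x) \<le> M" using periodic_bounded[OF cg pg] by metis
  define h where "h n = 1 / real (Suc n)" for n
  have h: "h n > 0" for n by (simp add: h_def)
  have h0: "h \<longlonglongrightarrow> 0"
    unfolding h_def[abs_def] using LIMSEQ_inverse_real_of_nat by (simp add: inverse_eq_divide)
  define q where "q n x = (f (x + h n *\<^sub>R e) - f x) / h n" for n x
  have d': "((\<lambda>s. f (x + s *\<^sub>R e)) has_real_derivative g (x + s *\<^sub>R e)) (at s)" for x s
    using DERIV_shift[of "\<lambda>s. f (x + s *\<^sub>R e)" "g (x + s *\<^sub>R e)" 0 s] d[of "x + s *\<^sub>R e"]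
    by (simp add: algebra_simps)
  have qb: "\<bar>q n x\<bar> \<le> M" for n x
  proof -
    obtain s where "f (x + h n *\<^sub>R e) - f (x + 0 *\<^sub>R e) = (h n - 0) * g (x + s *\<^sub>R e)"
      using MVT2[OF h d'[of x]] by blast
    then have "q n x = g (x + s *\<^sub>R e)" using h[of n] by (simp add: q_def)
    then show ?thesis using M by simp
  qed
  have qlim: "(\<lambda>n. q n x) \<longlonglongrightarrow> g x" for x
  proof -
    have "((\<lambda>s. (f (x + s *\<^sub>R e) - f x) / s) \<longlongrightarrow> g x) (at 0)"
      using d[of x] by (simp add: DERIV_def)
    moreover have "filterlim h (at 0) sequentially"
      using h0 h by (auto simp: filterlim_at intro!: always_eventually) (metis less_irrefl)
    ultimately show ?thesis unfolding q_def by (rule filterlim_compose)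
  qed
  have qm [measurable]: "q n \<in> borel_measurable borel" for n
    unfolding q_def[abs_def]
    by (intro borel_measurable_continuous_onI continuous_intros continuous_on_compose2[OF c]) (auto simp: h_def)
  have q0: "(LINT x:cell|lborel. q n x) = 0" for n
  proof -
    have c': "continuous_on UNIV (\<lambda>x. f (x + h n *\<^sub>R e))"
      by (rule continuous_on_compose2[OF c]) (auto intro!: continuous_intros)
    have p': "periodic (\<lambda>x. f (x + h n *\<^sub>R e))"
      by (rule periodic_shift[OF p])
    have i: "set_integrable lborel cell f" "set_integrable lborel cell (\<lambda>x. f (x + h n *\<^sub>R e))"
      using L1_le_L2(1)[OF square_integrable_continuous] c p c' p' by auto
    show ?thesis
      unfolding q_def using set_integral_diff(2)[OF i(2,1)] integral_cell_shift[OF c p, of "h n *\<^sub>R e"]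
      by simp
  qed
  have "(\<lambda>n. LINT x:cell|lborel. q n x) \<longlonglongrightarrow> (LINT x:cell|lborel. g x)"
    unfolding set_lebesgue_integral_def
  proof (rule integral_dominated_convergence[where w="\<lambda>x. indicat_real cell x *\<^sub>R M"])
    show "integrable lborel (\<lambda>x. indicat_real cell x *\<^sub>R M)"
      using set_integrable_cell_const[of M] by (simp add: set_integrable_def)
    show "(\<lambda>x. indicat_real cell x *\<^sub>R g x) \<in> borel_measurable lborel"
      using borel_measurable_continuous_onI[OF cg] by measurable
    show "AE x in lborel. (\<lambda>n. indicat_real cell x *\<^sub>R q n x) \<longlonglongrightarrow> indicat_real cell x *\<^sub>R g x"
      by (intro AE_I2 tendsto_intros qlim)
  qed (auto simp: abs_mult qb intro!: mult_left_mono)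
  then show ?thesis by (simp add: q0 LIMSEQ_const_iff)
qed

lemma integral_cell_by_parts:
  fixes f g f' g' :: "real^2 \<Rightarrow> real"
  assumes f: "periodic f" "continuous_on UNIV f" "continuous_on UNIV f'" "periodic f'"
    and g: "periodic g" "continuous_on UNIV g" "continuous_on UNIV g'" "periodic g'"
    and df: "\<And>x. ((\<lambda>s. f (x + s *\<^sub>R e)) has_real_derivative f' x) (at 0)"
    and dg: "\<And>x. ((\<lambda>s. g (x + s *\<^sub>R e)) has_real_derivative g' x) (at 0)"
  shows "(LINT x:cell|lborel. f x * g' x) = - (LINT x:cell|lborel. f' x * g x)"
proof -
  have "(LINT x:cell|lborel. f x * g' x + f' x * g x) = 0"
  proof (rule integral_cell_derivative[where f="\<lambda>x. f x * g x" and e=e])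
    fix x
    show "((\<lambda>s. f (x + s *\<^sub>R e) * g (x + s *\<^sub>R e)) has_real_derivative f x * g' x + f' x * g x) (at 0)"
      using DERIV_mult[OF df[of x] dg[of x]] by (simp add: algebra_simps)
  qed (use f g in \<open>auto simp: periodic_def intro!: continuous_intros\<close>)
  moreover have "set_integrable lborel cell (\<lambda>x. f x * g' x)" "set_integrable lborel cell (\<lambda>x. f' x * g x)"
    using f g by (auto intro!: L1_le_L2(1) square_integrable_continuous continuous_intros simp: periodic_def)
  ultimately show ?thesis by (simp add: set_integral_add(2))
qed

lemma test_function_D:
  assumes "test_function \<phi>"
  shows "periodic \<phi>" "continuous_on UNIV \<phi>" "continuous_on UNIV (partial i \<phi>)" "periodic (partial i \<phi>)"
    "((\<lambda>s. \<phi> (x + s *\<^sub>R axis i 1)) has_real_derivative partial i \<phi> x) (at 0)"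
proof -
  from assms show p: "periodic \<phi>" by (simp add: test_function_def)
  from assms have "C_on (Suc 0) UNIV \<phi>" by (simp add: test_function_def smooth_on_def)
  then have diff: "\<And>x. \<phi> differentiable (at x)"
    and ct: "\<And>v. continuous_on UNIV (\<lambda>x. frechet_derivative \<phi> (at x) v)"
    by auto
  show "continuous_on UNIV \<phi>"
    using diff by (simp add: continuous_on_eq_continuous_at differentiable_imp_continuous_within)
  show "continuous_on UNIV (partial i \<phi>)"
    using ct[of "axis i 1"] by (simp add: partial_def[abs_def])
  show d: "((\<lambda>s. \<phi> (x + s *\<^sub>R axis i 1)) has_real_derivative partial i \<phi> x) (at 0)" for x i
  proof -
    have "(\<phi> has_derivative frechet_derivative \<phi> (at x)) (at (x + 0 *\<^sub>R axis i 1))"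
      using diff frechet_derivative_works by auto
    then have "((\<lambda>s. \<phi> (x + s *\<^sub>R axis i 1)) has_derivative (\<lambda>s. frechet_derivative \<phi> (at x) (s *\<^sub>R axis i 1))) (at 0)"
      by (rule has_derivative_compose[rotated]) (auto intro!: derivative_eq_intros)
    moreover have "(\<lambda>s. frechet_derivative \<phi> (at x) (s *\<^sub>R axis i 1)) = (*) (partial i \<phi> x)"
      using linear_frechet_derivative[OF diff[of x]]
      by (auto simp: partial_def linear_cmul mult.commute)
    ultimately show ?thesis by (simp add: has_field_derivative_def)
  qed
  show "periodic (partial i \<phi>)"
    unfolding periodic_def
  proof (intro allI)
    fix x j
    have "(\<lambda>s. \<phi> (x + axis j (2 * pi) + s *\<^sub>R axis i 1)) = (\<lambda>s. \<phi> (x + s *\<^sub>R axis i 1))"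
      by (simp only: periodic_add[OF p])
    then show "partial i \<phi> (x + axis j (2 * pi)) = partial i \<phi> x"
      using DERIV_unique[OF d[of "x + axis j (2 * pi)" i]] d[of x i] by simp
  qed
qed

text \<open>The representative chosen for a class agrees with the given function only almost everywhere on
  the cell, which is all that an integral over the cell sees.\<close>

lemma integral_rep_abs:
  assumes "square_integrable f"
    and "\<And>x. h x (f x) = k x" "(\<lambda>x. h x (rep_L2 (abs_L2 f) x)) \<in> borel_measurable borel" "k \<in> borel_measurable borel"
  shows "(LINT x:cell|lborel. h x (rep_L2 (abs_L2 f) x)) = (LINT x:cell|lborel. k x :: real)"
  unfolding set_lebesgue_integral_def
proof (rule integral_cong_AE)
  show "AE x in lborel. indicat_real cell x *\<^sub>R h x (rep_L2 (abs_L2 f) x) = indicat_real cell x *\<^sub>R k x"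
    using AE_rep_abs[OF assms(1)] by eventually_elim (use assms(2) in \<open>auto simp: indicator_def\<close>)
qed (use assms(3,4) in auto)

lemma rep_L2_measurable [measurable]: "rep_L2 f \<in> borel_measurable borel"
  using square_integrable_rep[of f] by (simp add: square_integrable_def)

lemma vec_nth_measurable [measurable]: "(\<lambda>x :: real^2. x $ i) \<in> borel_measurable borel"
  by (intro borel_measurable_continuous_onI continuous_intros)

lemma weak_gradI:
  fixes b :: "real^2 \<Rightarrow> real" and G :: "real^2 \<Rightarrow> real^2"
  assumes b: "periodic b" "continuous_on UNIV b" and G: "periodic G" "continuous_on UNIV G"
    and d: "\<And>x i. ((\<lambda>s. b (x + s *\<^sub>R axis i 1)) has_real_derivative G x $ i) (at 0)"
  shows "weak_grad (abs_L2 b) (abs_L2 G)"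
  unfolding weak_grad_def
proof (intro allI impI)
  fix \<phi> i assume phi: "test_function \<phi>"
  note T = test_function_D[OF phi]
  note m = borel_measurable_continuous_onI[OF T(2)] borel_measurable_continuous_onI[OF T(3)[of i]]
    borel_measurable_continuous_onI[OF b(2)] borel_measurable_continuous_onI[OF G(2)]
  note [measurable] = m
  have "(LINT x:cell|lborel. rep_L2 (abs_L2 b) x * partial i \<phi> x) = (LINT x:cell|lborel. b x * partial i \<phi> x)"
    by (rule integral_rep_abs[OF square_integrable_continuous[OF b(2,1)]]) auto
  also have "\<dots> = - (LINT x:cell|lborel. G x $ i * \<phi> x)"
    by (rule integral_cell_by_parts[where e="axis i 1"])
       (use b G T d in \<open>auto simp: periodic_def intro!: continuous_intros\<close>)
  also have "(LINT x:cell|lborel. G x $ i * \<phi> x) = (LINT x:cell|lborel. rep_L2 (abs_L2 G) x $ i * \<phi> x)"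
    by (rule integral_rep_abs[OF square_integrable_continuous[OF G(2,1)], symmetric]) auto
  finally show "(LINT x:cell|lborel. rep_L2 (abs_L2 b) x * partial i \<phi> x)
      = - (LINT x:cell|lborel. rep_L2 (abs_L2 G) x $ i * \<phi> x)" .
qed

lemma weak_curlI:
  fixes E :: "real^2 \<Rightarrow> real^2" and D21 D12 :: "real^2 \<Rightarrow> real"
  assumes E: "periodic E" "continuous_on UNIV E"
    and D21: "periodic D21" "continuous_on UNIV D21" and D12: "periodic D12" "continuous_on UNIV D12"
    and d21: "\<And>x. ((\<lambda>s. E (x + s *\<^sub>R axis 1 1) $ 2) has_real_derivative D21 x) (at 0)"
    and d12: "\<And>x. ((\<lambda>s. E (x + s *\<^sub>R axis 2 1) $ 1) has_real_derivative D12 x) (at 0)"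
  shows "weak_curl (abs_L2 E) (abs_L2 (\<lambda>x. D21 x - D12 x))"
  unfolding weak_curl_def
proof (intro allI impI)
  fix \<phi> assume phi: "test_function \<phi>"
  note T = test_function_D[OF phi]
  note m = borel_measurable_continuous_onI[OF T(2)] borel_measurable_continuous_onI[OF T(3)]
    borel_measurable_continuous_onI[OF E(2)] borel_measurable_continuous_onI[OF D21(2)]
    borel_measurable_continuous_onI[OF D12(2)]
  note [measurable] = m
  have si: "set_integrable lborel cell (\<lambda>x. E x $ 2 * partial 1 \<phi> x)"
     "set_integrable lborel cell (\<lambda>x. E x $ 1 * partial 2 \<phi> x)"
     "set_integrable lborel cell (\<lambda>x. D21 x * \<phi> x)" "set_integrable lborel cell (\<lambda>x. D12 x * \<phi> x)"
    using T E D21 D12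
    by (auto intro!: L1_le_L2(1) square_integrable_continuous continuous_intros simp: periodic_def)
  have "(LINT x:cell|lborel. rep_L2 (abs_L2 E) x $ 2 * partial 1 \<phi> x - rep_L2 (abs_L2 E) x $ 1 * partial 2 \<phi> x)
      = (LINT x:cell|lborel. E x $ 2 * partial 1 \<phi> x - E x $ 1 * partial 2 \<phi> x)"
    by (rule integral_rep_abs[OF square_integrable_continuous[OF E(2,1)]]) auto
  also have "\<dots> = (LINT x:cell|lborel. E x $ 2 * partial 1 \<phi> x) - (LINT x:cell|lborel. E x $ 1 * partial 2 \<phi> x)"
    using si by (simp add: set_integral_diff)
  also have "(LINT x:cell|lborel. E x $ 2 * partial 1 \<phi> x) = - (LINT x:cell|lborel. D21 x * \<phi> x)"
    by (rule integral_cell_by_parts[where e="axis 1 1"])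
       (use E T D21 d21 in \<open>auto simp: periodic_def intro!: continuous_intros\<close>)
  also have "(LINT x:cell|lborel. E x $ 1 * partial 2 \<phi> x) = - (LINT x:cell|lborel. D12 x * \<phi> x)"
    by (rule integral_cell_by_parts[where e="axis 2 1"])
       (use E T D12 d12 in \<open>auto simp: periodic_def intro!: continuous_intros\<close>)
  also have "- (LINT x:cell|lborel. D21 x * \<phi> x) - - (LINT x:cell|lborel. D12 x * \<phi> x)
      = - (LINT x:cell|lborel. (D21 x - D12 x) * \<phi> x)"
    using si by (simp add: set_integral_diff left_diff_distrib)
  also have "(LINT x:cell|lborel. (D21 x - D12 x) * \<phi> x)
      = (LINT x:cell|lborel. rep_L2 (abs_L2 (\<lambda>x. D21 x - D12 x)) x * \<phi> x)"
    by (rule integral_rep_abs[OF square_integrable_continuous, symmetric])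
       (use D21 D12 in \<open>auto simp: periodic_def intro!: continuous_intros\<close>)
  finally show "(LINT x:cell|lborel. rep_L2 (abs_L2 E) x $ 2 * partial 1 \<phi> x - rep_L2 (abs_L2 E) x $ 1 * partial 2 \<phi> x)
      = - (LINT x:cell|lborel. rep_L2 (abs_L2 (\<lambda>x. D21 x - D12 x)) x * \<phi> x)" .
qed

section \<open>Curves in \<open>L\<^sup>2\<close> given by continuous functions\<close>

text \<open>By periodicity a uniform estimate in \<open>x\<close> has to be checked on the cell only, and the cell is
  compact.\<close>

lemma periodic_uniformly_close:
  fixes F :: "'t::metric_space \<Rightarrow> real^2 \<Rightarrow> 'a::real_normed_vector"
  assumes p: "\<And>t. t \<in> K \<Longrightarrow> periodic (F t)"
    and c: "continuous_on (K \<times> UNIV) (\<lambda>(t, x). F t x)" and t0: "t0 \<in> K" and e: "e > 0"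
  shows "\<exists>d>0. \<forall>t\<in>K. dist t t0 < d \<longrightarrow> (\<forall>x. norm (F t x - F t0 x) \<le> e)"
proof -
  have "continuous_on (K \<times> cell) (\<lambda>(t, x). F t x)"
    by (rule continuous_on_subset[OF c]) auto
  moreover have "compact cell" by (simp add: cell_def)
  ultimately obtain X0 where X0: "t0 \<in> X0" "open X0"
    and *: "\<forall>t\<in>X0 \<inter> K. \<forall>x\<in>cell. dist (F t x) (F t0 x) \<le> e"
    using continuous_on_prod_compactE[of K cell "\<lambda>(t, x). F t x" t0 e] t0 e by (auto simp: split_beta)
  obtain d where d: "d > 0" "ball t0 d \<subseteq> X0" using X0 openE by blast
  have "norm (F t x - F t0 x) \<le> e" if t: "t \<in> K" "dist t t0 < d" for t x
  proof -
    obtain k where k: "x + lat k \<in> cell" using ex_lat_cell by blast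
    have "t \<in> X0 \<inter> K" using d t by (auto simp: mem_ball dist_commute subset_iff)
    then have "norm (F t (x + lat k) - F t0 (x + lat k)) \<le> e" using * k by (auto simp: dist_norm)
    then show ?thesis by (simp add: periodic_lat[OF p[OF t(1)]] periodic_lat[OF p[OF t0]])
  qed
  with d show ?thesis by blast
qed

lemma continuous_slice:
  assumes "continuous_on (K \<times> UNIV) (\<lambda>(t, x). F t x)" "t \<in> K"
  shows "continuous_on UNIV (F t)"
proof -
  have "continuous_on UNIV (\<lambda>x. (t, x))" by (intro continuous_intros)
  moreover have "continuous_on (range (\<lambda>x. (t, x))) (\<lambda>(t, x). F t x)"
    by (rule continuous_on_subset[OF assms(1)]) (use assms(2) in auto)
  ultimately have "continuous_on UNIV ((\<lambda>(t, x). F t x) \<circ> (\<lambda>x. (t, x)))"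
    by (rule continuous_on_compose)
  then show ?thesis by (simp add: o_def)
qed

lemma square_integrable_slice:
  fixes F :: "'t::metric_space \<Rightarrow> real^2 \<Rightarrow> 'a::euclidean_space"
  assumes "\<And>t. t \<in> K \<Longrightarrow> periodic (F t)" "continuous_on (K \<times> UNIV) (\<lambda>(t, x). F t x)" "t \<in> K"
  shows "square_integrable (F t)"
  using assms continuous_slice square_integrable_continuous by metis

lemma continuous_on_abs_L2:
  fixes F :: "'t::metric_space \<Rightarrow> real^2 \<Rightarrow> 'a::euclidean_space"
  assumes p: "\<And>t. t \<in> K \<Longrightarrow> periodic (F t)" and c: "continuous_on (K \<times> UNIV) (\<lambda>(t, x). F t x)"
  shows "continuous_on K (\<lambda>t. abs_L2 (F t))"
  unfolding continuous_on_iff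
proof (intro ballI allI impI)
  fix t0 e assume t0: "t0 \<in> K" and e: "(0::real) < e"
  note si = square_integrable_slice[OF p c]
  have "e / (4 * pi) > 0" using e by simp
  from periodic_uniformly_close[OF p c t0 this] obtain d
    where d: "d > 0" "\<And>t x. t \<in> K \<Longrightarrow> dist t t0 < d \<Longrightarrow> norm (F t x - F t0 x) \<le> e / (4 * pi)"
    by blast
  have "dist (abs_L2 (F t)) (abs_L2 (F t0)) < e" if t: "t \<in> K" "dist t t0 < d" for t
  proof -
    have "norm (abs_L2 (\<lambda>x. F t x - F t0 x)) \<le> 2 * pi * (e / (4 * pi))"
      using d(2)[OF t] by (intro norm_abs_L2_le square_integrable_diff si t t0)
    also have "\<dots> < e" using e by simp
    finally show ?thesis using t t0 by (simp add: dist_norm abs_L2_diff si)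
  qed
  with d(1) show "\<exists>d>0. \<forall>t\<in>K. dist t t0 < d \<longrightarrow> dist (abs_L2 (F t)) (abs_L2 (F t0)) < e" by blast
qed

text \<open>The error of the linearisation is controlled by the oscillation of the time derivative, which is
  uniformly small in \<open>x\<close>; so classical derivatives in time of periodic functions are derivatives of
  curves in \<open>L\<^sup>2\<close>.\<close>

lemma abs_L2_has_vector_derivative:
  fixes F F' :: "real \<Rightarrow> real^2 \<Rightarrow> 'a::euclidean_space"
  assumes p: "\<And>t. t \<in> {a..b} \<Longrightarrow> periodic (F t)" "\<And>t. t \<in> {a..b} \<Longrightarrow> periodic (F' t)"
    and c: "continuous_on ({a..b} \<times> UNIV) (\<lambda>(t, x). F t x)" "continuous_on ({a..b} \<times> UNIV) (\<lambda>(t, x). F' t x)"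
    and d: "\<And>t x. t \<in> {a..b} \<Longrightarrow> ((\<lambda>t. F t x) has_vector_derivative F' t x) (at t within {a..b})"
    and t0: "t0 \<in> {a..b}"
  shows "((\<lambda>t. abs_L2 (F t)) has_vector_derivative abs_L2 (F' t0)) (at t0 within {a..b})"
  unfolding has_vector_derivative_def has_derivative_within_alt
proof (intro conjI allI impI)
  show "bounded_linear (\<lambda>x. x *\<^sub>R abs_L2 (F' t0))" by (rule bounded_linear_scaleR_left)
  fix e :: real assume e: "e > 0"
  note si = square_integrable_slice[OF p(1) c(1)] square_integrable_slice[OF p(2) c(2)]
  have "e / (2 * pi) > 0" using e by simp
  from periodic_uniformly_close[OF p(2) c(2) t0 this] obtain \<delta>
    where \<delta>: "\<delta> > 0" "\<And>t x. t \<in> {a..b} \<Longrightarrow> dist t t0 < \<delta> \<Longrightarrow> norm (F' t x - F' t0 x) \<le> e / (2 * pi)"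
    by blast
  have "norm (abs_L2 (F t) - abs_L2 (F t0) - (t - t0) *\<^sub>R abs_L2 (F' t0)) \<le> e * norm (t - t0)"
    if t: "t \<in> {a..b}" "norm (t - t0) < \<delta>" for t
  proof -
    have seg: "closed_segment t0 t \<subseteq> {a..b}" using t t0 by (auto simp: closed_segment_eq_real_ivl)
    have "norm (F t x - F t0 x - (t - t0) *\<^sub>R F' t0 x) \<le> norm (t - t0) * (e / (2 * pi))" for x
    proof (rule vector_differentiable_bound_linearization[where S="closed_segment t0 t"])
      fix s assume s: "s \<in> closed_segment t0 t"
      then show "((\<lambda>t. F t x) has_vector_derivative F' s x) (at s within closed_segment t0 t)"
        using d seg by (blast intro: has_vector_derivative_within_subset)
      have "dist s t0 \<le> dist t t0" using s by (auto simp: closed_segment_eq_real_ivl dist_real_def split: if_splits)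
      then show "norm (F' s x - F' t0 x) \<le> e / (2 * pi)"
        using \<delta>(2)[of s x] s seg t(2) by (auto simp: dist_norm)
    qed auto
    then have "norm (abs_L2 (\<lambda>x. F t x - F t0 x - (t - t0) *\<^sub>R F' t0 x)) \<le> 2 * pi * (norm (t - t0) * (e / (2 * pi)))"
      using t t0 by (intro norm_abs_L2_le square_integrable_diff square_integrable_scaleR si) auto
    moreover have "abs_L2 (F t) - abs_L2 (F t0) - (t - t0) *\<^sub>R abs_L2 (F' t0)
        = abs_L2 (\<lambda>x. F t x - F t0 x - (t - t0) *\<^sub>R F' t0 x)"
      using si(1)[OF _ t(1)] si(1)[OF _ t0] si(2)[OF _ t0]
      by (simp add: abs_L2_diff abs_L2_scaleR square_integrable_diff square_integrable_scaleR)
    ultimately show ?thesis by (simp add: mult.commute)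
  qed
  with \<delta>(1) show "\<exists>d>0. \<forall>y\<in>{a..b}. norm (y - t0) < d \<longrightarrow>
      norm (abs_L2 (F y) - abs_L2 (F t0) - (y - t0) *\<^sub>R abs_L2 (F' t0)) \<le> e * norm (y - t0)"
    by blast
qed

section \<open>The principle of uniform boundedness\<close>

text \<open>Some \<open>w\<close> of norm \<open>r\<close> nearly realises the operator norm, and \<open>2 f w = f (x + w) - f (x - w)\<close>, so
  one of the two end points has a large image, wherever the centre \<open>x\<close> is.\<close>

lemma ex_large_value_in_ball:
  fixes f :: "'a::real_normed_vector \<Rightarrow>\<^sub>L 'b::real_normed_vector"
  assumes r: "r > 0"
  shows "\<exists>y. norm (y - x) \<le> r \<and> norm (f y) \<ge> 2 / 3 * r * norm f"
proof (cases "norm f = 0")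
  case True
  then show ?thesis using r by (intro exI[of _ x]) auto
next
  case False
  have "\<exists>v. norm (f v) > 2 / 3 * norm f * norm v"
  proof (rule ccontr)
    assume "\<nexists>v. norm (f v) > 2 / 3 * norm f * norm v"
    then have "norm f \<le> 2 / 3 * norm f"
      by (intro norm_blinfun_bound) (auto simp: not_less)
    with False show False using norm_ge_zero[of f] by linarith
  qed
  then obtain v where v: "norm (f v) > 2 / 3 * norm f * norm v" by blast
  then have "v \<noteq> 0" by (auto simp: blinfun.zero_right)
  define w where "w = (r / norm v) *\<^sub>R v"
  have nw: "norm w = r" using \<open>v \<noteq> 0\<close> r by (simp add: w_def)
  have "norm (f w) = r / norm v * norm (f v)" using r by (simp add: w_def blinfun.scaleR_right)
  also have "\<dots> \<ge> r / norm v * (2 / 3 * norm f * norm v)"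
    using v r by (intro mult_left_mono) auto
  also have "r / norm v * (2 / 3 * norm f * norm v) = 2 / 3 * r * norm f"
    using \<open>v \<noteq> 0\<close> by simp
  finally have fw: "norm (f w) \<ge> 2 / 3 * r * norm f" .
  have "f (x + w) - f (x - w) = 2 *\<^sub>R f w"
    by (simp add: blinfun.add_right blinfun.diff_right scaleR_2)
  then have "2 * norm (f w) \<le> norm (f (x + w)) + norm (f (x - w))"
    using norm_triangle_ineq4[of "f (x + w)" "f (x - w)"] by simp
  then have "norm (f (x + w)) \<ge> norm (f w) \<or> norm (f (x - w)) \<ge> norm (f w)" by linarith
  then show ?thesis
  proof
    assume "norm (f (x + w)) \<ge> norm (f w)"
    with fw nw show ?thesis by (intro exI[of _ "x + w"]) auto
  next
    assume "norm (f (x - w)) \<ge> norm (f w)"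
    with fw nw show ?thesis by (intro exI[of _ "x - w"]) auto
  qed
qed

text \<open>A gliding hump, without Baire category: pass to operators of norm at least \<open>4\<^sup>k\<close> and move
  successively by at most \<open>r\<^sub>k = 3\<^sup>-\<^sup>k\<^sup>-\<^sup>1\<close> to a point where the value of the \<open>k\<close>-th of them is at
  least \<open>2/3 r\<^sub>k\<close> times its norm. All later moves together have length at most \<open>r\<^sub>k / 2\<close>, so that at
  the limit the value is still at least a multiple of \<open>(4/3)\<^sup>k\<close>.\<close>

lemma uniform_boundedness:
  fixes f :: "nat \<Rightarrow> 'a::banach \<Rightarrow>\<^sub>L 'b::real_normed_vector"
  assumes lim: "filterlim (\<lambda>n. norm (f n)) at_top sequentially"
  shows "\<exists>x. \<forall>K. \<exists>n. norm (f n x) > K"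
proof -
  have "\<exists>n. norm (f n) \<ge> 4 ^ k" for k :: nat
    using lim unfolding filterlim_at_top by (metis eventually_sequentially order_refl)
  then obtain m where m: "\<And>k. norm (f (m k)) \<ge> 4 ^ k" by metis
  have "\<exists>x :: nat \<Rightarrow> 'a. \<forall>k. True \<and> norm (x (Suc k) - x k) \<le> (1/3) ^ Suc k \<and>
      norm (f (m k) (x (Suc k))) \<ge> 2 / 3 * (1/3) ^ Suc k * norm (f (m k))"
  proof (rule dependent_nat_choice)
    fix y :: 'a and k
    have "(1/3 :: real) ^ Suc k > 0" by simp
    from ex_large_value_in_ball[OF this, of y "f (m k)"]
    show "\<exists>z. True \<and> norm (z - y) \<le> (1/3) ^ Suc k \<and>
        norm (f (m k) z) \<ge> 2 / 3 * (1/3) ^ Suc k * norm (f (m k))"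
      by blast
  qed auto
  then obtain x where x: "\<And>k. norm (x (Suc k) - x k) \<le> (1/3) ^ Suc k"
    and fx: "\<And>k. norm (f (m k) (x (Suc k))) \<ge> 2 / 3 * (1/3) ^ Suc k * norm (f (m k))"
    by blast
  have near: "norm (x (k + j) - x k) \<le> (1/3) ^ k / 2 * (1 - (1/3) ^ j)" for k j
  proof (induction j)
    case (Suc j)
    have "norm (x (k + Suc j) - x k) \<le> norm (x (Suc (k + j)) - x (k + j)) + norm (x (k + j) - x k)"
      using norm_triangle_ineq[of "x (Suc (k + j)) - x (k + j)" "x (k + j) - x k"] by simp
    also have "\<dots> \<le> (1/3) ^ Suc (k + j) + (1/3) ^ k / 2 * (1 - (1/3) ^ j)"
      using x Suc by (intro add_mono) auto
    also have "\<dots> = (1/3) ^ k / 2 * (1 - (1/3) ^ Suc j)"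
      by (simp add: power_add field_simps)
    finally show ?case .
  qed simp
  have near': "norm (x (k + j) - x k) \<le> (1/3) ^ k / 2" for k j
  proof -
    have "(1/3::real) ^ k / 2 * (1 - (1/3) ^ j) \<le> (1/3) ^ k / 2 * 1"
      by (intro mult_left_mono) auto
    with near[of k j] show ?thesis by linarith
  qed
  have "Cauchy x"
  proof (rule metric_CauchyI)
    fix e :: real assume "e > 0"
    then obtain k where k: "(1/3::real) ^ k < e" using real_arch_pow_inv[of e "1/3"] by auto
    have "dist (x a) (x b) < e" if "a \<ge> k" "b \<ge> k" for a b
    proof -
      have "dist (x a) (x b) \<le> norm (x a - x k) + norm (x b - x k)"
        by (metis dist_norm dist_triangle2)
      also have "\<dots> \<le> (1/3) ^ k / 2 + (1/3) ^ k / 2"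
        using near'[of k "a - k"] near'[of k "b - k"] that by (intro add_mono) auto
      finally show ?thesis using k by simp
    qed
    then show "\<exists>M. \<forall>m\<ge>M. \<forall>n\<ge>M. dist (x m) (x n) < e" by blast
  qed
  then obtain l where l: "x \<longlonglongrightarrow> l" using Cauchy_convergent_iff convergent_def by blast
  have l_near: "norm (l - x k) \<le> (1/3) ^ k / 2" for k
  proof (rule LIMSEQ_le_const2)
    show "(\<lambda>j. norm (x (j + k) - x k)) \<longlonglongrightarrow> norm (l - x k)"
      by (intro tendsto_intros LIMSEQ_ignore_initial_segment l)
    show "\<exists>N. \<forall>n\<ge>N. norm (x (n + k) - x k) \<le> (1/3) ^ k / 2"
      using near'[of k] by (simp add: add.commute)
  qed
  have big: "norm (f (m k) l) \<ge> (4/3) ^ k / 18" for k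
  proof -
    have "norm (f (m k) (x (Suc k))) \<le> norm (f (m k) l) + norm (f (m k) (l - x (Suc k)))"
      using norm_triangle_ineq4[of "f (m k) l" "f (m k) (l - x (Suc k))"] by (simp add: blinfun.diff_right)
    also have "norm (f (m k) (l - x (Suc k))) \<le> norm (f (m k)) * ((1/3) ^ Suc k / 2)"
      using norm_blinfun[of "f (m k)" "l - x (Suc k)"] l_near[of "Suc k"]
      by (meson mult_left_mono norm_ge_zero order_trans)
    finally have "norm (f (m k) l) \<ge> (1/3) ^ k * norm (f (m k)) / 18"
      using fx[of k] by (simp add: field_simps)
    moreover have "(1/3) ^ k * norm (f (m k)) \<ge> (1/3) ^ k * 4 ^ k"
      using m[of k] by (intro mult_left_mono) auto
    moreover have "(1/3) ^ k * 4 ^ k = (4/3 :: real) ^ k" by (simp add: power_divide)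
    ultimately show ?thesis by linarith
  qed
  have "\<exists>n. norm (f n l) > K" for K
  proof -
    obtain k where "(4/3::real) ^ k > 18 * K" using real_arch_pow[of "4/3" "18 * K"] by auto
    then have "norm (f (m k) l) > K" using big[of k] by linarith
    then show ?thesis by blast
  qed
  then show ?thesis by blast
qed

section \<open>Contraction semigroups with bounded time-dependent perturbations\<close>

locale contraction_semigroup =
  fixes S :: "real \<Rightarrow> 'a::banach \<Rightarrow>\<^sub>L 'a" and A :: "('a \<times> 'a) set"
  assumes gen: "contraction_semigroup_generated_by S A"
begin

lemma S_0 [simp]: "S 0 x = x"
  using gen by (simp add: contraction_semigroup_generated_by_def)

lemma S_add: "s \<ge> 0 \<Longrightarrow> t \<ge> 0 \<Longrightarrow> S (s + t) x = S s (S t x)"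
  using gen by (simp add: contraction_semigroup_generated_by_def)

lemma S_cont: "continuous_on {0..} (\<lambda>t. S t x)"
  using gen by (simp add: contraction_semigroup_generated_by_def)

lemma norm_S: "t \<ge> 0 \<Longrightarrow> norm (S t x) \<le> norm x"
proof -
  assume "t \<ge> 0"
  then have "norm (S t) \<le> 1" using gen by (simp add: contraction_semigroup_generated_by_def)
  then show ?thesis using norm_blinfun[of "S t" x] mult_right_mono[of "norm (S t)" 1 "norm x"] by simp
qed

lemma S_generator:
  "(x, z) \<in> A \<longleftrightarrow> ((\<lambda>h. (S h x - x) /\<^sub>R h) \<longlongrightarrow> z) (at_right 0)"
  using gen by (simp add: contraction_semigroup_generated_by_def)

lemma continuous_on_S:
  fixes f :: "'t::topological_space \<Rightarrow> real"
  assumes f: "continuous_on K f" and g: "continuous_on K g" and nn: "\<And>x. x \<in> K \<Longrightarrow> f x \<ge> 0"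
  shows "continuous_on K (\<lambda>x. S (f x) (g x))"
  unfolding continuous_on_def
proof (intro ballI)
  fix x0 assume x0: "x0 \<in> K"
  have "continuous_on K (\<lambda>x. S (f x) (g x0))"
    by (rule continuous_on_compose2[OF S_cont f]) (use nn in auto)
  then have 1: "((\<lambda>x. S (f x) (g x0)) \<longlongrightarrow> S (f x0) (g x0)) (at x0 within K)"
    using x0 by (simp add: continuous_on_def)
  have "((\<lambda>x. g x - g x0) \<longlongrightarrow> 0) (at x0 within K)"
    using g x0 by (simp add: continuous_on_def LIM_zero_iff)
  then have 2: "((\<lambda>x. S (f x) (g x - g x0)) \<longlongrightarrow> 0) (at x0 within K)"
    by (rule Lim_null_comparison[rotated, OF tendsto_norm_zero])
       (auto simp: eventually_at_filter nn intro!: norm_S always_eventually)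
  from tendsto_add[OF 1 2] show "((\<lambda>x. S (f x) (g x)) \<longlongrightarrow> S (f x0) (g x0)) (at x0 within K)"
    by (simp add: blinfun.diff_right)
qed

text \<open>The Duhamel integral of a source term.\<close>

definition conv :: "(real \<Rightarrow> 'a) \<Rightarrow> real \<Rightarrow> 'a" where
  "conv F t = integral {0..t} (\<lambda>s. S (t - s) (F s))"

lemma conv_integrand:
  assumes "continuous_on {0..T} F" "t \<in> {0..T}"
  shows "(\<lambda>s. S (t - s) (F s)) integrable_on {0..t}"
    and "((\<lambda>s. S (t - s) (F s)) has_integral conv F t) {0..t}"
proof -
  have "continuous_on {0..t} (\<lambda>s. S (t - s) (F s))"
    by (intro continuous_on_S continuous_intros continuous_on_subset[OF assms(1)]) (use assms(2) in auto)
  then show "(\<lambda>s. S (t - s) (F s)) integrable_on {0..t}"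
    using integrable_continuous_real by blast
  then show "((\<lambda>s. S (t - s) (F s)) has_integral conv F t) {0..t}"
    unfolding conv_def by (rule integrable_integral)
qed

lemma conv_diff:
  assumes "continuous_on {0..T} F" "continuous_on {0..T} G" "t \<in> {0..T}"
  shows "conv F t - conv G t = conv (\<lambda>s. F s - G s) t"
  unfolding conv_def
  using conv_integrand(1)[OF assms(1,3)] conv_integrand(1)[OF assms(2,3)]
  by (simp add: blinfun.diff_right Henstock_Kurzweil_Integration.integral_diff)

text \<open>After rescaling to the unit interval the convolution is an integral over a fixed interval
  that depends continuously on a parameter.\<close>

lemma continuous_on_conv:
  assumes F: "continuous_on {0..T} F"
  shows "continuous_on {0..T} (conv F)"
proof -
  have *: "conv F t = t *\<^sub>R integral (cbox 0 1) (\<lambda>\<theta>. S (t - t * \<theta>) (F (t * \<theta>)))" if t: "t \<in> {0..T}" for t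
  proof (cases "t = 0")
    case True
    then show ?thesis by (simp add: conv_def)
  next
    case False
    with t have t0: "t > 0" by simp
    have "((\<lambda>s. S (t - s) (F s)) has_integral conv F t) (cbox 0 t)"
      using conv_integrand(2)[OF F t] by simp
    from has_integral_affinity'[OF this t0, of 0]
    have "((\<lambda>\<theta>. S (t - t * \<theta>) (F (t * \<theta>))) has_integral conv F t /\<^sub>R t) (cbox 0 1)"
      using t0 by simp
    then show ?thesis using t0 by (simp add: integral_unique)
  qed
  have sub: "t * \<theta> \<in> {0..T}" "t - t * \<theta> \<ge> 0" if "t \<in> {0..T}" "\<theta> \<in> cbox 0 1" for t \<theta> :: real
    using that mult_left_mono[of \<theta> 1 t] by auto
  have "continuous_on ({0..T} \<times> cbox 0 1) (\<lambda>p. S (fst p - fst p * snd p) (F (fst p * snd p)))"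
    by (intro continuous_on_S continuous_intros continuous_on_compose2[OF F]) (use sub in auto)
  then have "continuous_on {0..T} (\<lambda>t. integral (cbox 0 1) (\<lambda>\<theta>. S (t - t * \<theta>) (F (t * \<theta>))))"
    by (intro integral_continuous_on_param) (simp add: split_beta)
  then have "continuous_on {0..T} (\<lambda>t. t *\<^sub>R integral (cbox 0 1) (\<lambda>\<theta>. S (t - t * \<theta>) (F (t * \<theta>))))"
    by (intro continuous_intros)
  then show ?thesis by (rule continuous_on_eq) (rule *[symmetric])
qed

lemma norm_conv_le:
  assumes F: "continuous_on {0..T} F" and t: "t \<in> {0..T}" and b: "\<And>s. s \<in> {0..T} \<Longrightarrow> norm (F s) \<le> r"
  shows "norm (conv F t) \<le> T * r"
proof -
  have "norm (F t) \<le> r" by (rule b[OF t])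
  then have "r \<ge> 0" using norm_ge_zero[of "F t"] by linarith
  have "norm (conv F t) \<le> r * (t - 0)"
    unfolding conv_def
  proof (rule integral_bound[OF _ _ ])
    show "continuous_on {0..t} (\<lambda>s. S (t - s) (F s))"
      by (intro continuous_on_S continuous_intros continuous_on_subset[OF F]) (use t in auto)
    fix s assume "s \<in> {0..t}"
    then show "norm (S (t - s) (F s)) \<le> r"
      using norm_S[of "t - s" "F s"] b[of s] t by auto
  qed (use t in auto)
  also have "\<dots> \<le> T * r" using t \<open>r \<ge> 0\<close> mult_left_mono[of t T r] by (simp add: mult.commute)
  finally show ?thesis .
qed

text \<open>The exponential weight with exponent \<open>2M\<close> turns a perturbation of size \<open>M\<close> into a
  contraction with constant \<open>1/2\<close> on the whole time interval.\<close>

lemma norm_conv_le_exp: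
  assumes F: "continuous_on {0..T} F" and t: "t \<in> {0..T}" and M: "M > 0"
    and b: "\<And>s. s \<in> {0..T} \<Longrightarrow> norm (F s) \<le> M * (K * exp (2 * M * s))"
  shows "norm (conv F t) \<le> K / 2 * exp (2 * M * t)"
proof -
  have K: "K \<ge> 0"
    using order_trans[OF norm_ge_zero b[of 0]] t M by (simp add: zero_le_mult_iff)
  have hi: "((\<lambda>s. M * (K * exp (2 * M * s))) has_integral K / 2 * exp (2 * M * t) - K / 2 * exp (2 * M * 0)) {0..t}"
    by (rule fundamental_theorem_of_calculus)
       (use t M in \<open>auto intro!: derivative_eq_intros simp flip: has_real_derivative_iff_has_vector_derivative\<close>)
  have "norm (conv F t) \<le> integral {0..t} (\<lambda>s. M * (K * exp (2 * M * s)))"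
    unfolding conv_def
  proof (rule integral_norm_bound_integral)
    fix s assume "s \<in> {0..t}"
    then show "norm (S (t - s) (F s)) \<le> M * (K * exp (2 * M * s))"
      using norm_S[of "t - s" "F s"] b[of s] t by auto
  qed (use conv_integrand(1)[OF F t] hi in auto)
  also have "\<dots> \<le> K / 2 * exp (2 * M * t)"
    using integral_unique[OF hi] K by simp
  finally show ?thesis .
qed

end

locale perturbed_semigroup = contraction_semigroup +
  fixes T M :: real and B :: "real \<Rightarrow> 'a \<Rightarrow> 'a"
  assumes T: "T \<ge> 0" and M: "M > 0"
    and B_linear: "\<And>t. t \<in> {0..T} \<Longrightarrow> linear (B t)"
    and B_bound: "\<And>t x. t \<in> {0..T} \<Longrightarrow> norm (B t x) \<le> M * norm x"
    and B_cont: "continuous_on ({0..T} \<times> UNIV) (\<lambda>(t, x). B t x)"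
begin

definition mild :: "'a \<Rightarrow> (real \<Rightarrow> 'a) \<Rightarrow> bool" where
  "mild x0 X \<longleftrightarrow> continuous_on {0..T} X \<and> (\<forall>t\<in>{0..T}. X t = S t x0 + conv (\<lambda>s. B s (X s)) t)"

lemma continuous_on_B:
  assumes "continuous_on {0..T} X"
  shows "continuous_on {0..T} (\<lambda>s. B s (X s))"
proof -
  have "continuous_on {0..T} (\<lambda>s. (s, X s))" by (intro continuous_intros assms)
  from continuous_on_compose2[OF B_cont this] show ?thesis by auto
qed

text \<open>Where the norm with the exponential weight is maximal, the Duhamel term takes up at most half of
  it, and the remaining half is bounded by \<open>c\<close>.\<close>

lemma gronwall:
  assumes X: "continuous_on {0..T} X"
    and le: "\<And>t. t \<in> {0..T} \<Longrightarrow> norm (X t) \<le> c + norm (conv (\<lambda>s. B s (X s)) t)" and c: "c \<ge> 0"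
    and t: "t \<in> {0..T}"
  shows "norm (X t) \<le> 2 * c * exp (2 * M * t)"
proof -
  have "continuous_on {0..T} (\<lambda>t. norm (X t) * exp (- (2 * M * t)))"
    by (intro continuous_intros X)
  from continuous_attains_sup[OF compact_Icc _ this] T
  obtain t1 where t1: "t1 \<in> {0..T}"
    and max: "\<And>s. s \<in> {0..T} \<Longrightarrow> norm (X s) * exp (- (2 * M * s)) \<le> norm (X t1) * exp (- (2 * M * t1))"
    by auto
  define K where "K = norm (X t1) * exp (- (2 * M * t1))"
  have XK: "norm (X s) \<le> K * exp (2 * M * s)" if "s \<in> {0..T}" for s
    using max[OF that] by (simp add: K_def exp_minus field_simps)
  have "norm (conv (\<lambda>s. B s (X s)) t1) \<le> K / 2 * exp (2 * M * t1)"
  proof (rule norm_conv_le_exp[OF continuous_on_B[OF X] t1 M])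
    fix s assume s: "s \<in> {0..T}"
    have "norm (B s (X s)) \<le> M * norm (X s)" by (rule B_bound[OF s])
    also have "\<dots> \<le> M * (K * exp (2 * M * s))" using XK[OF s] M by (intro mult_left_mono) auto
    finally show "norm (B s (X s)) \<le> M * (K * exp (2 * M * s))" .
  qed
  with le[OF t1] have "norm (X t1) \<le> c + K / 2 * exp (2 * M * t1)" by linarith
  then have "K \<le> c * exp (- (2 * M * t1)) + K / 2"
    by (simp add: K_def exp_minus field_simps)
  also have "c * exp (- (2 * M * t1)) \<le> c * 1"
    using c M t1 by (intro mult_left_mono) auto
  finally have "K \<le> 2 * c" by simp
  then have "K * exp (2 * M * t) \<le> 2 * c * exp (2 * M * t)" by (intro mult_right_mono) auto
  with XK[OF t] show ?thesis by linarith
qed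

lemma mild_bound:
  assumes "mild x0 X" "t \<in> {0..T}"
  shows "norm (X t) \<le> 2 * norm x0 * exp (2 * M * t)"
proof (rule gronwall)
  show "continuous_on {0..T} X" using assms by (simp add: mild_def)
  fix t assume t: "t \<in> {0..T}"
  then have "X t = S t x0 + conv (\<lambda>s. B s (X s)) t" using assms by (simp add: mild_def)
  then show "norm (X t) \<le> norm x0 + norm (conv (\<lambda>s. B s (X s)) t)"
    using norm_triangle_ineq[of "S t x0" "conv (\<lambda>s. B s (X s)) t"] norm_S[of t x0] t by simp
qed (use assms in auto)

lemma mild_linear_combination:
  assumes X: "mild x0 X" and Y: "mild y0 Y"
  shows "mild (a *\<^sub>R x0 + b *\<^sub>R y0) (\<lambda>t. a *\<^sub>R X t + b *\<^sub>R Y t)"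
  unfolding mild_def
proof (intro conjI ballI)
  show "continuous_on {0..T} (\<lambda>t. a *\<^sub>R X t + b *\<^sub>R Y t)"
    using X Y by (auto simp: mild_def intro!: continuous_intros)
  fix t assume t: "t \<in> {0..T}"
  have hX: "((\<lambda>s. S (t - s) (B s (X s))) has_integral conv (\<lambda>s. B s (X s)) t) {0..t}"
    using X by (intro conv_integrand(2)[OF continuous_on_B t]) (simp add: mild_def)
  have hY: "((\<lambda>s. S (t - s) (B s (Y s))) has_integral conv (\<lambda>s. B s (Y s)) t) {0..t}"
    using Y by (intro conv_integrand(2)[OF continuous_on_B t]) (simp add: mild_def)
  have "((\<lambda>s. S (t - s) (B s (a *\<^sub>R X s + b *\<^sub>R Y s))) has_integral
      a *\<^sub>R conv (\<lambda>s. B s (X s)) t + b *\<^sub>R conv (\<lambda>s. B s (Y s)) t) {0..t}"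
  proof (rule has_integral_eq[OF _ has_integral_add[OF has_integral_cmul[OF hX] has_integral_cmul[OF hY]]])
    fix s assume "s \<in> {0..t}"
    then have "linear (B s)" using t by (intro B_linear) auto
    then show "a *\<^sub>R S (t - s) (B s (X s)) + b *\<^sub>R S (t - s) (B s (Y s)) = S (t - s) (B s (a *\<^sub>R X s + b *\<^sub>R Y s))"
      by (simp add: linear_add linear_cmul blinfun.add_right blinfun.scaleR_right)
  qed
  then have "conv (\<lambda>s. B s (a *\<^sub>R X s + b *\<^sub>R Y s)) t = a *\<^sub>R conv (\<lambda>s. B s (X s)) t + b *\<^sub>R conv (\<lambda>s. B s (Y s)) t"
    unfolding conv_def[of "\<lambda>s. B s (a *\<^sub>R X s + b *\<^sub>R Y s)"] by (rule integral_unique)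
  moreover have "X t = S t x0 + conv (\<lambda>s. B s (X s)) t" "Y t = S t y0 + conv (\<lambda>s. B s (Y s)) t"
    using X Y t by (auto simp: mild_def)
  ultimately show "a *\<^sub>R X t + b *\<^sub>R Y t = S t (a *\<^sub>R x0 + b *\<^sub>R y0) + conv (\<lambda>s. B s (a *\<^sub>R X s + b *\<^sub>R Y s)) t"
    by (simp add: blinfun.add_right blinfun.scaleR_right algebra_simps)
qed

lemma mild_unique:
  assumes "mild x0 X" "mild x0 Y" "t \<in> {0..T}"
  shows "X t = Y t"
  using mild_bound[OF mild_linear_combination[OF assms(1,2), of 1 "-1"] assms(3)] by simp

text \<open>Banach's fixed point theorem for the Duhamel map on bounded continuous functions, in the
  unknown \<open>exp (- 2 M t) X t\<close>. These functions live on the whole line: outside the time interval the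
  time is clamped to its end points.\<close>

lemma ex_mild: "\<exists>X. mild x0 X"
proof -
  define cl where "cl t = max 0 (min T t)" for t
  have cl: "cl t \<in> {0..T}" for t using T by (auto simp: cl_def)
  have cl_id: "cl t = t" if "t \<in> {0..T}" for t using that by (auto simp: cl_def)
  have cl_cont: "continuous_on UNIV cl" unfolding cl_def[abs_def] by (intro continuous_intros)
  define lift :: "(real \<Rightarrow>\<^sub>C 'a) \<Rightarrow> real \<Rightarrow> 'a" where "lift Y s = exp (2 * M * s) *\<^sub>R Y s" for Y s
  define step where "step Y t = exp (- (2 * M * cl t)) *\<^sub>R (S (cl t) x0 + conv (\<lambda>s. B s (lift Y s)) (cl t))" for Y t
  have lift_cont: "continuous_on {0..T} (lift Y)" for Y
    unfolding lift_def[abs_def] by (intro continuous_intros continuous_on_apply_bcontfun)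
  note BL = continuous_on_B[OF lift_cont]
  have "step Y \<in> bcontfun" for Y
  proof -
    have c: "continuous_on {0..T} (\<lambda>t. exp (- (2 * M * t)) *\<^sub>R (S t x0 + conv (\<lambda>s. B s (lift Y s)) t))"
      by (intro continuous_intros continuous_on_conv BL continuous_on_S) auto
    then have "bounded ((\<lambda>t. exp (- (2 * M * t)) *\<^sub>R (S t x0 + conv (\<lambda>s. B s (lift Y s)) t)) ` {0..T})"
      by (intro compact_imp_bounded compact_continuous_image) auto
    then have "bounded (range (step Y))"
      by (rule bounded_subset) (use cl in \<open>auto simp: step_def\<close>)
    moreover have "continuous_on UNIV (step Y)"
      unfolding step_def[abs_def] by (rule continuous_on_compose2[OF c cl_cont]) (use cl in auto)
    ultimately show ?thesis by (simp add: bcontfun_def)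
  qed
  then have ap: "apply_bcontfun (Bcontfun (step Y)) = step Y" for Y by (simp add: Bcontfun_inverse)
  have "dist (Bcontfun (step Y)) (Bcontfun (step Z)) \<le> 1 / 2 * dist Y Z" for Y Z
  proof (rule dist_bound)
    fix t
    let ?t = "cl t"
    have e: "exp (- (2 * M * ?t)) * exp (2 * M * ?t) = 1" by (simp flip: exp_add)
    have "step Y t - step Z t = exp (- (2 * M * ?t)) *\<^sub>R conv (\<lambda>s. B s (lift Y s) - B s (lift Z s)) ?t"
      unfolding step_def conv_diff[OF BL BL cl, symmetric] by (simp add: algebra_simps)
    also have "norm \<dots> \<le> exp (- (2 * M * ?t)) * (dist Y Z / 2 * exp (2 * M * ?t))"
    proof -
      have "norm (conv (\<lambda>s. B s (lift Y s) - B s (lift Z s)) ?t) \<le> dist Y Z / 2 * exp (2 * M * ?t)"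
      proof (rule norm_conv_le_exp[OF _ cl M])
        show "continuous_on {0..T} (\<lambda>s. B s (lift Y s) - B s (lift Z s))" by (intro continuous_intros BL)
        fix s assume s: "s \<in> {0..T}"
        have "norm (B s (lift Y s) - B s (lift Z s)) \<le> M * norm (lift Y s - lift Z s)"
          using B_bound[OF s] by (simp flip: linear_diff[OF B_linear[OF s]])
        also have "norm (lift Y s - lift Z s) = exp (2 * M * s) * dist (Y s) (Z s)"
          by (simp add: lift_def dist_norm flip: scaleR_diff_right)
        also have "\<dots> \<le> exp (2 * M * s) * dist Y Z" by (intro mult_left_mono dist_bounded) auto
        finally show "norm (B s (lift Y s) - B s (lift Z s)) \<le> M * (dist Y Z * exp (2 * M * s))"
          using M by (simp add: mult.commute)
      qed
      then show ?thesis by (simp add: mult_left_mono)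
    qed
    also have "\<dots> = dist Y Z / 2 * (exp (- (2 * M * ?t)) * exp (2 * M * ?t))"
      by (simp only: mult_ac)
    also have "\<dots> = 1 / 2 * dist Y Z" unfolding e by simp
    finally show "dist (apply_bcontfun (Bcontfun (step Y)) t) (apply_bcontfun (Bcontfun (step Z)) t) \<le> 1 / 2 * dist Y Z"
      by (simp add: ap dist_norm)
  qed
  then have "\<exists>!Y\<in>UNIV. Bcontfun (step Y) = Y"
    by (intro Banach_fix[of _ "1/2"]) (auto simp: complete_UNIV)
  then obtain Y where "Bcontfun (step Y) = Y" by auto
  then have Y: "apply_bcontfun Y = step Y" using ap[of Y] by metis
  have "lift Y t = S t x0 + conv (\<lambda>s. B s (lift Y s)) t" if t: "t \<in> {0..T}" for t
    unfolding lift_def[of _ t] Y step_def cl_id[OF t] by (simp add: exp_minus)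
  then have "mild x0 (lift Y)" using lift_cont by (simp add: mild_def)
  then show ?thesis by blast
qed

end

context contraction_semigroup
begin

text \<open>The generator gives the derivative from the right at zero. The semigroup law transports it to
  the right of any time; to the left the increment starts at \<open>y < \<tau>\<close>, and strong continuity replaces
  \<open>S y z\<close> by \<open>S \<tau> z\<close>.\<close>

lemma S_has_vector_derivative:
  assumes x: "(x, z) \<in> A" and \<tau>: "\<tau> \<ge> 0"
  shows "((\<lambda>t. S t x) has_vector_derivative S \<tau> z) (at \<tau> within {0..})"
  unfolding has_vector_derivative_def has_derivative_within_alt
proof (intro conjI allI impI)
  show "bounded_linear (\<lambda>h. h *\<^sub>R S \<tau> z)" by (rule bounded_linear_scaleR_left)
  fix e :: real assume "e > 0"
  then have e: "e / 2 > 0" by simp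
  from x have "((\<lambda>h. (S h x - x) /\<^sub>R h) \<longlongrightarrow> z) (at_right 0)" by (simp add: S_generator)
  from tendstoD[OF this e] obtain d1 where d1: "d1 > 0"
    "\<And>h. 0 < h \<Longrightarrow> h < d1 \<Longrightarrow> dist ((S h x - x) /\<^sub>R h) z < e / 2"
    by (auto simp: eventually_at_right_field)
  have q: "norm (S h x - x - h *\<^sub>R z) \<le> e / 2 * h" if "0 \<le> h" "h < d1" for h
  proof (cases "h = 0")
    case False
    have "S h x - x - h *\<^sub>R z = h *\<^sub>R ((S h x - x) /\<^sub>R h - z)" using False by (simp add: algebra_simps)
    then have "norm (S h x - x - h *\<^sub>R z) = h * dist ((S h x - x) /\<^sub>R h) z"
      using that by (simp add: dist_norm)
    also have "\<dots> \<le> h * (e / 2)" using d1(2)[of h] that False by (intro mult_left_mono) auto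
    finally show ?thesis by (simp add: mult.commute)
  qed simp
  obtain d2 where d2: "d2 > 0" "\<And>s. s \<ge> 0 \<Longrightarrow> dist s \<tau> < d2 \<Longrightarrow> dist (S s z) (S \<tau> z) < e / 2"
    using S_cont[of z] \<tau> e unfolding continuous_on_iff by (metis atLeast_iff)
  have "norm (S y x - S \<tau> x - (y - \<tau>) *\<^sub>R S \<tau> z) \<le> e * norm (y - \<tau>)"
    if y: "y \<ge> 0" "norm (y - \<tau>) < min d1 d2" for y
  proof (cases "y \<ge> \<tau>")
    case True
    then have "S y x = S \<tau> (S (y - \<tau>) x)" using S_add[of \<tau> "y - \<tau>" x] \<tau> by simp
    then have "S y x - S \<tau> x - (y - \<tau>) *\<^sub>R S \<tau> z = S \<tau> (S (y - \<tau>) x - x - (y - \<tau>) *\<^sub>R z)"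
      by (simp add: blinfun.diff_right blinfun.scaleR_right)
    then have "norm (S y x - S \<tau> x - (y - \<tau>) *\<^sub>R S \<tau> z) \<le> norm (S (y - \<tau>) x - x - (y - \<tau>) *\<^sub>R z)"
      using norm_S[OF \<tau>] by metis
    also have "\<dots> \<le> e / 2 * (y - \<tau>)" using q[of "y - \<tau>"] True y by simp
    also have "\<dots> \<le> e * norm (y - \<tau>)" using True e by (simp add: mult_right_mono)
    finally show ?thesis .
  next
    case False
    define h where "h = \<tau> - y"
    have h: "h > 0" "h < d1" "h < d2" using False y by (auto simp: h_def)
    have "S \<tau> x = S y (S h x)" using S_add[of y h x] y h by (simp add: h_def)
    then have "S y x - S \<tau> x - (y - \<tau>) *\<^sub>R S \<tau> z
        = - S y (S h x - x - h *\<^sub>R z) - h *\<^sub>R (S y z - S \<tau> z)"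
      by (simp add: blinfun.diff_right blinfun.add_right blinfun.scaleR_right h_def algebra_simps)
    then have "norm (S y x - S \<tau> x - (y - \<tau>) *\<^sub>R S \<tau> z)
        \<le> norm (S y (S h x - x - h *\<^sub>R z)) + h * dist (S y z) (S \<tau> z)"
      using norm_triangle_ineq4[of "- S y (S h x - x - h *\<^sub>R z)" "h *\<^sub>R (S y z - S \<tau> z)"] h
      by (simp add: dist_norm)
    also have "\<dots> \<le> e / 2 * h + h * (e / 2)"
      using order_trans[OF norm_S[OF y(1)] q[of h]] d2(2)[of y] h y
      by (intro add_mono mult_left_mono) (auto simp: h_def dist_real_def)
    also have "\<dots> = e * norm (y - \<tau>)" using h by (simp add: h_def)
    finally show ?thesis .
  qed
  then show "\<exists>d>0. \<forall>y\<in>{0..}. norm (y - \<tau>) < d \<longrightarrow> norm (S y x - S \<tau> x - (y - \<tau>) *\<^sub>R S \<tau> z) \<le> e * norm (y - \<tau>)"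
    using d1(1) d2(1) by (intro exI[of _ "min d1 d2"]) auto
qed

text \<open>The derivative of \<open>S (t - s) (Y s)\<close> in \<open>s\<close> is \<open>S (t - s)\<close> applied to the residual of \<open>Y\<close> in the
  unperturbed equation, because \<open>S (t - s)\<close> contributes minus the generator.\<close>

lemma duhamel:
  assumes Y: "\<And>s. s \<in> {0..T} \<Longrightarrow> (Y has_vector_derivative Y' s) (at s within {0..T})"
    and YZ: "\<And>s. s \<in> {0..T} \<Longrightarrow> (Y s, Z s) \<in> A"
    and t: "t \<in> {0..T}"
  shows "((\<lambda>s. S (t - s) (Y' s - Z s)) has_integral Y t - S t (Y 0)) {0..t}"
proof -
  have "((\<lambda>s. S (t - s) (Y s)) has_vector_derivative S (t - s) (Y' s - Z s)) (at s within {0..t})"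
    if s: "s \<in> {0..t}" for s
    unfolding has_vector_derivative_def has_derivative_within_alt
  proof (intro conjI allI impI)
    show "bounded_linear (\<lambda>h. h *\<^sub>R S (t - s) (Y' s - Z s))" by (rule bounded_linear_scaleR_left)
    fix e :: real assume "e > 0"
    then have e: "e / 3 > 0" by simp
    have sT: "s \<in> {0..T}" and ts: "t - s \<ge> 0" using s t by auto
    obtain d1 where d1: "d1 > 0"
      "\<And>y. y \<in> {0..T} \<Longrightarrow> norm (y - s) < d1 \<Longrightarrow> norm (Y y - Y s - (y - s) *\<^sub>R Y' s) \<le> e / 3 * norm (y - s)"
      using Y[OF sT] e unfolding has_vector_derivative_def has_derivative_within_alt by blast
    obtain d2 where d2: "d2 > 0"
      "\<And>y. y \<ge> 0 \<Longrightarrow> norm (y - (t - s)) < d2 \<Longrightarrow>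
         norm (S y (Y s) - S (t - s) (Y s) - (y - (t - s)) *\<^sub>R S (t - s) (Z s)) \<le> e / 3 * norm (y - (t - s))"
      using S_has_vector_derivative[OF YZ[OF sT] ts] e
      unfolding has_vector_derivative_def has_derivative_within_alt by (metis atLeast_iff)
    obtain d3 where d3: "d3 > 0"
      "\<And>y. y \<ge> 0 \<Longrightarrow> dist y (t - s) < d3 \<Longrightarrow> dist (S y (Y' s)) (S (t - s) (Y' s)) < e / 3"
      using S_cont[of "Y' s"] ts e unfolding continuous_on_iff by (metis atLeast_iff)
    have "norm (S (t - y) (Y y) - S (t - s) (Y s) - (y - s) *\<^sub>R S (t - s) (Y' s - Z s)) \<le> e * norm (y - s)"
      if y: "y \<in> {0..t}" "norm (y - s) < min d1 (min d2 d3)" for y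
    proof -
      have ty: "t - y \<ge> 0" "norm (t - y - (t - s)) = norm (y - s)" using y by (auto simp: norm_minus_commute)
      \<comment> \<open>The increment splits into the error of linearising \<open>Y\<close>, the variation of the semigroup on
        the derivative of \<open>Y\<close>, and the error of linearising the semigroup on \<open>Y s\<close>.\<close>
      define a where "a = S (t - y) (Y y - Y s - (y - s) *\<^sub>R Y' s)"
      define b where "b = (y - s) *\<^sub>R (S (t - y) (Y' s) - S (t - s) (Y' s))"
      define c where "c = S (t - y) (Y s) - S (t - s) (Y s) - (t - y - (t - s)) *\<^sub>R S (t - s) (Z s)"
      have "S (t - y) (Y y) - S (t - s) (Y s) - (y - s) *\<^sub>R S (t - s) (Y' s - Z s) = a + b + c"
        by (simp add: a_def b_def c_def blinfun.diff_right blinfun.add_right blinfun.scaleR_right algebra_simps)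
      moreover have "norm (a + b + c) \<le> norm a + norm b + norm c"
        by (meson norm_triangle_ineq add_right_mono order_trans)
      moreover have "norm a \<le> e / 3 * norm (y - s)"
        unfolding a_def using order_trans[OF norm_S[OF ty(1)] d1(2)[of y]] y t by auto
      moreover have "norm b \<le> e / 3 * norm (y - s)"
      proof -
        have "dist (t - y) (t - s) < d3" using y(2) ty(2) by (simp add: dist_norm)
        from d3(2)[OF ty(1) this] have "norm (S (t - y) (Y' s) - S (t - s) (Y' s)) \<le> e / 3"
          by (simp add: dist_norm)
        then show ?thesis unfolding b_def norm_scaleR
          by (simp only: mult.commute[of "e / 3"] real_norm_def mult_left_mono abs_ge_zero)
      qed
      moreover have "norm c \<le> e / 3 * norm (y - s)"
        unfolding c_def using d2(2)[OF ty(1)] y(2) ty(2) by simp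
      ultimately show ?thesis by (simp add: field_simps)
    qed
    then show "\<exists>d>0. \<forall>y\<in>{0..t}. norm (y - s) < d \<longrightarrow>
        norm (S (t - y) (Y y) - S (t - s) (Y s) - (y - s) *\<^sub>R S (t - s) (Y' s - Z s)) \<le> e * norm (y - s)"
      using d1(1) d2(1) d3(1) by (intro exI[of _ "min d1 (min d2 d3)"]) auto
  qed
  from fundamental_theorem_of_calculus[OF _ this] t show ?thesis by auto
qed

end

context perturbed_semigroup
begin

text \<open>A classical approximate solution with a small residual stays close to the mild solution
  with the same initial state.\<close>

lemma approximate_solution:
  assumes Y: "\<And>s. s \<in> {0..T} \<Longrightarrow> (Y has_vector_derivative Y' s) (at s within {0..T})"
    and YZ: "\<And>s. s \<in> {0..T} \<Longrightarrow> (Y s, Z s) \<in> A"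
    and c: "continuous_on {0..T} Y'" "continuous_on {0..T} Z"
    and r: "\<And>s. s \<in> {0..T} \<Longrightarrow> norm (Y' s - Z s - B s (Y s)) \<le> r"
    and X: "mild (Y 0) X" and t: "t \<in> {0..T}"
  shows "norm (X t - Y t) \<le> 2 * (T * r) * exp (2 * M * t)"
proof (rule gronwall[OF _ _ _ t])
  have Yc: "continuous_on {0..T} Y"
    using Y has_vector_derivative_continuous continuous_on_eq_continuous_within by blast
  have Xc: "continuous_on {0..T} X" using X by (simp add: mild_def)
  note BX = continuous_on_B[OF Xc] and BY = continuous_on_B[OF Yc]
  show "continuous_on {0..T} (\<lambda>t. X t - Y t)" by (intro continuous_intros Xc Yc)
  have r0: "r \<ge> 0" using r[of 0] T norm_ge_zero order_trans by (metis atLeastAtMost_iff order_refl)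
  then show "0 \<le> T * r" using T by simp
  fix t assume t: "t \<in> {0..T}"
  have Rc: "continuous_on {0..T} (\<lambda>s. Y' s - Z s - B s (Y s))" by (intro continuous_intros c BY)
  have YZc: "continuous_on {0..T} (\<lambda>s. Y' s - Z s)" by (intro continuous_intros c)
  have "conv (\<lambda>s. Y' s - Z s) t = Y t - S t (Y 0)"
    unfolding conv_def using duhamel[OF Y YZ t] by (simp add: integral_unique)
  moreover have "X t = S t (Y 0) + conv (\<lambda>s. B s (X s)) t" using X t by (simp add: mild_def)
  ultimately have "X t - Y t = conv (\<lambda>s. B s (X s)) t - conv (\<lambda>s. Y' s - Z s) t" by simp
  also have "\<dots> = conv (\<lambda>s. B s (X s) - B s (Y s)) t - conv (\<lambda>s. Y' s - Z s - B s (Y s)) t"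
    by (simp add: conv_diff[OF BX BY t, symmetric] conv_diff[OF YZc BY t, symmetric])
  also have "conv (\<lambda>s. B s (X s) - B s (Y s)) t = conv (\<lambda>s. B s (X s - Y s)) t"
    unfolding conv_def
  proof (rule integral_cong)
    fix s assume "s \<in> {0..t}"
    then have "linear (B s)" using t by (intro B_linear) auto
    then show "S (t - s) (B s (X s) - B s (Y s)) = S (t - s) (B s (X s - Y s))" by (simp add: linear_diff)
  qed
  finally have "norm (X t - Y t) \<le> norm (conv (\<lambda>s. B s (X s - Y s)) t) + norm (conv (\<lambda>s. Y' s - Z s - B s (Y s)) t)"
    by (simp add: norm_triangle_ineq4)
  also have "norm (conv (\<lambda>s. Y' s - Z s - B s (Y s)) t) \<le> T * r"
    by (rule norm_conv_le[OF Rc t r])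
  finally show "norm (X t - Y t) \<le> T * r + norm (conv (\<lambda>s. B s (X s - Y s)) t)" by simp
qed

end

section \<open>The evolution operator of a continuous coefficient\<close>

lemma rot_simps [simp]: "rot z $ 1 = z $ 2" "rot z $ 2 = - (z $ 1)"
  by (simp_all add: rot_def)

lemma norm_rot [simp]: "norm (rot z) = norm z"
  by (simp add: norm_vec_def L2_set_def sum_2 add.commute)

lemma linear_rot: "linear rot"
  by (rule linearI) (simp_all add: vec_eq_iff forall_2)

lemma bounded_linear_rot: "bounded_linear rot"
  using linear_rot linear_conv_bounded_linear by blast

lemmas continuous_on_rot [continuous_intros] = bounded_linear.continuous_on[OF bounded_linear_rot]

lemma rot_measurable [measurable]: "rot \<in> borel_measurable borel"
  by (intro borel_measurable_continuous_onI continuous_on_rot continuous_on_id)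

lemma norm_abs_L2_le_mult:
  fixes f :: "real^2 \<Rightarrow> 'a::euclidean_space" and g :: "real^2 \<Rightarrow> 'b::euclidean_space"
  assumes f: "square_integrable f" and g: "periodic g" "g \<in> borel_measurable borel"
    and le: "\<And>x. norm (g x) \<le> c * norm (f x)" and c: "c \<ge> 0"
  shows "square_integrable g" "norm (abs_L2 g) \<le> c * norm (abs_L2 f)"
proof -
  have le2: "(norm (g x))\<^sup>2 \<le> c\<^sup>2 * (norm (f x))\<^sup>2" for x
    using power_mono[OF le norm_ge_zero, of x 2] by (simp add: power_mult_distrib)
  have i: "set_integrable lborel cell (\<lambda>x. c\<^sup>2 * (norm (f x))\<^sup>2)"
    using f by (simp add: square_integrable_def)
  have "set_integrable lborel cell (\<lambda>x. (norm (g x))\<^sup>2)"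
  proof (rule set_integrable_bound[OF i])
    show "set_borel_measurable lborel cell (\<lambda>x. (norm (g x))\<^sup>2)"
      using g(2) unfolding set_borel_measurable_def by measurable
  qed (use le2 in \<open>auto intro!: AE_I2\<close>)
  with g show sg: "square_integrable g" by (simp add: square_integrable_def)
  have "(norm (abs_L2 g))\<^sup>2 \<le> (LINT x:cell|lborel. c\<^sup>2 * (norm (f x))\<^sup>2)"
    unfolding norm_abs_L2[OF sg] using sg i le2
    by (intro set_integral_mono) (auto simp: square_integrable_def)
  also have "\<dots> = (c * norm (abs_L2 f))\<^sup>2" by (simp add: norm_abs_L2[OF f] power_mult_distrib)
  finally show "norm (abs_L2 g) \<le> c * norm (abs_L2 f)"
    by (rule power2_le_imp_le) (use c in simp)
qed

lemma ohm_source_integrand: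
  assumes w: "periodic w" "continuous_on UNIV w" and m: "\<And>x. norm (w x) \<le> m" and \<sigma>: "\<sigma> \<ge> 0"
  shows "square_integrable (\<lambda>x. - (\<sigma> * rep_L2 b x) *\<^sub>R rot (w x))"
    and "norm (ohm_source \<sigma> w b) \<le> \<sigma> * m * norm b"
proof -
  have [measurable]: "w \<in> borel_measurable borel" by (rule borel_measurable_continuous_onI[OF w(2)])
  have m0: "m \<ge> 0" using m[of 0] norm_ge_zero order_trans by blast
  have p: "periodic (\<lambda>x. - (\<sigma> * rep_L2 b x) *\<^sub>R rot (w x))"
    using w(1) square_integrable_rep[of b] by (simp add: periodic_def square_integrable_def)
  have me: "(\<lambda>x. - (\<sigma> * rep_L2 b x) *\<^sub>R rot (w x)) \<in> borel_measurable borel" by measurable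
  have le: "norm (- (\<sigma> * rep_L2 b x) *\<^sub>R rot (w x)) \<le> \<sigma> * m * norm (rep_L2 b x)" for x
    using mult_left_mono[OF m[of x], of "\<sigma> * \<bar>rep_L2 b x\<bar>"] \<sigma> by (simp add: abs_mult mult_ac)
  have 0: "\<sigma> * m \<ge> 0" using \<sigma> m0 by simp
  note * = norm_abs_L2_le_mult[OF square_integrable_rep p me le 0]
  show "square_integrable (\<lambda>x. - (\<sigma> * rep_L2 b x) *\<^sub>R rot (w x))" by (rule *(1))
  show "norm (ohm_source \<sigma> w b) \<le> \<sigma> * m * norm b"
    using *(2) by (simp add: ohm_source_def abs_rep_L2)
qed

lemma ohm_source_abs:
  assumes w: "periodic w" "continuous_on UNIV w" and \<sigma>: "\<sigma> \<ge> 0"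
    and b: "periodic b" "continuous_on UNIV b"
  shows "ohm_source \<sigma> w (abs_L2 b) = abs_L2 (\<lambda>x. - (\<sigma> * b x) *\<^sub>R rot (w x))"
proof -
  obtain m where m: "\<And>x. norm (w x) \<le> m" using periodic_bounded[OF w(2,1)] by metis
  show ?thesis
    unfolding ohm_source_def
  proof (rule abs_L2_eqI)
    show "square_integrable (\<lambda>x. - (\<sigma> * b x) *\<^sub>R rot (w x))"
      using w b by (intro square_integrable_continuous continuous_intros) (auto simp: periodic_def)
    show "AE x in lborel. x \<in> cell \<longrightarrow>
        - (\<sigma> * rep_L2 (abs_L2 b) x) *\<^sub>R rot (w x) = - (\<sigma> * b x) *\<^sub>R rot (w x)"
      using AE_rep_abs[OF square_integrable_continuous[OF b(2,1)]] by eventually_elim auto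
  qed (rule ohm_source_integrand(1)[OF w m \<sigma>])
qed

lemma AE_rep_add: "AE x in lborel. x \<in> cell \<longrightarrow> rep_L2 (b + c) x = rep_L2 b x + rep_L2 c x"
  using AE_rep_abs[OF square_integrable_add[OF square_integrable_rep[of b] square_integrable_rep[of c]]]
  by (simp add: abs_rep_L2 flip: abs_L2_add[OF square_integrable_rep square_integrable_rep])

lemma AE_rep_scaleR: "AE x in lborel. x \<in> cell \<longrightarrow> rep_L2 (r *\<^sub>R b) x = r *\<^sub>R rep_L2 b x"
  using AE_rep_abs[OF square_integrable_scaleR[OF square_integrable_rep[of b], of r]]
  by (simp add: abs_rep_L2 flip: abs_L2_scaleR[OF square_integrable_rep])

lemma linear_ohm_source:
  assumes w: "periodic w" "continuous_on UNIV w" and \<sigma>: "\<sigma> \<ge> 0"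
  shows "linear (ohm_source \<sigma> w)"
proof -
  obtain m where m: "\<And>x. norm (w x) \<le> m" using periodic_bounded[OF w(2,1)] by metis
  note si = ohm_source_integrand(1)[OF w m \<sigma>]
  show ?thesis
  proof (rule linearI)
    fix b c r
    show "ohm_source \<sigma> w (b + c) = ohm_source \<sigma> w b + ohm_source \<sigma> w c"
      unfolding ohm_source_def abs_L2_add[OF si si]
    proof (rule abs_L2_eqI)
      show "AE x in lborel. x \<in> cell \<longrightarrow> - (\<sigma> * rep_L2 (b + c) x) *\<^sub>R rot (w x)
          = - (\<sigma> * rep_L2 b x) *\<^sub>R rot (w x) + - (\<sigma> * rep_L2 c x) *\<^sub>R rot (w x)"
        using AE_rep_add[of b c] by eventually_elim (auto simp: distrib_left scaleR_add_left scaleR_diff_left)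
    qed (intro square_integrable_add si)+
    show "ohm_source \<sigma> w (r *\<^sub>R b) = r *\<^sub>R ohm_source \<sigma> w b"
      unfolding ohm_source_def abs_L2_scaleR[OF si]
    proof (rule abs_L2_eqI)
      show "AE x in lborel. x \<in> cell \<longrightarrow> - (\<sigma> * rep_L2 (r *\<^sub>R b) x) *\<^sub>R rot (w x)
          = r *\<^sub>R - (\<sigma> * rep_L2 b x) *\<^sub>R rot (w x)"
        using AE_rep_scaleR[of r b] by eventually_elim auto
    qed (intro square_integrable_scaleR si)+
  qed
qed

lemma ohm_source_diff_coeff:
  assumes w: "periodic w" "continuous_on UNIV w" and w': "periodic w'" "continuous_on UNIV w'"
    and m: "\<And>x. norm (w x - w' x) \<le> m" and \<sigma>: "\<sigma> \<ge> 0"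
  shows "norm (ohm_source \<sigma> w b - ohm_source \<sigma> w' b) \<le> \<sigma> * m * norm b"
proof -
  obtain m1 where m1: "\<And>x. norm (w x) \<le> m1" using periodic_bounded[OF w(2,1)] by metis
  obtain m2 where m2: "\<And>x. norm (w' x) \<le> m2" using periodic_bounded[OF w'(2,1)] by metis
  have "ohm_source \<sigma> w b - ohm_source \<sigma> w' b = ohm_source \<sigma> (\<lambda>x. w x - w' x) b"
    unfolding ohm_source_def
      abs_L2_diff[OF ohm_source_integrand(1)[OF w m1 \<sigma>] ohm_source_integrand(1)[OF w' m2 \<sigma>]]
    by (simp add: linear_diff[OF linear_rot] scaleR_diff_right)
  moreover have "norm (ohm_source \<sigma> (\<lambda>x. w x - w' x) b) \<le> \<sigma> * m * norm b"
    using w w' by (intro ohm_source_integrand(2) m \<sigma> continuous_intros) (auto simp: periodic_def)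
  ultimately show ?thesis by simp
qed

locale maxwell_ohm =
  fixes S :: "real \<Rightarrow> H2 \<Rightarrow>\<^sub>L H2" and \<sigma> T :: real
  assumes S: "contraction_semigroup_generated_by S (maxwell_ohm_graph \<sigma>)"
    and \<sigma>: "\<sigma> > 0" and T: "T > 0"

sublocale maxwell_ohm \<subseteq> contraction_semigroup S "maxwell_ohm_graph \<sigma>"
  by unfold_locales (rule S)

locale maxwell_ohm_coeff = maxwell_ohm +
  fixes v :: "real \<Rightarrow> real^2 \<Rightarrow> real^2"
  assumes v_periodic: "\<And>t. t \<in> {0..T} \<Longrightarrow> periodic (v t)"
    and v_cont: "continuous_on ({0..T} \<times> UNIV) (\<lambda>(t, x). v t x)"
begin

definition source :: "real \<Rightarrow> H2 \<Rightarrow> H2" where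
  "source t X = (ohm_source \<sigma> (v t) (snd X), 0)"

lemma v_slice: "t \<in> {0..T} \<Longrightarrow> continuous_on UNIV (v t)"
  by (rule continuous_slice[OF v_cont])

lemma v_bounded: "\<exists>m>0. \<forall>t\<in>{0..T}. \<forall>x. norm (v t x) \<le> m"
proof -
  have "compact ((\<lambda>(t, x). v t x) ` ({0..T} \<times> cell))"
    by (intro compact_continuous_image continuous_on_subset[OF v_cont] compact_Times) (auto simp: cell_def)
  from compact_imp_bounded[OF this]
  obtain m where "\<forall>z\<in>(\<lambda>(t, x). v t x) ` ({0..T} \<times> cell). norm z \<le> m"
    unfolding bounded_iff by blast
  then have m: "\<And>t x. t \<in> {0..T} \<Longrightarrow> x \<in> cell \<Longrightarrow> norm (v t x) \<le> m" by auto
  have "norm (v t x) \<le> max m 1" if t: "t \<in> {0..T}" for t x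
  proof -
    obtain k where "x + lat k \<in> cell" using ex_lat_cell by blast
    from m[OF t this] show ?thesis by (simp add: periodic_lat[OF v_periodic[OF t]])
  qed
  then show ?thesis by (intro exI[of _ "max m 1"]) auto
qed

definition bound :: real where
  "bound = (SOME m. m > 0 \<and> (\<forall>t\<in>{0..T}. \<forall>x. norm (v t x) \<le> m))"

lemma bound: "bound > 0" "t \<in> {0..T} \<Longrightarrow> norm (v t x) \<le> bound"
  using someI_ex[OF v_bounded] unfolding bound_def by blast+

lemma source_bound: "t \<in> {0..T} \<Longrightarrow> norm (source t X) \<le> \<sigma> * bound * norm X"
proof -
  assume t: "t \<in> {0..T}"
  have "norm (source t X) \<le> \<sigma> * bound * norm (snd X)"
    using ohm_source_integrand(2)[OF v_periodic[OF t] v_slice[OF t] bound(2)[OF t]] \<sigma>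
    by (simp add: source_def norm_Pair)
  also have "\<dots> \<le> \<sigma> * bound * norm X"
    using \<sigma> bound(1) norm_snd_le[of "snd X" "fst X"] by (intro mult_left_mono) auto
  finally show ?thesis .
qed

lemma linear_source: "t \<in> {0..T} \<Longrightarrow> linear (source t)"
proof -
  assume t: "t \<in> {0..T}"
  note * = linear_ohm_source[OF v_periodic[OF t] v_slice[OF t], of \<sigma>]
  show ?thesis
    using \<sigma> by (intro linearI) (auto simp: source_def linear_add[OF *] linear_cmul[OF *])
qed

text \<open>Changes of the state are controlled by the operator bound, which is uniform in time. For a fixed
  state, changes of time are controlled by the supremum norm of the difference of the coefficients.\<close>

lemma source_cont: "continuous_on ({0..T} \<times> UNIV) (\<lambda>(t, X). source t X)"
  unfolding continuous_on_def
proof (intro ballI, clarify)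
  fix t0 and X0 :: H2 assume t0: "t0 \<in> {0..T}"
  let ?F = "at (t0, X0) within {0..T} \<times> UNIV"
  have 1: "((\<lambda>p. source (fst p) (snd p - X0)) \<longlongrightarrow> 0) ?F"
  proof (rule Lim_null_comparison)
    show "\<forall>\<^sub>F p in ?F. norm (source (fst p) (snd p - X0)) \<le> \<sigma> * bound * norm (snd p - X0)"
      unfolding eventually_at_filter by (intro always_eventually allI impI source_bound) auto
    have "((\<lambda>p. \<sigma> * bound * norm (snd p - X0)) \<longlongrightarrow> \<sigma> * bound * norm (snd (t0, X0) - X0)) ?F"
      by (intro tendsto_intros)
    then show "((\<lambda>p. \<sigma> * bound * norm (snd p - X0)) \<longlongrightarrow> 0) ?F" by simp
  qed
  have 2: "((\<lambda>p. source (fst p) X0) \<longlongrightarrow> source t0 X0) ?F"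
  proof (rule tendstoI)
    fix e :: real assume e: "e > 0"
    define e' where "e' = e / (2 * \<sigma> * (norm (snd X0) + 1))"
    have e': "e' > 0" using e \<sigma> by (simp add: e'_def add_nonneg_pos)
    obtain d where d: "d > 0" "\<And>t x. t \<in> {0..T} \<Longrightarrow> dist t t0 < d \<Longrightarrow> norm (v t x - v t0 x) \<le> e'"
      using periodic_uniformly_close[OF v_periodic v_cont t0 e'] by blast
    have close: "dist (source t X0) (source t0 X0) < e" if t: "t \<in> {0..T}" "dist t t0 < d" for t
    proof -
      have "dist (source t X0) (source t0 X0) = norm (ohm_source \<sigma> (v t) (snd X0) - ohm_source \<sigma> (v t0) (snd X0))"
        by (simp add: source_def dist_norm norm_Pair)
      also have "\<dots> \<le> \<sigma> * e' * norm (snd X0)"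
        using \<sigma> by (intro ohm_source_diff_coeff v_periodic v_slice d(2) t t0) auto
      also have "\<dots> \<le> \<sigma> * e' * (norm (snd X0) + 1)" using \<sigma> e' by (intro mult_left_mono) auto
      also have "\<dots> = e / 2" using \<sigma> norm_ge_zero[of "snd X0"] by (simp add: e'_def field_simps add_nonneg_eq_0_iff)
      also have "\<dots> < e" using e by simp
      finally show ?thesis .
    qed
    have "\<forall>\<^sub>F p in ?F. dist p (t0, X0) < d" using d(1) by (auto simp: eventually_at)
    moreover have "\<forall>\<^sub>F p in ?F. fst p \<in> {0..T}" unfolding eventually_at_filter by (intro always_eventually) auto
    ultimately show "\<forall>\<^sub>F p in ?F. dist (source (fst p) X0) (source t0 X0) < e"
    proof eventually_elim
      fix p :: "real \<times> H2" assume p: "dist p (t0, X0) < d" "fst p \<in> {0..T}"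
      have "dist (fst p) t0 < d" using dist_fst_le[of p "(t0, X0)"] p(1) by simp
      then show "dist (source (fst p) X0) (source t0 X0) < e" by (rule close[OF p(2)])
    qed
  qed
  have 3: "((\<lambda>p. source (fst p) (snd p - X0) + source (fst p) X0) \<longlongrightarrow> source t0 X0) ?F"
    using tendsto_add[OF 1 2] by simp
  have 4: "\<forall>\<^sub>F p in ?F. source (fst p) (snd p - X0) + source (fst p) X0 = (case p of (t, X) \<Rightarrow> source t X)"
    unfolding eventually_at_filter
    by (intro always_eventually) (auto simp flip: linear_add[OF linear_source])
  from 3 show "((\<lambda>p. case p of (t, X) \<Rightarrow> source t X) \<longlongrightarrow> source t0 X0) ?F"
    by (simp only: tendsto_cong[OF 4])
qed

end

sublocale maxwell_ohm_coeff \<subseteq> perturbed_semigroup S "maxwell_ohm_graph \<sigma>" T "\<sigma> * bound" source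
proof unfold_locales
  show "0 \<le> T" "0 < \<sigma> * bound" using T \<sigma> bound(1) by auto
  fix t :: real and r :: real and X Y :: H2 assume t: "t \<in> {0..T}"
  show "source t (X + Y) = source t X + source t Y" "source t (r *\<^sub>R X) = r *\<^sub>R source t X"
    using linear_source[OF t] by (simp_all add: linear_add linear_cmul)
qed (rule source_bound source_cont; assumption?)+

context maxwell_ohm_coeff
begin

lemma mild_iff: "mild X0 X \<longleftrightarrow> mild_solution S \<sigma> T v X0 X"
proof -
  have "X t = S t X0 + conv (\<lambda>s. source s (X s)) t \<longleftrightarrow>
      ((\<lambda>s. S (t - s) (ohm_source \<sigma> (v s) (snd (X s)), 0)) has_integral (X t - S t X0)) {0..t}"
    if X: "continuous_on {0..T} X" and t: "t \<in> {0..T}" for t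
  proof -
    note hi = conv_integrand(2)[OF continuous_on_B[OF X] t]
    show ?thesis
    proof
      assume "X t = S t X0 + conv (\<lambda>s. source s (X s)) t"
      with hi show "((\<lambda>s. S (t - s) (ohm_source \<sigma> (v s) (snd (X s)), 0)) has_integral (X t - S t X0)) {0..t}"
        by (simp add: source_def)
    next
      assume "((\<lambda>s. S (t - s) (ohm_source \<sigma> (v s) (snd (X s)), 0)) has_integral (X t - S t X0)) {0..t}"
      from has_integral_unique[OF this] hi have "X t - S t X0 = conv (\<lambda>s. source s (X s)) t"
        by (simp add: source_def)
      then show "X t = S t X0 + conv (\<lambda>s. source s (X s)) t" by (simp add: algebra_simps)
    qed
  qed
  then show ?thesis unfolding mild_def mild_solution_def by blast
qed

text \<open>Existence and uniqueness of mild solutions make the description in \<^const>\<open>evolution\<close> denote the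
  terminal value, and this value depends linearly and boundedly on the initial state, so that
  \<^const>\<open>Blinfun\<close> is applied to an operator and not to an arbitrary function.\<close>

lemma evolution_eq:
  assumes "mild X0 X"
  shows "evolution S \<sigma> T v X0 = X T"
proof -
  define P where "P X0 = (THE Y. \<exists>X. mild_solution S \<sigma> T v X0 X \<and> Y = X T)" for X0
  have P: "P X0 = X T" if "mild X0 X" for X0 X
    unfolding P_def
  proof (rule the_equality)
    show "\<exists>X'. mild_solution S \<sigma> T v X0 X' \<and> X T = X' T" using that mild_iff by blast
    fix Y assume "\<exists>X. mild_solution S \<sigma> T v X0 X \<and> Y = X T"
    then show "Y = X T" using mild_unique[OF _ that] T mild_iff by auto
  qed
  have lin: "P (a *\<^sub>R x + b *\<^sub>R y) = a *\<^sub>R P x + b *\<^sub>R P y" for a b x y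
  proof -
    obtain X where X: "mild x X" using ex_mild by blast
    obtain Y where Y: "mild y Y" using ex_mild by blast
    show ?thesis using P[OF mild_linear_combination[OF X Y]] P[OF X] P[OF Y] by simp
  qed
  have "bounded_linear P"
  proof (rule bounded_linear_intro[where K="2 * exp (2 * (\<sigma> * bound) * T)"])
    show "P (x + y) = P x + P y" for x y using lin[of 1 x 1 y] by simp
    show "P (r *\<^sub>R x) = r *\<^sub>R P x" for r x using lin[of r x 0 x] by simp
    show "norm (P x) \<le> norm x * (2 * exp (2 * (\<sigma> * bound) * T))" for x
    proof -
      obtain X where X: "mild x X" using ex_mild by blast
      show ?thesis using mild_bound[OF X, of T] P[OF X] T by (simp add: mult_ac)
    qed
  qed
  then have "blinfun_apply (evolution S \<sigma> T v) = P"
    unfolding evolution_def P_def[abs_def] by (rule bounded_linear_Blinfun_apply)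
  then show ?thesis using P[OF assms] by simp
qed

end

context maxwell_ohm
begin

lemma evolution_zero: "evolution S \<sigma> T (\<lambda>t x. 0) X0 = S T X0"
proof -
  interpret Z: maxwell_ohm_coeff S \<sigma> T "\<lambda>t x. 0"
    by unfold_locales (auto simp: periodic_def intro!: continuous_intros)
  have "ohm_source \<sigma> (\<lambda>x. 0) b = 0" for b
  proof -
    have "rot 0 = 0" by (simp add: vec_eq_iff forall_2)
    then show ?thesis by (simp add: ohm_source_def flip: zero_L2.abs_eq)
  qed
  then have "Z.source t X = 0" for t X by (simp add: Z.source_def zero_prod_def)
  moreover have "continuous_on {0..T} (\<lambda>t. S t X0)" by (rule continuous_on_subset[OF S_cont]) auto
  ultimately have "Z.mild X0 (\<lambda>t. S t X0)"
    unfolding Z.mild_def by (simp add: conv_def)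
  then show ?thesis by (rule Z.evolution_eq)
qed

lemma norm_evolution_zero: "norm (evolution S \<sigma> T (\<lambda>t x. 0)) \<le> 1"
  by (rule norm_blinfun_bound) (use norm_S[of T] T in \<open>auto simp: evolution_zero\<close>)

end

section \<open>Amplification of wave packets that travel with the core\<close>

lemma rot_L2_abs:
  assumes "square_integrable G"
  shows "square_integrable (\<lambda>x. rot (G x))" "rot_L2 (abs_L2 G) = abs_L2 (\<lambda>x. rot (G x))"
proof -
  have r: "square_integrable (\<lambda>x. rot (H x))" if "square_integrable H" for H :: "real^2 \<Rightarrow> real^2"
  proof -
    have [measurable]: "H \<in> borel_measurable borel" using that by (simp add: square_integrable_def)
    show ?thesis
      by (rule norm_abs_L2_le_mult(1)[OF that, where c=1]) (use that in \<open>auto simp: square_integrable_def periodic_def\<close>)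
  qed
  show "square_integrable (\<lambda>x. rot (G x))" by (rule r[OF assms])
  show "rot_L2 (abs_L2 G) = abs_L2 (\<lambda>x. rot (G x))"
    unfolding rot_L2_def
  proof (rule abs_L2_eqI[OF r[OF square_integrable_rep] r[OF assms]])
    show "AE x in lborel. x \<in> cell \<longrightarrow> rot (rep_L2 (abs_L2 G) x) = rot (G x)"
      using AE_rep_abs[OF assms] by eventually_elim simp
  qed
qed

text \<open>A coefficient that is constant on a core moving with unit speed in the first direction.
  The condition \<open>cos s > c0\<close> is a \<open>2\<pi>\<close>-periodic way of saying that \<open>s\<close> is close to a multiple of
  \<open>2\<pi>\<close>; so the function \<open>k\<close> applied to both coordinates relative to the centre is a profile
  supported in the core. The value in the core is chosen such that the amplification rate below is
  \<open>1 / (t + \<delta>)\<close>.\<close>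

locale travelling_core = maxwell_ohm_coeff +
  fixes x0 :: "real^2" and \<delta> c0 \<kappa> :: real and k k' k'' :: "real \<Rightarrow> real"
  assumes \<delta>: "\<delta> > 0"
    and dk: "\<And>s. (k has_real_derivative k' s) (at s)"
    and dk': "\<And>s. (k' has_real_derivative k'' s) (at s)"
    and k''_cont: "continuous_on UNIV k''"
    and k_periodic: "\<And>s. k (s + 2 * pi) = k s" "\<And>s. k' (s + 2 * pi) = k' s" "\<And>s. k'' (s + 2 * pi) = k'' s"
    and k_bound: "\<And>s. \<bar>k s\<bar> \<le> \<kappa>" "\<And>s. \<bar>k' s\<bar> \<le> \<kappa>" "\<And>s. \<bar>k'' s\<bar> \<le> \<kappa>"
    and k_support: "\<And>s. k s \<noteq> 0 \<Longrightarrow> cos s > c0"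
    and k_0: "k 0 \<noteq> 0"
    and core: "\<And>t x. t \<in> {0..T} \<Longrightarrow> cos (x $ 1 - x0 $ 1 - t) > c0 \<Longrightarrow> cos (x $ 2 - x0 $ 2) > c0 \<Longrightarrow>
        v t x = (1 + 2 / (\<sigma> * (t + \<delta>))) *\<^sub>R dir"
begin

lemma k_cont: "continuous_on UNIV k" "continuous_on UNIV k'"
  by (rule DERIV_continuous_on[OF dk] DERIV_continuous_on[OF dk'])+

lemma k_continuous_on [continuous_intros]:
  assumes "continuous_on A f"
  shows "continuous_on A (\<lambda>x. k (f x))" "continuous_on A (\<lambda>x. k' (f x))" "continuous_on A (\<lambda>x. k'' (f x))"
  by (rule continuous_on_compose2[OF k_cont(1) assms] continuous_on_compose2[OF k_cont(2) assms]
        continuous_on_compose2[OF k''_cont assms], simp)+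

lemma k_derivative [derivative_intros]:
  assumes "(f has_real_derivative D) (at x within A)"
  shows "((\<lambda>x. k (f x)) has_real_derivative k' (f x) * D) (at x within A)"
    "((\<lambda>x. k' (f x)) has_real_derivative k'' (f x) * D) (at x within A)"
  using DERIV_chain2[OF dk assms] DERIV_chain2[OF dk' assms] by auto

text \<open>The solution with initial value \<open>1\<close> of \<open>a' = a / (t + \<delta>)\<close>. It is affine; \<open>rate\<close> is its slope.\<close>

definition amp :: "real \<Rightarrow> real" where "amp t = (t + \<delta>) / \<delta>"

definition rate :: real where "rate = 1 / \<delta>"

lemma amp_continuous_on [continuous_intros]:
  "continuous_on A f \<Longrightarrow> continuous_on A (\<lambda>x. amp (f x))"
  unfolding amp_def using \<delta> by (intro continuous_intros) auto

lemma amp_derivative [derivative_intros]: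
  "(f has_real_derivative D) (at x within A) \<Longrightarrow>
    ((\<lambda>x. amp (f x)) has_real_derivative rate * D) (at x within A)"
  unfolding amp_def rate_def using DERIV_cdivide[OF DERIV_add[OF _ DERIV_const[of \<delta>]], of f D x A \<delta>] by simp

text \<open>The function on the plane given by a profile in the coordinates relative to the core.\<close>

definition comoving :: "(real \<Rightarrow> real \<Rightarrow> real \<Rightarrow> real) \<Rightarrow> real \<Rightarrow> real^2 \<Rightarrow> real" where
  "comoving f t x = f t (x $ 1 - x0 $ 1 - t) (x $ 2 - x0 $ 2)"

definition admissible :: "(real \<Rightarrow> real \<Rightarrow> real \<Rightarrow> real) \<Rightarrow> bool" where
  "admissible f \<longleftrightarrow> continuous_on UNIV (\<lambda>(t, y, z). f t y z) \<and>
     (\<forall>t y z. f t (y + 2 * pi) z = f t y z \<and> f t y (z + 2 * pi) = f t y z)"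

lemma admissible_intros:
  "admissible f \<Longrightarrow> admissible g \<Longrightarrow> admissible (\<lambda>t y z. f t y z * g t y z)"
  "admissible f \<Longrightarrow> admissible g \<Longrightarrow> admissible (\<lambda>t y z. f t y z + g t y z)"
  "admissible f \<Longrightarrow> admissible g \<Longrightarrow> admissible (\<lambda>t y z. f t y z - g t y z)"
  "admissible f \<Longrightarrow> admissible (\<lambda>t y z. - f t y z)"
  "admissible (\<lambda>t y z. c)" "admissible (\<lambda>t y z. amp t)"
  "admissible (\<lambda>t y z. k y)" "admissible (\<lambda>t y z. k' y)" "admissible (\<lambda>t y z. k'' y)"
  "admissible (\<lambda>t y z. k z)" "admissible (\<lambda>t y z. k' z)" "admissible (\<lambda>t y z. k'' z)"
  unfolding admissible_def split_beta
  by (simp_all add: k_periodic continuous_on_mult continuous_on_add continuous_on_diff continuous_on_minus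
      amp_continuous_on k_continuous_on continuous_on_fst continuous_on_snd)

lemma periodic_comoving: "admissible f \<Longrightarrow> periodic (comoving f t)"
proof -
  assume f: "admissible f"
  have "comoving f t (x + axis 1 (2 * pi)) = f t (x $ 1 - x0 $ 1 - t + 2 * pi) (x $ 2 - x0 $ 2)"
    "comoving f t (x + axis 2 (2 * pi)) = f t (x $ 1 - x0 $ 1 - t) (x $ 2 - x0 $ 2 + 2 * pi)" for x
    by (simp_all add: comoving_def axis_def algebra_simps)
  then have "comoving f t (x + axis i (2 * pi)) = comoving f t x" for x i
    using f exhaust_2[of i] by (auto simp: comoving_def admissible_def)
  then show ?thesis by (simp add: periodic_def)
qed

lemma continuous_comoving: "admissible f \<Longrightarrow> continuous_on A (\<lambda>(t, x). comoving f t x)"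
proof -
  assume f: "admissible f"
  have "continuous_on A (\<lambda>(t, x::real^2). (t, x $ 1 - x0 $ 1 - t, x $ 2 - x0 $ 2))"
    unfolding split_beta by (intro continuous_intros)
  from continuous_on_compose2[OF _ this, of UNIV "\<lambda>(t, y, z). f t y z"] f
  show ?thesis by (simp add: admissible_def comoving_def split_beta)
qed

lemma continuous_comoving_slice: "admissible f \<Longrightarrow> continuous_on UNIV (comoving f t)"
  using continuous_slice[of UNIV "comoving f" t] continuous_comoving[of f] by simp

lemma comoving_dir:
  "comoving f t (x + s *\<^sub>R axis 1 1) = f t (x $ 1 - x0 $ 1 - t + s) (x $ 2 - x0 $ 2)"
  "comoving f t (x + s *\<^sub>R axis 2 1) = f t (x $ 1 - x0 $ 1 - t) (x $ 2 - x0 $ 2 + s)"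
  by (simp_all add: comoving_def axis_def algebra_simps)

definition "K_res = (rate + amp T + \<sigma> * amp T + \<sigma> * rate) * \<kappa>\<^sup>2"

lemma \<kappa>_nonneg: "\<kappa> \<ge> 0"
  using k_bound(1)[of 0] by linarith

lemma abs_kk_le: "\<bar>p * q\<bar> \<le> \<kappa>\<^sup>2" if "\<bar>p\<bar> \<le> \<kappa>" "\<bar>q\<bar> \<le> \<kappa>" for p q
  using mult_mono[OF that] \<kappa>_nonneg by (simp add: abs_mult power2_eq_square)

lemma rate_pos: "rate > 0"
  using \<delta> by (simp add: rate_def)

lemma amp_bounds: "t \<in> {0..T} \<Longrightarrow> 0 < amp t" "t \<in> {0..T} \<Longrightarrow> amp t \<le> amp T" "amp 0 = 1" "amp T \<ge> 1"
  using \<delta> T by (auto simp: amp_def divide_right_mono)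

definition vec2 :: "(real \<Rightarrow> real \<Rightarrow> real \<Rightarrow> real) \<Rightarrow> (real \<Rightarrow> real \<Rightarrow> real \<Rightarrow> real) \<Rightarrow> real \<Rightarrow> real^2 \<Rightarrow> real^2" where
  "vec2 f g t x = comoving f t x *\<^sub>R axis 1 1 + comoving g t x *\<^sub>R axis 2 1"

lemma vec2_nth [simp]: "vec2 f g t x $ 1 = comoving f t x" "vec2 f g t x $ 2 = comoving g t x"
  by (simp_all add: vec2_def axis_def)

lemma norm_vec2_le: "norm (vec2 f g t x) \<le> \<bar>comoving f t x\<bar> + \<bar>comoving g t x\<bar>"
  unfolding vec2_def by (rule order_trans[OF norm_triangle_ineq]) (simp add: norm_axis_1)

lemma periodic_vec2: "admissible f \<Longrightarrow> admissible g \<Longrightarrow> periodic (vec2 f g t)"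
  using periodic_comoving[of f t] periodic_comoving[of g t] by (simp add: periodic_def vec2_def)

lemma continuous_vec2: "admissible f \<Longrightarrow> admissible g \<Longrightarrow> continuous_on A (\<lambda>(t, x). vec2 f g t x)"
  using continuous_comoving[of f A] continuous_comoving[of g A]
  unfolding vec2_def split_beta by (intro continuous_intros)

lemma continuous_vec2_slice: "admissible f \<Longrightarrow> admissible g \<Longrightarrow> continuous_on UNIV (vec2 f g t)"
  using continuous_slice[of UNIV "vec2 f g" t] continuous_vec2[of f g] by simp

lemma si_comoving: "admissible f \<Longrightarrow> square_integrable (comoving f t)"
  by (simp add: square_integrable_continuous periodic_comoving continuous_comoving_slice)

lemma si_vec2: "admissible f \<Longrightarrow> admissible g \<Longrightarrow> square_integrable (vec2 f g t)"
  by (simp add: square_integrable_continuous periodic_vec2 continuous_vec2_slice)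

lemmas comoving_derivative_rules = DERIV_const DERIV_ident DERIV_mult DERIV_add DERIV_diff DERIV_minus
  DERIV_fun_sin DERIV_fun_cos k_derivative amp_derivative

context
  fixes N :: nat
  assumes N: "N \<ge> 1"
begin

text \<open>With \<open>f = amp t * k y * k z * cos (N y)\<close> the leading part of the packet is \<open>E = (0, f)\<close> and
  \<open>b = f\<close>, which moves rigidly with the core up to its growing amplitude. It leaves two residuals
  that do not decay with \<open>N\<close>: the variation of the profile across the ray puts \<open>\<partial>\<^sub>2 b\<close> into the
  equation for \<open>E\<^sub>1\<close>, and the growth is driven by the equation for \<open>E\<^sub>2\<close> alone but has to be shared
  equally with \<open>b\<close>. Both oscillate like \<open>cos (N y)\<close>, and the time derivative of \<open>h sin (N y)\<close> is
  \<open>- cos (N y)\<close> because \<open>y\<close> decreases with unit speed; so one corrector of size \<open>h\<close> in each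
  component of \<open>E\<close> removes them.\<close>

definition "h = 1 / real N"

definition "E1 t y z = - h * amp t * k y * k' z * sin (real N * y)"
definition "E2 t y z = amp t * k y * k z * cos (real N * y) - h * rate * k y * k z * sin (real N * y)"
definition "bb t y z = amp t * k y * k z * cos (real N * y)"

text \<open>Derivatives of the packet at a fixed point of the plane, where \<open>y\<close> has time derivative \<open>-1\<close>: with
  respect to time, and those with respect to the coordinates that enter \<open>\<nabla>b\<close> and \<open>curl E\<close>. What the
  three equations leave over is \<open>res1\<close>, \<open>res2\<close>, \<open>res3\<close>.\<close>

definition "E1_t t y z = - (h * rate) * k y * k' z * sin (real N * y) + h * amp t * k' y * k' z * sin (real N * y)
  + amp t * k y * k' z * cos (real N * y)"
definition "E2_t t y z = 2 * rate * k y * k z * cos (real N * y) - amp t * k' y * k z * cos (real N * y)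
  + real N * amp t * k y * k z * sin (real N * y) + h * rate * k' y * k z * sin (real N * y)"
definition "b_t t y z = rate * k y * k z * cos (real N * y) - amp t * k' y * k z * cos (real N * y)
  + real N * amp t * k y * k z * sin (real N * y)"
definition "b_1 t y z = amp t * k' y * k z * cos (real N * y) - real N * amp t * k y * k z * sin (real N * y)"
definition "b_2 t y z = amp t * k y * k' z * cos (real N * y)"
definition "E2_1 t y z = amp t * k' y * k z * cos (real N * y) - real N * amp t * k y * k z * sin (real N * y)
  - h * rate * k' y * k z * sin (real N * y) - rate * k y * k z * cos (real N * y)"
definition "E1_2 t y z = - h * amp t * k y * k'' z * sin (real N * y)"

definition "res1 t y z = (- rate * k y * k' z + amp t * k' y * k' z - \<sigma> * amp t * k y * k' z) * sin (real N * y) * h"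
definition "res2 t y z = (rate * k' y * k z - \<sigma> * rate * k y * k z) * sin (real N * y) * h"
definition "res3 t y z = (- rate * k' y * k z + amp t * k y * k'' z) * sin (real N * y) * h"

lemmas profile_defs = E1_def E2_def bb_def E1_t_def E2_t_def b_t_def b_1_def b_2_def E2_1_def E1_2_def
  res1_def res2_def res3_def

lemma h_pos: "h > 0"
  using N by (simp add: h_def)

lemma trig_periodic: "sin (real N * (y + 2 * pi)) = sin (real N * y)" "cos (real N * (y + 2 * pi)) = cos (real N * y)"
proof -
  have *: "real N * (y + 2 * pi) = real N * y + 2 * of_nat N * pi" by (simp add: algebra_simps)
  show "sin (real N * (y + 2 * pi)) = sin (real N * y)" "cos (real N * (y + 2 * pi)) = cos (real N * y)"
    unfolding * by (simp_all add: sin_add cos_add)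
qed

lemma admissible_trig:
  "admissible (\<lambda>t y z. sin (real N * y))" "admissible (\<lambda>t y z. cos (real N * y))"
  unfolding admissible_def trig_periodic split_beta by (auto intro!: continuous_intros)

lemma admissible_profiles:
  "admissible E1" "admissible E2" "admissible bb" "admissible E1_t" "admissible E2_t" "admissible b_t"
  "admissible b_1" "admissible b_2" "admissible E2_1" "admissible E1_2"
  "admissible res1" "admissible res2" "admissible res3"
  unfolding profile_defs[abs_def]
  by (intro admissible_intros admissible_trig)+

lemma comoving_time_derivatives:
  "((\<lambda>t. comoving E1 t x) has_real_derivative comoving E1_t t x) (at t)"
  "((\<lambda>t. comoving E2 t x) has_real_derivative comoving E2_t t x) (at t)"
  "((\<lambda>t. comoving bb t x) has_real_derivative comoving b_t t x) (at t)"
  unfolding comoving_def profile_defs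
  by (rule DERIV_cong, (rule comoving_derivative_rules)+, use N in \<open>simp add: h_def field_simps\<close>)+

lemma comoving_space_derivatives:
  "((\<lambda>s. comoving bb t (x + s *\<^sub>R axis 1 1)) has_real_derivative comoving b_1 t x) (at 0)"
  "((\<lambda>s. comoving bb t (x + s *\<^sub>R axis 2 1)) has_real_derivative comoving b_2 t x) (at 0)"
  "((\<lambda>s. comoving E2 t (x + s *\<^sub>R axis 1 1)) has_real_derivative comoving E2_1 t x) (at 0)"
  "((\<lambda>s. comoving E1 t (x + s *\<^sub>R axis 2 1)) has_real_derivative comoving E1_2 t x) (at 0)"
  unfolding comoving_dir unfolding comoving_def profile_defs
  by (rule DERIV_cong, (rule comoving_derivative_rules)+, use N in \<open>simp add: h_def field_simps\<close>)+

text \<open>In the second equation the source contributes \<open>(\<sigma> * amp t + 2 * rate) * k y * k z * cos (N y)\<close>,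
  as the affine amplitude satisfies \<open>2 / (t + \<delta>) * amp t = 2 * rate\<close>. The first summand cancels
  the damping; of the second, one half is the growth of the amplitude and the other half is taken up
  by the corrector.\<close>

lemma residual_identities:
  assumes "t + \<delta> > 0"
  shows "E1_t t y z - b_2 t y z + \<sigma> * E1 t y z = res1 t y z"
    "E2_t t y z + b_1 t y z + \<sigma> * E2 t y z - \<sigma> * (1 + 2 / (\<sigma> * (t + \<delta>))) * bb t y z = res2 t y z"
    "b_t t y z + (E2_1 t y z - E1_2 t y z) = res3 t y z"
proof -
  show "E1_t t y z - b_2 t y z + \<sigma> * E1 t y z = res1 t y z"
    using N by (simp add: profile_defs h_def field_simps)
  have "\<sigma> * (1 + 2 / (\<sigma> * (t + \<delta>))) = \<sigma> + 2 / (t + \<delta>)"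
  proof -
    have "\<sigma> * (1 + q) = \<sigma> + \<sigma> * q" for q by (simp add: distrib_left)
    moreover have "\<sigma> * (2 / (\<sigma> * (t + \<delta>))) = 2 / (t + \<delta>)" using \<sigma> by simp
    ultimately show ?thesis by (simp only:)
  qed
  moreover have "2 / (t + \<delta>) * amp t = 2 * rate"
    using assms \<delta> by (simp add: amp_def rate_def divide_simps)
  ultimately have "\<sigma> * (1 + 2 / (\<sigma> * (t + \<delta>))) * amp t = \<sigma> * amp t + 2 * rate"
    by (simp add: distrib_right)
  then have "\<sigma> * (1 + 2 / (\<sigma> * (t + \<delta>))) * bb t y z = (\<sigma> * amp t + 2 * rate) * (k y * k z * cos (real N * y))"
    by (simp add: bb_def mult.assoc[symmetric])
  then show "E2_t t y z + b_1 t y z + \<sigma> * E2 t y z - \<sigma> * (1 + 2 / (\<sigma> * (t + \<delta>))) * bb t y z = res2 t y z"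
    using N by (simp add: profile_defs h_def field_simps)
  show "b_t t y z + (E2_1 t y z - E1_2 t y z) = res3 t y z"
    using N by (simp add: profile_defs h_def field_simps)
qed

lemma residual_bounds:
  assumes t: "t \<in> {0..T}"
  shows "\<bar>res1 t y z\<bar> \<le> h * K_res" "\<bar>res2 t y z\<bar> \<le> h * K_res" "\<bar>res3 t y z\<bar> \<le> h * K_res"
proof -
  note kk = abs_kk_le[OF k_bound(1) k_bound(1)] abs_kk_le[OF k_bound(1) k_bound(2)]
    abs_kk_le[OF k_bound(2) k_bound(1)] abs_kk_le[OF k_bound(2) k_bound(2)] abs_kk_le[OF k_bound(1) k_bound(3)]
  have m: "\<bar>c * q\<bar> \<le> C * \<kappa>\<^sup>2" if "\<bar>q\<bar> \<le> \<kappa>\<^sup>2" "\<bar>c\<bar> \<le> C" for c q C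
    using that mult_mono[of "\<bar>c\<bar>" C "\<bar>q\<bar>" "\<kappa>\<^sup>2"] by (simp add: abs_mult)
  have s: "\<bar>p * sin (real N * y) * h\<bar> \<le> h * K_res" if "\<bar>p\<bar> \<le> K_res" for p
  proof -
    have "\<bar>p\<bar> * \<bar>sin (real N * y)\<bar> \<le> K_res * 1"
      using that by (intro mult_mono) (auto intro: order_trans[OF abs_ge_zero])
    then show ?thesis using N by (simp add: abs_mult h_def divide_right_mono)
  qed
  have pos: "0 \<le> rate" "0 \<le> amp T" "0 \<le> \<sigma> * amp T" "0 \<le> \<sigma> * rate" "\<bar>amp t\<bar> \<le> amp T" "\<bar>\<sigma> * amp t\<bar> \<le> \<sigma> * amp T"
    using rate_pos \<sigma> amp_bounds(1,2)[OF t] amp_bounds(4) by (auto simp: abs_mult)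
  have posk: "0 \<le> rate * \<kappa>\<^sup>2" "0 \<le> amp T * \<kappa>\<^sup>2" "0 \<le> \<sigma> * amp T * \<kappa>\<^sup>2" "0 \<le> \<sigma> * rate * \<kappa>\<^sup>2"
    by (intro mult_nonneg_nonneg[OF _ zero_le_power2] pos)+
  have K: "K_res = rate * \<kappa>\<^sup>2 + amp T * \<kappa>\<^sup>2 + \<sigma> * amp T * \<kappa>\<^sup>2 + \<sigma> * rate * \<kappa>\<^sup>2"
    by (simp add: K_res_def algebra_simps)
  have "\<bar>- rate * (k y * k' z) + amp t * (k' y * k' z) - \<sigma> * amp t * (k y * k' z)\<bar> \<le> K_res"
    using m[OF kk(2)[of y z], of "- rate" "rate"] m[OF kk(4)[of y z] pos(5)] m[OF kk(2)[of y z] pos(6)] posk rate_pos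
    unfolding K by simp
  then show "\<bar>res1 t y z\<bar> \<le> h * K_res" unfolding res1_def by (intro s) (simp add: mult.assoc)
  have "\<bar>rate * (k' y * k z) - \<sigma> * rate * (k y * k z)\<bar> \<le> K_res"
    using m[OF kk(3)[of y z], of "rate" "rate"] m[OF kk(1)[of y z], of "\<sigma> * rate" "\<sigma> * rate"] posk pos rate_pos
      abs_triangle_ineq4[of "rate * (k' y * k z)" "\<sigma> * rate * (k y * k z)"]
    unfolding K by linarith
  then show "\<bar>res2 t y z\<bar> \<le> h * K_res" unfolding res2_def by (intro s) (simp add: mult.assoc)
  have "\<bar>- rate * (k' y * k z) + amp t * (k y * k'' z)\<bar> \<le> K_res"
    using m[OF kk(3)[of y z], of "- rate" "rate"] m[OF kk(5)[of y z] pos(5)] posk rate_pos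
    unfolding K by simp
  then show "\<bar>res3 t y z\<bar> \<le> h * K_res" unfolding res3_def by (intro s) (simp add: mult.assoc)
qed

lemmas admissible_simps = admissible_profiles periodic_comoving continuous_comoving continuous_comoving_slice
  periodic_vec2 continuous_vec2 continuous_vec2_slice

text \<open>The packet as a state, its time derivative, and the value of the generator at it.\<close>

definition "packet t = (abs_L2 (vec2 E1 E2 t), abs_L2 (comoving bb t))"
definition "packet' t = (abs_L2 (vec2 E1_t E2_t t), abs_L2 (comoving b_t t))"
definition "packet_gen t = (rot_L2 (abs_L2 (vec2 b_1 b_2 t)) - \<sigma> *\<^sub>R abs_L2 (vec2 E1 E2 t),
  - abs_L2 (\<lambda>x. comoving E2_1 t x - comoving E1_2 t x))"

lemma packet_graph: "(packet t, packet_gen t) \<in> maxwell_ohm_graph \<sigma>"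
proof -
  have "weak_grad (abs_L2 (comoving bb t)) (abs_L2 (vec2 b_1 b_2 t))"
  proof (rule weak_gradI)
    fix x i
    show "((\<lambda>s. comoving bb t (x + s *\<^sub>R axis i 1)) has_real_derivative vec2 b_1 b_2 t x $ i) (at 0)"
      using comoving_space_derivatives(1,2)[of t x] exhaust_2[of i] by auto
  qed (simp_all add: admissible_simps)
  moreover have "weak_curl (abs_L2 (vec2 E1 E2 t)) (abs_L2 (\<lambda>x. comoving E2_1 t x - comoving E1_2 t x))"
    by (rule weak_curlI) (simp_all add: admissible_simps comoving_space_derivatives(3,4))
  ultimately show ?thesis
    unfolding maxwell_ohm_graph_def packet_def packet_gen_def by blast
qed

lemma packet_derivative:
  assumes "t \<in> {0..T}"
  shows "(packet has_vector_derivative packet' t) (at t within {0..T})"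
  unfolding packet_def[abs_def] packet'_def
proof (intro has_vector_derivative_Pair abs_L2_has_vector_derivative)
  fix t x assume "t \<in> {0..T}"
  have "((\<lambda>t. comoving E1 t x *\<^sub>R (axis 1 1 :: real^2)) has_vector_derivative comoving E1_t t x *\<^sub>R axis 1 1) (at t within {0..T})"
    "((\<lambda>t. comoving E2 t x *\<^sub>R (axis 2 1 :: real^2)) has_vector_derivative comoving E2_t t x *\<^sub>R axis 2 1) (at t within {0..T})"
    using has_vector_derivative_scaleR[OF DERIV_subset[OF comoving_time_derivatives(1)[of x t] subset_UNIV] has_vector_derivative_const]
      has_vector_derivative_scaleR[OF DERIV_subset[OF comoving_time_derivatives(2)[of x t] subset_UNIV] has_vector_derivative_const] by auto
  from has_vector_derivative_add[OF this]
  show "((\<lambda>t. vec2 E1 E2 t x) has_vector_derivative vec2 E1_t E2_t t x) (at t within {0..T})"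
    by (simp add: vec2_def)
  show "((\<lambda>t. comoving bb t x) has_vector_derivative comoving b_t t x) (at t within {0..T})"
    using DERIV_subset[OF comoving_time_derivatives(3)[of x t] subset_UNIV]
    by (simp add: has_real_derivative_iff_has_vector_derivative)
qed (use assms in \<open>simp_all add: admissible_simps\<close>)

lemma packet_gen_eq: "packet_gen t = (abs_L2 (\<lambda>x. rot (vec2 b_1 b_2 t x) - \<sigma> *\<^sub>R vec2 E1 E2 t x),
    abs_L2 (\<lambda>x. - (comoving E2_1 t x - comoving E1_2 t x)))"
  by (simp add: packet_gen_def rot_L2_abs si_vec2 si_comoving admissible_profiles abs_L2_scaleR abs_L2_diff
      abs_L2_minus square_integrable_scaleR square_integrable_diff)

lemma packet_cont: "continuous_on {0..T} packet'" "continuous_on {0..T} packet_gen"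
proof -
  show "continuous_on {0..T} packet'"
    unfolding packet'_def[abs_def]
    by (intro continuous_intros continuous_on_abs_L2) (simp_all add: admissible_simps)
  have 1: "periodic (\<lambda>x. rot (vec2 b_1 b_2 t x) - \<sigma> *\<^sub>R vec2 E1 E2 t x)" for t
    using periodic_vec2[of b_1 b_2 t] periodic_vec2[of E1 E2 t] by (simp add: periodic_def admissible_profiles)
  have 2: "periodic (\<lambda>x. - (comoving E2_1 t x - comoving E1_2 t x))" for t
    using periodic_comoving[of E2_1 t] periodic_comoving[of E1_2 t] by (simp add: periodic_def admissible_profiles)
  have 3: "continuous_on ({0..T} \<times> UNIV) (\<lambda>(t, x). rot (vec2 b_1 b_2 t x) - \<sigma> *\<^sub>R vec2 E1 E2 t x)"
    using continuous_vec2[of b_1 b_2 "{0..T} \<times> UNIV"] continuous_vec2[of E1 E2 "{0..T} \<times> UNIV"]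
    unfolding split_beta by (intro continuous_intros) (simp_all add: admissible_profiles)
  have 4: "continuous_on ({0..T} \<times> UNIV) (\<lambda>(t, x). - (comoving E2_1 t x - comoving E1_2 t x))"
    using continuous_comoving[of E2_1 "{0..T} \<times> UNIV"] continuous_comoving[of E1_2 "{0..T} \<times> UNIV"]
    unfolding split_beta by (intro continuous_intros) (simp_all add: admissible_profiles)
  show "continuous_on {0..T} packet_gen"
    unfolding packet_gen_eq[abs_def]
    by (intro continuous_intros continuous_on_abs_L2 1 2 3 4)
qed

text \<open>The amplitude solves the transport equation along the ray exactly, so that only terms of
  relative size \<open>1/N\<close> remain.\<close>

lemma packet_residual:
  assumes t: "t \<in> {0..T}"
  shows "norm (packet' t - packet_gen t - source t (packet t)) \<le> 6 * pi * (h * K_res)"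
proof -
  have src: "source t (packet t) = (abs_L2 (\<lambda>x. - (\<sigma> * comoving bb t x) *\<^sub>R rot (v t x)), 0)"
    unfolding source_def packet_def snd_conv
    using \<sigma> by (subst ohm_source_abs) (simp_all add: v_periodic[OF t] v_slice[OF t] admissible_simps)
  have si: "square_integrable (\<lambda>x. - (\<sigma> * comoving bb t x) *\<^sub>R rot (v t x))"
  proof (rule square_integrable_continuous)
    show "continuous_on UNIV (\<lambda>x. - (\<sigma> * comoving bb t x) *\<^sub>R rot (v t x))"
      by (intro continuous_intros v_slice[OF t] continuous_comoving_slice admissible_profiles)
    show "periodic (\<lambda>x. - (\<sigma> * comoving bb t x) *\<^sub>R rot (v t x))"
      using v_periodic[OF t] periodic_comoving[OF admissible_profiles(3), of t] by (simp add: periodic_def)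
  qed
  have pt: "vec2 E1_t E2_t t x - (rot (vec2 b_1 b_2 t x) - \<sigma> *\<^sub>R vec2 E1 E2 t x)
      - - (\<sigma> * comoving bb t x) *\<^sub>R rot (v t x) = vec2 res1 res2 t x" for x
  proof -
    define a where "a = 1 + 2 / (\<sigma> * (t + \<delta>))"
    have "comoving bb t x *\<^sub>R rot (v t x) = comoving bb t x *\<^sub>R (a *\<^sub>R rot dir)"
    proof (cases "comoving bb t x = 0")
      case False
      then have "k (x $ 1 - x0 $ 1 - t) \<noteq> 0" "k (x $ 2 - x0 $ 2) \<noteq> 0" by (auto simp: comoving_def bb_def)
      then have "v t x = a *\<^sub>R dir" unfolding a_def using core[OF t] k_support by blast
      then show ?thesis by (simp add: linear_cmul[OF linear_rot])
    qed simp
    from arg_cong[OF this, of "\<lambda>u. - \<sigma> *\<^sub>R u"]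
    have e: "- (\<sigma> * comoving bb t x) *\<^sub>R rot (v t x) = - (\<sigma> * a * comoving bb t x) *\<^sub>R rot dir"
      by (simp add: mult_ac)
    have pos: "t + \<delta> > 0" using t \<delta> by auto
    show ?thesis
      unfolding e
      using residual_identities[OF pos, of "x $ 1 - x0 $ 1 - t" "x $ 2 - x0 $ 2", folded a_def]
      by (simp add: vec_eq_iff forall_2 comoving_def dir_def axis_def algebra_simps)
  qed
  have pt3: "comoving b_t t x - - (comoving E2_1 t x - comoving E1_2 t x) = comoving res3 t x" for x
    using residual_identities(3)[of t "x $ 1 - x0 $ 1 - t" "x $ 2 - x0 $ 2"] t \<delta> by (simp add: comoving_def)
  have si2: "square_integrable (\<lambda>x. rot (vec2 b_1 b_2 t x) - \<sigma> *\<^sub>R vec2 E1 E2 t x)"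
    by (simp add: rot_L2_abs(1) si_vec2 admissible_profiles square_integrable_scaleR square_integrable_diff)
  have "packet' t - packet_gen t - source t (packet t) = (abs_L2 (vec2 res1 res2 t), abs_L2 (comoving res3 t))"
    unfolding packet'_def packet_gen_eq src
    by (simp only: diff_Pair diff_zero abs_L2_diff si si2 si_vec2 si_comoving admissible_profiles
        square_integrable_diff square_integrable_minus pt pt3)
  then have "norm (packet' t - packet_gen t - source t (packet t))
      \<le> norm (abs_L2 (vec2 res1 res2 t)) + norm (abs_L2 (comoving res3 t))"
    by (simp add: norm_Pair sqrt_sum_squares_le_sum)
  also have "norm (abs_L2 (vec2 res1 res2 t)) \<le> 2 * pi * (2 * (h * K_res))"
  proof (rule norm_abs_L2_le)
    fix x
    show "norm (vec2 res1 res2 t x) \<le> 2 * (h * K_res)"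
      using norm_vec2_le[of res1 res2 t x]
        residual_bounds(1,2)[OF t, of "x $ 1 - x0 $ 1 - t" "x $ 2 - x0 $ 2"]
      unfolding comoving_def by linarith
  qed (simp add: si_vec2 admissible_profiles)
  also have "norm (abs_L2 (comoving res3 t)) \<le> 2 * pi * (h * K_res)"
    by (rule norm_abs_L2_le) (use residual_bounds(3)[OF t] in \<open>simp_all add: si_comoving admissible_profiles comoving_def\<close>)
  finally show ?thesis by simp
qed

definition "mass = norm (abs_L2 (comoving bb 0))"

text \<open>The electric and the magnetic leading parts have the same norm; the correctors contribute the
  error of size \<open>h\<close>.\<close>

lemma norm_packet_0: "norm (packet 0) \<le> 2 * mass + 2 * pi * (h * ((1 + rate) * \<kappa>\<^sup>2))"
proof -
  define f where "f t y z = E2 t y z - bb t y z" for t y z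
  define g :: "real \<Rightarrow> real \<Rightarrow> real \<Rightarrow> real" where "g t y z = 0" for t y z
  have f: "admissible f" using admissible_profiles(2,3) by (auto simp: admissible_def f_def split_beta intro!: continuous_intros)
  have g: "admissible g" by (simp add: admissible_def g_def split_beta)
  have "vec2 E1 E2 0 = (\<lambda>x. vec2 E1 f 0 x + vec2 g bb 0 x)"
    by (simp add: fun_eq_iff vec2_def comoving_def f_def g_def algebra_simps)
  then have "abs_L2 (vec2 E1 E2 0) = abs_L2 (vec2 E1 f 0) + abs_L2 (vec2 g bb 0)"
    by (simp add: abs_L2_add si_vec2 admissible_profiles f g)
  moreover have "norm (abs_L2 (vec2 g bb 0)) \<le> 1 * mass"
    unfolding mass_def
  proof (rule norm_abs_L2_le_mult(2)[OF si_comoving[OF admissible_profiles(3)]])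
    show "norm (vec2 g bb 0 x) \<le> 1 * norm (comoving bb 0 x)" for x
      using norm_vec2_le[of g bb 0 x] by (simp add: comoving_def g_def)
  qed (use si_vec2[OF g admissible_profiles(3), of 0] in \<open>simp_all add: square_integrable_def\<close>)
  moreover have "norm (abs_L2 (vec2 E1 f 0)) \<le> 2 * pi * (h * ((1 + rate) * \<kappa>\<^sup>2))"
  proof (rule norm_abs_L2_le)
    fix x :: "real^2"
    let ?y = "x $ 1 - x0 $ 1 - 0" let ?z = "x $ 2 - x0 $ 2"
    have "\<bar>k ?y * k' ?z\<bar> * \<bar>sin (real N * ?y)\<bar> \<le> \<kappa>\<^sup>2 * 1" "\<bar>k ?y * k ?z\<bar> * \<bar>sin (real N * ?y)\<bar> \<le> \<kappa>\<^sup>2 * 1"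
      using mult_mono[OF abs_kk_le[OF k_bound(1)[of ?y] k_bound(2)[of ?z]] abs_sin_le_one[of "real N * ?y"]]
        mult_mono[OF abs_kk_le[OF k_bound(1)[of ?y] k_bound(1)[of ?z]] abs_sin_le_one[of "real N * ?y"]]
      by simp_all
    moreover have "\<bar>comoving E1 0 x\<bar> = h * (\<bar>k ?y * k' ?z\<bar> * \<bar>sin (real N * ?y)\<bar>)"
      "\<bar>comoving f 0 x\<bar> = (h * rate) * (\<bar>k ?y * k ?z\<bar> * \<bar>sin (real N * ?y)\<bar>)"
      using rate_pos h_pos by (simp_all add: comoving_def E1_def f_def E2_def bb_def amp_bounds(3) abs_mult)
    ultimately have "\<bar>comoving E1 0 x\<bar> \<le> h * \<kappa>\<^sup>2" "\<bar>comoving f 0 x\<bar> \<le> (h * rate) * \<kappa>\<^sup>2"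
      using rate_pos h_pos by (simp_all only: mult_1_right mult_left_mono less_imp_le mult_pos_pos)
    then have "norm (vec2 E1 f 0 x) \<le> h * \<kappa>\<^sup>2 + (h * rate) * \<kappa>\<^sup>2"
      using norm_vec2_le[of E1 f 0 x] by linarith
    also have "\<dots> = h * ((1 + rate) * \<kappa>\<^sup>2)" by (simp add: algebra_simps)
    finally show "norm (vec2 E1 f 0 x) \<le> h * ((1 + rate) * \<kappa>\<^sup>2)" .
  qed (simp add: si_vec2 admissible_profiles f)
  ultimately have "norm (abs_L2 (vec2 E1 E2 0)) \<le> 2 * pi * (h * ((1 + rate) * \<kappa>\<^sup>2)) + mass"
    using norm_triangle_ineq[of "abs_L2 (vec2 E1 f 0)" "abs_L2 (vec2 g bb 0)"] by simp
  moreover have "norm (packet 0) \<le> norm (abs_L2 (vec2 E1 E2 0)) + mass"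
    unfolding packet_def mass_def by (simp add: norm_Pair sqrt_sum_squares_le_sum)
  ultimately show ?thesis by linarith
qed

text \<open>The magnetic part at time \<open>T\<close> is a translate of the initial one times \<open>amp T\<close>, because the
  amplitude starts at \<open>1\<close>.\<close>

lemma norm_packet_T: "norm (packet T) \<ge> amp T * mass"
proof -
  have "(norm (abs_L2 (comoving bb T)))\<^sup>2 = (LINT x:cell|lborel. (amp T)\<^sup>2 * (comoving bb 0 (x - T *\<^sub>R axis 1 1))\<^sup>2)"
    unfolding norm_abs_L2[OF si_comoving[OF admissible_profiles(3)]]
    by (rule arg_cong[where f="set_lebesgue_integral lborel cell"])
       (simp add: fun_eq_iff comoving_def bb_def amp_bounds(3) axis_def power_mult_distrib algebra_simps)
  also have "\<dots> = (amp T)\<^sup>2 * (LINT x:cell|lborel. (comoving bb 0 (x + - T *\<^sub>R axis 1 1))\<^sup>2)" by simp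
  also have "(LINT x:cell|lborel. (comoving bb 0 (x + - T *\<^sub>R axis 1 1))\<^sup>2) = (LINT x:cell|lborel. (comoving bb 0 x)\<^sup>2)"
    by (rule integral_cell_shift[where f="\<lambda>x. (comoving bb 0 x)\<^sup>2"])
       (use periodic_comoving[OF admissible_profiles(3), of 0] in \<open>auto simp: periodic_def intro!: continuous_intros continuous_comoving_slice admissible_profiles\<close>)
  also have "(amp T)\<^sup>2 * \<dots> = (amp T * mass)\<^sup>2"
    using norm_abs_L2[OF si_comoving[OF admissible_profiles(3)], of 0] by (simp add: mass_def power_mult_distrib)
  finally have "norm (abs_L2 (comoving bb T)) = amp T * mass"
    using amp_bounds(4) by (simp add: mass_def power2_eq_iff_nonneg)
  moreover have "norm (abs_L2 (comoving bb T)) \<le> norm (packet T)"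
    unfolding packet_def by (rule norm_snd_le)
  ultimately show ?thesis by simp
qed

end

definition "profile_mass = (LINT x:cell|lborel. (k (x $ 1 - x0 $ 1) * k (x $ 2 - x0 $ 2))\<^sup>2)"

text \<open>The integrand is continuous, nonnegative and nonzero at the centre \<open>x0\<close>.\<close>

lemma profile_mass_pos: "profile_mass > 0"
proof -
  let ?f = "\<lambda>x :: real^2. (k (x $ 1 - x0 $ 1) * k (x $ 2 - x0 $ 2))\<^sup>2"
  have c: "continuous_on A ?f" for A by (intro continuous_intros)
  have p: "periodic ?f"
    using k_periodic(1)[of "x $ i - x0 $ i" for x i]
    unfolding periodic_def by (auto simp: axis_def algebra_simps)
  have i: "set_integrable lborel cell ?f"
    by (rule L1_le_L2(1)[OF square_integrable_continuous[OF c p]])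
  obtain m where m: "x0 + lat m \<in> cell" using ex_lat_cell by blast
  have "?f (x0 + lat m) \<noteq> 0"
    unfolding periodic_lat[OF p] using k_0 by simp
  have "profile_mass \<noteq> 0"
  proof
    assume "profile_mass = 0"
    have "(?f has_integral 0) cell"
      using set_borel_integral_eq_integral[OF i] \<open>profile_mass = 0\<close> unfolding profile_mass_def
      by (simp add: has_integral_integrable_integral)
    then have "?f (x0 + lat m) = 0"
      using m unfolding cell_def
      by (intro has_integral_0_cbox_imp_0[OF c]) (auto simp: interval_ne_empty_cart)
    with \<open>?f (x0 + lat m) \<noteq> 0\<close> show False by simp
  qed
  moreover have "profile_mass \<ge> 0" unfolding profile_mass_def set_lebesgue_integral_def by (rule Bochner_Integration.integral_nonneg) simp
  ultimately show ?thesis by simp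
qed

text \<open>The oscillating factor halves the mass up to an error of size \<open>1/N\<close>: the double-angle term
  is a derivative up to such an error.\<close>

lemma mass_lower_bound:
  assumes N: "N \<ge> 1"
  shows "(mass N)\<^sup>2 \<ge> profile_mass / 2 - 2 * pi\<^sup>2 * \<kappa>^4 / N"
proof -
  define y z where "y x = x $ 1 - x0 $ 1" and "z x = x $ 2 - x0 $ 2" for x :: "real^2"
  \<comment> \<open>\<open>g\<close> is the derivative of \<open>f\<close> in the first direction; it consists of the double-angle term and of
    the small term \<open>r\<close>.\<close>
  define f where "f x = (k (y x) * k (z x))\<^sup>2 * sin (2 * real N * y x) / (2 * N)" for x
  define r where "r x = k (y x) * k' (y x) * (k (z x))\<^sup>2 * sin (2 * real N * y x) / N" for x
  define g where "g x = (k (y x) * k (z x))\<^sup>2 * cos (2 * real N * y x) + r x" for x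
  note defs = f_def r_def g_def y_def z_def
  have tp: "sin (2 * real N * (s + 2 * pi)) = sin (2 * real N * s)" "cos (2 * real N * (s + 2 * pi)) = cos (2 * real N * s)" for s
  proof -
    have *: "2 * real N * (s + 2 * pi) = 2 * real N * s + 2 * of_nat (2 * N) * pi" by (simp add: algebra_simps)
    show "sin (2 * real N * (s + 2 * pi)) = sin (2 * real N * s)" "cos (2 * real N * (s + 2 * pi)) = cos (2 * real N * s)"
      unfolding * sin_add cos_add by (simp_all del: of_nat_mult)
  qed
  have yz: "y (x + axis 1 (2 * pi)) = y x + 2 * pi" "z (x + axis 1 (2 * pi)) = z x"
    "y (x + axis 2 (2 * pi)) = y x" "z (x + axis 2 (2 * pi)) = z x + 2 * pi" for x
    by (simp_all add: y_def z_def axis_def)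
  have per: "periodic h" if "\<And>x. h (x + axis 1 (2 * pi)) = h x" "\<And>x. h (x + axis 2 (2 * pi)) = h x" for h :: "real^2 \<Rightarrow> real"
    unfolding periodic_def using that exhaust_2 by metis
  have pf: "periodic f" "periodic r" "periodic g" "periodic (\<lambda>x. (k (y x) * k (z x))\<^sup>2)"
    by (rule per; simp add: f_def g_def r_def yz tp k_periodic)+
  have cf: "continuous_on UNIV f" "continuous_on UNIV r" "continuous_on UNIV g" "continuous_on UNIV (\<lambda>x. (k (y x) * k (z x))\<^sup>2)"
    unfolding defs using N by (auto intro!: continuous_intros)
  have "(LINT x:cell|lborel. g x) = 0"
  proof (rule integral_cell_derivative[OF pf(1) cf(1) cf(3), where e="axis 1 1"])
    fix x
    have "y (x + s *\<^sub>R axis 1 1) = y x + s" "z (x + s *\<^sub>R axis 1 1) = z x" for s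
      by (simp_all add: y_def z_def axis_def)
    then have f_dir: "(\<lambda>s. f (x + s *\<^sub>R axis 1 1)) = (\<lambda>s. k (y x + s) * k (y x + s) * (k (z x) * k (z x))
        * sin (2 * real N * (y x + s)) * (1 / (2 * real N)))"
      by (simp add: f_def power2_eq_square mult_ac)
    show "((\<lambda>s. f (x + s *\<^sub>R axis 1 1)) has_real_derivative g x) (at 0)"
      unfolding f_dir
      by (rule DERIV_cong, (rule comoving_derivative_rules)+,
          use N in \<open>simp add: g_def r_def field_simps power2_eq_square\<close>)
  qed
  moreover have "\<bar>LINT x:cell|lborel. r x\<bar> \<le> 4 * pi\<^sup>2 * \<kappa>^4 / N"
  proof -
    have "\<bar>r x\<bar> \<le> \<kappa>^4 / N" for x
    proof -
      have "\<bar>k (y x) * k' (y x)\<bar> * \<bar>k (z x) * k (z x)\<bar> * \<bar>sin (2 * real N * y x)\<bar> \<le> \<kappa>\<^sup>2 * \<kappa>\<^sup>2 * 1"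
        using mult_mono[of "\<bar>k (y x)\<bar>" \<kappa> "\<bar>k' (y x)\<bar>" \<kappa>] mult_mono[of "\<bar>k (z x)\<bar>" \<kappa> "\<bar>k (z x)\<bar>" \<kappa>]
          k_bound(1)[of "y x"] k_bound(1)[of "z x"] k_bound(2)[of "y x"]
        by (intro mult_mono) (auto simp: abs_mult power2_eq_square)
      moreover have "\<bar>k (y x) * k' (y x) * (k (z x))\<^sup>2 * sin (2 * real N * y x)\<bar>
          = \<bar>k (y x) * k' (y x)\<bar> * \<bar>k (z x) * k (z x)\<bar> * \<bar>sin (2 * real N * y x)\<bar>"
        by (simp add: abs_mult power2_eq_square)
      moreover have "\<kappa>\<^sup>2 * \<kappa>\<^sup>2 * 1 = \<kappa>^4" by (simp flip: power_add)
      ultimately have "\<bar>k (y x) * k' (y x) * (k (z x))\<^sup>2 * sin (2 * real N * y x)\<bar> \<le> \<kappa>^4"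
        by linarith
      then show ?thesis using N by (simp add: r_def divide_right_mono)
    qed
    then have "\<bar>LINT x:cell|lborel. r x\<bar> \<le> (LINT x:cell|lborel. \<kappa>^4 / N)"
      using L1_le_L2(1)[OF square_integrable_continuous[OF cf(2) pf(2)]] set_integrable_cell_const[of "\<kappa>^4 / N"]
      unfolding set_lebesgue_integral_def set_integrable_def
      by (intro integral_abs_bound_integral) (auto simp: indicator_def)
    then show ?thesis by (simp add: set_lebesgue_integral_def measure_cell)
  qed
  moreover have "(mass N)\<^sup>2 = (LINT x:cell|lborel. ((k (y x) * k (z x))\<^sup>2 + (g x - r x)) / 2)"
    unfolding mass_def[OF N] norm_abs_L2[OF si_comoving[OF admissible_profiles(3)[OF N]]]
  proof (rule arg_cong[where f="set_lebesgue_integral lborel cell"], rule ext)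
    fix x
    have "cos (2 * real N * y x) = 2 * (cos (real N * y x))\<^sup>2 - 1"
      using cos_double_cos[of "real N * y x"] by (simp add: mult.assoc)
    then have half: "(cos (real N * y x))\<^sup>2 = (1 + cos (2 * real N * y x)) / 2" by simp
    have "comoving (bb N) 0 x = k (y x) * k (z x) * cos (real N * y x)"
      by (simp add: comoving_def bb_def[OF N] amp_bounds(3) y_def z_def)
    then have "(norm (comoving (bb N) 0 x))\<^sup>2 = (k (y x) * k (z x))\<^sup>2 * (cos (real N * y x))\<^sup>2"
      by (simp add: power_mult_distrib)
    then show "(norm (comoving (bb N) 0 x))\<^sup>2 = ((k (y x) * k (z x))\<^sup>2 + (g x - r x)) / 2"
      unfolding half by (simp add: g_def field_simps)
  qed
  moreover have "(LINT x:cell|lborel. ((k (y x) * k (z x))\<^sup>2 + (g x - r x)) / 2)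
      = (profile_mass + ((LINT x:cell|lborel. g x) - (LINT x:cell|lborel. r x))) / 2"
  proof -
    have i: "set_integrable lborel cell (\<lambda>x. (k (y x) * k (z x))\<^sup>2)" "set_integrable lborel cell g" "set_integrable lborel cell r"
      using cf pf by (auto intro!: L1_le_L2(1) square_integrable_continuous)
    show ?thesis using i by (simp add: profile_mass_def y_def z_def set_integral_add set_integral_diff)
  qed
  ultimately show ?thesis by (simp add: field_simps abs_le_iff)
qed

text \<open>The frequency is chosen so large that the mass of the packet is at least \<open>\<mu>\<close> and that both the
  distance from the mild solution and the norm of the correctors are at most \<open>\<mu> / 2\<close>. Then the
  initial norm is at most \<open>5 / 2\<close> times the mass and the terminal norm at least \<open>amp T - 1 / 2\<close> times
  the mass, and \<open>amp T \<ge> 1\<close> absorbs the loss.\<close>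

lemma norm_evolution_lower_bound: "norm (evolution S \<sigma> T v) \<ge> (T + \<delta>) / (5 * \<delta>)"
proof -
  have amp1: "amp T \<ge> 1" using \<delta> T by (simp add: amp_def)
  define \<mu> where "\<mu> = sqrt profile_mass / 2"
  have \<mu>: "\<mu> > 0" using profile_mass_pos by (simp add: \<mu>_def)
  define C1 where "C1 = 2 * (T * (6 * pi * K_res)) * exp (2 * (\<sigma> * bound) * T)"
  define C2 where "C2 = 2 * pi * ((1 + rate) * \<kappa>\<^sup>2)"
  have "\<exists>N::nat. N \<ge> 1 \<and> 2 * C1 / \<mu> \<le> N \<and> 2 * C2 / \<mu> \<le> N \<and> 8 * pi\<^sup>2 * \<kappa>^4 / profile_mass \<le> N"
  proof -
    obtain N :: nat where "max (max 1 (2 * C1 / \<mu>)) (max (2 * C2 / \<mu>) (8 * pi\<^sup>2 * \<kappa>^4 / profile_mass)) \<le> N"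
      using real_arch_simple by blast
    then show ?thesis by (intro exI[of _ N]) simp
  qed
  then obtain N :: nat where N: "N \<ge> 1" and N1: "C1 / N \<le> \<mu> / 2" "C2 / N \<le> \<mu> / 2" "2 * pi\<^sup>2 * \<kappa>^4 / N \<le> profile_mass / 4"
    using \<mu> profile_mass_pos by (auto simp: field_simps)
  have "(mass N)\<^sup>2 \<ge> \<mu>\<^sup>2"
    using mass_lower_bound[OF N] N1(3) profile_mass_pos by (simp add: \<mu>_def power_divide)
  then have m: "mass N \<ge> \<mu>"
    using power2_le_imp_le[of \<mu> "mass N"] by (simp add: mass_def[OF N])
  obtain X where X: "mild (packet N 0) X" using ex_mild by blast
  have "norm (X T - packet N T) \<le> 2 * (T * (6 * pi * (h N * K_res))) * exp (2 * (\<sigma> * bound) * T)"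
    using T by (intro approximate_solution[OF packet_derivative[OF N] packet_graph[OF N] packet_cont[OF N] packet_residual[OF N] X]) auto
  also have "\<dots> = C1 / N" by (simp add: C1_def h_def[OF N])
  finally have "norm (X T) \<ge> amp T * mass N - C1 / N"
    using norm_packet_T[OF N] norm_triangle_ineq2[of "packet N T" "X T"] by (simp add: norm_minus_commute)
  moreover have "norm (X T) \<le> norm (evolution S \<sigma> T v) * norm (packet N 0)"
    using norm_blinfun[of "evolution S \<sigma> T v" "packet N 0"] evolution_eq[OF X] by simp
  moreover have "norm (packet N 0) \<le> 5 / 2 * mass N"
  proof -
    have "2 * pi * (h N * ((1 + rate) * \<kappa>\<^sup>2)) = C2 / N" by (simp add: C2_def h_def[OF N])
    then show ?thesis using norm_packet_0[OF N] N1(2) m by linarith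
  qed
  then have "norm (evolution S \<sigma> T v) * norm (packet N 0) \<le> norm (evolution S \<sigma> T v) * (5 / 2 * mass N)"
    by (rule mult_left_mono) simp
  ultimately have "amp T * mass N - mass N / 2 \<le> norm (evolution S \<sigma> T v) * (5 / 2 * mass N)"
    using N1(1) m by linarith
  then have "(amp T - 1 / 2) * mass N \<le> (norm (evolution S \<sigma> T v) * 5 / 2) * mass N"
    by (simp add: algebra_simps)
  then have "amp T - 1 / 2 \<le> norm (evolution S \<sigma> T v) * 5 / 2"
    using m \<mu> by (simp add: mult_le_cancel_right)
  then have "norm (evolution S \<sigma> T v) \<ge> amp T / 5" using amp1 by simp
  then show ?thesis by (simp add: amp_def)
qed

end

section \<open>Calculus of smooth functions\<close>

lemma C_on_Suc_D:
  assumes "C_on (Suc k) U f" "x \<in> U"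
  shows "(f has_derivative frechet_derivative f (at x)) (at x)"
  using assms frechet_derivative_works by auto

lemma C_on_cong:
  assumes "open U" "\<And>x. x \<in> U \<Longrightarrow> f x = g x" "C_on k U f"
  shows "C_on k U g"
  using assms(2,3)
proof (induction k arbitrary: f g)
  case 0
  then show ?case by (simp cong: continuous_on_cong)
next
  case (Suc k)
  have d: "(g has_derivative frechet_derivative f (at x)) (at x)" if "x \<in> U" for x
    by (rule has_derivative_transform_within_open[OF C_on_Suc_D[OF Suc.prems(2) that] assms(1) that])
       (use Suc.prems(1) in auto)
  have eq: "frechet_derivative f (at x) v = frechet_derivative g (at x) v" if "x \<in> U" for x v
    using frechet_derivative_at[OF d[OF that]] by simp
  have "C_on k U (\<lambda>x. frechet_derivative g (at x) v)" for v
    by (rule Suc.IH[of "\<lambda>x. frechet_derivative f (at x) v"]) (use eq Suc.prems(2) in auto)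
  then show ?case using d by (auto simp: differentiable_def)
qed

lemma C_on_SucI:
  assumes "open U" "\<And>x. x \<in> U \<Longrightarrow> (f has_derivative D x) (at x)" "\<And>v. C_on k U (\<lambda>x. D x v)"
  shows "C_on (Suc k) U f"
proof -
  have "C_on k U (\<lambda>x. frechet_derivative f (at x) v)" for v
    by (rule C_on_cong[OF assms(1) _ assms(3)[of v]]) (use frechet_derivative_at[OF assms(2)] in simp)
  then show ?thesis using assms(2) by (auto simp: differentiable_def)
qed

lemma C_on_lower: "C_on (Suc k) U f \<Longrightarrow> C_on k U f"
proof (induction k arbitrary: f)
  case 0
  then have "\<forall>x\<in>U. isCont f x" by (simp add: differentiable_imp_continuous_within)
  then show ?case by (simp add: continuous_at_imp_continuous_on)
next
  case (Suc k)
  have "\<forall>x\<in>U. f differentiable (at x)"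
    using Suc.prems unfolding C_on.simps(2)[of "Suc k"] by blast
  moreover have "C_on k U (\<lambda>x. frechet_derivative f (at x) v)" for v
    by (rule Suc.IH) (use Suc.prems C_on.simps(2)[of "Suc k"] in blast)
  ultimately show ?case unfolding C_on.simps(2)[of k] by blast
qed

text \<open>Smoothness is a local property, so it can be checked in charts in which different formulas hold.\<close>

lemma C_on_local:
  assumes "\<And>x. x \<in> U \<Longrightarrow> \<exists>V. open V \<and> x \<in> V \<and> C_on k V f"
  shows "C_on k U f"
  using assms
proof (induction k arbitrary: f)
  case 0
  have "isCont f x" if "x \<in> U" for x
    using 0[OF that] by (auto simp: continuous_on_eq_continuous_at)
  then show ?case by (simp add: continuous_at_imp_continuous_on)
next
  case (Suc k)
  have "f differentiable (at x)" if "x \<in> U" for x using Suc.prems[OF that] by auto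
  moreover have "C_on k U (\<lambda>x. frechet_derivative f (at x) v)" for v
  proof (rule Suc.IH)
    fix x assume "x \<in> U"
    from Suc.prems[OF this] obtain V where "open V" "x \<in> V" "C_on (Suc k) V f" by blast
    then show "\<exists>V. open V \<and> x \<in> V \<and> C_on k V (\<lambda>x. frechet_derivative f (at x) v)"
      by (intro exI[of _ V]) simp
  qed
  ultimately show ?case by simp
qed

lemma C_on_const: "open U \<Longrightarrow> C_on k U (\<lambda>x. c)"
proof (induction k arbitrary: c)
  case (Suc k)
  then show ?case by (intro C_on_SucI[where D="\<lambda>x v. 0"]) auto
qed simp

lemma C_on_bounded_linear:
  assumes "open U" "bounded_linear f"
  shows "C_on k U f"
proof (cases k)
  case 0
  then show ?thesis using linear_continuous_on[OF assms(2)] by simp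
next
  case (Suc m)
  show ?thesis unfolding Suc
    by (rule C_on_SucI[OF assms(1) bounded_linear_imp_has_derivative[OF assms(2)]]) (rule C_on_const[OF assms(1)])
qed

lemma C_on_add:
  assumes "open U"
  shows "C_on k U f \<Longrightarrow> C_on k U g \<Longrightarrow> C_on k U (\<lambda>x. f x + g x)"
proof (induction k arbitrary: f g)
  case 0
  then show ?case by (auto intro!: continuous_intros)
next
  case (Suc k)
  show ?case
  proof (rule C_on_SucI[OF assms])
    show "((\<lambda>x. f x + g x) has_derivative (\<lambda>v. frechet_derivative f (at x) v + frechet_derivative g (at x) v)) (at x)"
      if "x \<in> U" for x
      by (intro has_derivative_add C_on_Suc_D[OF Suc.prems(1) that] C_on_Suc_D[OF Suc.prems(2) that])
    show "C_on k U (\<lambda>x. frechet_derivative f (at x) v + frechet_derivative g (at x) v)" for v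
      using Suc by auto
  qed
qed

lemma C_on_bilinear:
  assumes "open U" "bounded_bilinear pr"
  shows "C_on k U f \<Longrightarrow> C_on k U g \<Longrightarrow> C_on k U (\<lambda>x. pr (f x) (g x))"
proof (induction k arbitrary: f g)
  case 0
  then show ?case by (auto intro!: bounded_bilinear.continuous_on[OF assms(2)])
next
  case (Suc k)
  show ?case
  proof (rule C_on_SucI[OF assms(1)])
    show "((\<lambda>x. pr (f x) (g x)) has_derivative
        (\<lambda>v. pr (f x) (frechet_derivative g (at x) v) + pr (frechet_derivative f (at x) v) (g x))) (at x)"
      if "x \<in> U" for x
      by (intro bounded_bilinear.FDERIV[OF assms(2)] C_on_Suc_D[OF Suc.prems(1) that] C_on_Suc_D[OF Suc.prems(2) that])
    show "C_on k U (\<lambda>x. pr (f x) (frechet_derivative g (at x) v) + pr (frechet_derivative f (at x) v) (g x))" for v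
      using Suc.prems C_on_lower[OF Suc.prems(1)] C_on_lower[OF Suc.prems(2)]
      by (intro C_on_add[OF assms(1)] Suc.IH) auto
  qed
qed

lemmas C_on_mult = C_on_bilinear[OF _ bounded_bilinear_mult]
lemmas C_on_scaleR = C_on_bilinear[OF _ bounded_bilinear_scaleR]

lemma C_on_sum:
  assumes "open U" "finite I" "\<And>i. i \<in> I \<Longrightarrow> C_on k U (f i)"
  shows "C_on k U (\<lambda>x. \<Sum>i\<in>I. f i x)"
  using assms(2,3) by (induction I rule: finite_induct) (auto intro: C_on_const C_on_add assms(1))

text \<open>In \<^const>\<open>C_on\<close> only the derivatives in fixed directions are required to be smooth, whereas in the
  chain rule the direction varies with the point. Expanding it in the basis of the intermediate space
  reduces the derivative of the composition to sums of products.\<close>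

lemma C_on_compose:
  fixes f :: "'b::euclidean_space \<Rightarrow> 'c::real_normed_vector"
  assumes U: "open U"
  shows "C_on k V f \<Longrightarrow> C_on k U g \<Longrightarrow> (\<And>x. x \<in> U \<Longrightarrow> g x \<in> V) \<Longrightarrow> C_on k U (\<lambda>x. f (g x))"
proof (induction k arbitrary: f)
  case 0
  then show ?case using continuous_on_compose2[of V f U g] by auto
next
  case (Suc k)
  let ?D = "\<lambda>x v. \<Sum>i\<in>Basis. (frechet_derivative g (at x) v \<bullet> i) *\<^sub>R frechet_derivative f (at (g x)) i"
  show ?case
  proof (rule C_on_SucI[OF U])
    fix x assume x: "x \<in> U"
    have df: "(f has_derivative frechet_derivative f (at (g x))) (at (g x))"
      by (rule C_on_Suc_D[OF Suc.prems(1) Suc.prems(3)[OF x]])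
    have chain: "((\<lambda>x. f (g x)) has_derivative (\<lambda>v. frechet_derivative f (at (g x)) (frechet_derivative g (at x) v))) (at x)"
      by (rule has_derivative_compose[OF C_on_Suc_D[OF Suc.prems(2) x] df])
    have expand: "frechet_derivative f (at (g x)) w = (\<Sum>i\<in>Basis. (w \<bullet> i) *\<^sub>R frechet_derivative f (at (g x)) i)" for w
    proof -
      note lin = has_derivative_linear[OF df]
      have "frechet_derivative f (at (g x)) (\<Sum>i\<in>Basis. (w \<bullet> i) *\<^sub>R i)
          = (\<Sum>i\<in>Basis. (w \<bullet> i) *\<^sub>R frechet_derivative f (at (g x)) i)"
        by (simp only: linear_sum[OF lin] linear_cmul[OF lin])
      then show ?thesis by (simp only: euclidean_representation)
    qed
    show "((\<lambda>x. f (g x)) has_derivative ?D x) (at x)"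
      by (rule has_derivative_eq_rhs[OF chain]) (rule ext, rule expand)
  next
    fix v
    show "C_on k U (\<lambda>x. ?D x v)"
    proof (intro C_on_sum[OF U] C_on_scaleR[OF U])
      fix i :: 'b
      show "C_on k U (\<lambda>x. frechet_derivative f (at (g x)) i)"
        by (rule Suc.IH[OF _ C_on_lower[OF Suc.prems(2)] Suc.prems(3)]) (use Suc.prems(1) in simp_all)
      have "C_on k U (\<lambda>x. frechet_derivative g (at x) v)" using Suc.prems(2) by simp
      from C_on_bilinear[OF U bounded_bilinear_inner this C_on_const[OF U]]
      show "C_on k U (\<lambda>x. frechet_derivative g (at x) v \<bullet> i)" .
    qed simp
  qed
qed

lemma C_on_real_SucI:
  fixes f :: "real \<Rightarrow> real"
  assumes "open U" "\<And>x. x \<in> U \<Longrightarrow> (f has_real_derivative f' x) (at x)" "C_on k U f'"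
  shows "C_on (Suc k) U f"
proof (rule C_on_SucI[OF assms(1)])
  show "(f has_derivative (\<lambda>v. f' x * v)) (at x)" if "x \<in> U" for x
    using assms(2)[OF that] by (simp add: has_field_derivative_def)
  show "C_on k U (\<lambda>x. f' x * v)" for v
    by (intro C_on_mult[OF assms(1)] assms(3) C_on_const[OF assms(1)])
qed

lemma C_on_inverse: "C_on k {0<..} (inverse :: real \<Rightarrow> real)"
proof (induction k)
  case 0
  then show ?case by (auto intro!: continuous_intros)
next
  case (Suc k)
  show ?case
  proof (rule C_on_real_SucI)
    show "(inverse has_real_derivative - 1 * (inverse x * inverse x)) (at x)" if "x \<in> {0<..}" for x :: real
      using DERIV_inverse[of x] that by (simp add: power2_eq_square)
    show "C_on k {0<..} (\<lambda>x::real. - 1 * (inverse x * inverse x))"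
      by (intro C_on_mult Suc C_on_const) auto
  qed simp
qed

lemma C_on_ln: "C_on k {0<..} (ln :: real \<Rightarrow> real)"
proof (cases k)
  case 0
  then show ?thesis by (auto intro!: continuous_intros)
next
  case (Suc m)
  have "C_on (Suc m) {0<..} (ln :: real \<Rightarrow> real)"
    by (rule C_on_real_SucI[OF _ _ C_on_inverse]) (auto intro: DERIV_ln)
  then show ?thesis using Suc by simp
qed

section \<open>Partial derivatives in the plane\<close>

lemma partial_cong:
  assumes "open V" "y \<in> V" "\<And>x. x \<in> V \<Longrightarrow> f x = g x"
  shows "partial i f y = partial i g y"
proof -
  have "(f has_derivative D) (at y) \<longleftrightarrow> (g has_derivative D) (at y)" for D
    using has_derivative_transform_within_open[of f D y UNIV V g] has_derivative_transform_within_open[of g D y UNIV V f] assms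
    by auto
  then show ?thesis by (simp add: partial_def frechet_derivative_def)
qed

lemma partial_eqI:
  fixes f :: "real^2 \<Rightarrow> 'b::real_normed_vector"
  assumes "f differentiable (at y)" "((\<lambda>s. f (y + s *\<^sub>R axis i 1)) has_vector_derivative D) (at 0)"
  shows "partial i f y = D"
proof -
  have "(f has_derivative frechet_derivative f (at y)) (at (y + 0 *\<^sub>R axis i 1))"
    using assms(1) frechet_derivative_works by auto
  then have "((\<lambda>s. f (y + s *\<^sub>R axis i 1)) has_derivative (\<lambda>s. frechet_derivative f (at y) (s *\<^sub>R axis i 1))) (at 0)"
    by (rule has_derivative_compose[rotated]) (auto intro!: derivative_eq_intros)
  moreover have "frechet_derivative f (at y) (s *\<^sub>R axis i 1) = s *\<^sub>R partial i f y" for s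
    using linear_cmul[OF linear_frechet_derivative[OF assms(1)]] by (simp add: partial_def)
  ultimately have "((\<lambda>s. f (y + s *\<^sub>R axis i 1)) has_vector_derivative partial i f y) (at 0)"
    by (simp add: has_vector_derivative_def)
  then show ?thesis using assms(2) vector_derivative_unique_at by blast
qed

lemma sum_sq_pos: "y \<noteq> 0 \<Longrightarrow> (y $ 1)\<^sup>2 + (y $ 2)\<^sup>2 > 0" for y :: "real^2"
  by (auto simp: vec_eq_iff forall_2 sum_power2_gt_zero_iff)

lemma norm_sq: "(norm y)\<^sup>2 = (y $ 1)\<^sup>2 + (y $ 2)\<^sup>2" for y :: "real^2"
  unfolding power2_norm_eq_inner by (simp add: inner_vec_def sum_2 power2_eq_square)

lemma partial_nth:
  fixes f :: "real^2 \<Rightarrow> real^2"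
  assumes "f differentiable (at y)"
  shows "(\<lambda>x. f x $ i) differentiable (at y)" "partial j f y $ i = partial j (\<lambda>x. f x $ i) y"
proof -
  have d: "((\<lambda>x. f x $ i) has_derivative (\<lambda>w. frechet_derivative f (at y) w $ i)) (at y)"
    using bounded_linear.has_derivative[OF bounded_linear_vec_nth] assms frechet_derivative_works by blast
  then show "(\<lambda>x. f x $ i) differentiable (at y)" by (auto simp: differentiable_def)
  show "partial j f y $ i = partial j (\<lambda>x. f x $ i) y"
    by (simp add: partial_def frechet_derivative_at[OF d, symmetric])
qed

lemma line_nth: "(y + s *\<^sub>R axis 1 1) $ 1 = y $ 1 + s" "(y + s *\<^sub>R axis 1 1) $ 2 = y $ 2"
   "(y + s *\<^sub>R axis 2 1) $ 1 = y $ 1" "(y + s *\<^sub>R axis 2 1) $ 2 = y $ 2 + s" for y :: "real^2"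
  by (simp_all add: axis_def)

text \<open>For functions that are given away from the origin by a formula in the coordinates, partial
  derivatives are one-variable derivatives of that formula.\<close>

lemma partial_of_components:
  fixes f :: "real^2 \<Rightarrow> real"
  assumes d: "f differentiable (at y)" and y: "y \<noteq> 0"
    and f: "\<And>x. x \<noteq> 0 \<Longrightarrow> f x = g (x $ 1) (x $ 2)"
  shows "((\<lambda>a. g a (y $ 2)) has_real_derivative D1) (at (y $ 1)) \<Longrightarrow> partial 1 f y = D1"
    and "((\<lambda>b. g (y $ 1) b) has_real_derivative D2) (at (y $ 2)) \<Longrightarrow> partial 2 f y = D2"
proof -
  have ev: "\<forall>\<^sub>F s in nhds 0. f (y + s *\<^sub>R axis i 1) = g ((y + s *\<^sub>R axis i 1) $ 1) ((y + s *\<^sub>R axis i 1) $ 2)" for i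
  proof -
    have "open ((\<lambda>s::real. y + s *\<^sub>R axis i 1) -` (- {0}))"
      by (intro open_vimage continuous_intros)
    then have "\<forall>\<^sub>F s in nhds 0. y + s *\<^sub>R axis i 1 \<noteq> 0"
      using y eventually_nhds_in_open[of "(\<lambda>s::real. y + s *\<^sub>R axis i 1) -` (- {0})" 0] by simp
    then show ?thesis by (rule eventually_mono[OF _ f])
  qed
  {
    assume "((\<lambda>a. g a (y $ 2)) has_real_derivative D1) (at (y $ 1))"
    then have "((\<lambda>s. g (y $ 1 + s) (y $ 2)) has_real_derivative D1) (at 0)"
      using DERIV_shift[of "\<lambda>a. g a (y $ 2)" D1 0 "y $ 1"] by (simp add: add.commute)
    then have "((\<lambda>s. f (y + s *\<^sub>R axis 1 1)) has_real_derivative D1) (at 0)"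
      by (simp only: DERIV_cong_ev[OF refl ev[of 1] refl] line_nth)
    then show "partial 1 f y = D1"
      by (intro partial_eqI d) (simp add: has_real_derivative_iff_has_vector_derivative)
  next
    assume "((\<lambda>b. g (y $ 1) b) has_real_derivative D2) (at (y $ 2))"
    then have "((\<lambda>s. g (y $ 1) (y $ 2 + s)) has_real_derivative D2) (at 0)"
      using DERIV_shift[of "\<lambda>b. g (y $ 1) b" D2 0 "y $ 2"] by (simp add: add.commute)
    then have "((\<lambda>s. f (y + s *\<^sub>R axis 2 1)) has_real_derivative D2) (at 0)"
      by (simp only: DERIV_cong_ev[OF refl ev[of 2] refl] line_nth)
    then show "partial 2 f y = D2"
      by (intro partial_eqI d) (simp add: has_real_derivative_iff_has_vector_derivative)
  }
qed

section \<open>The pulses are smooth\<close>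

lemma floor_wrap_eq:
  "\<lfloor>(a + pi) / (2 * pi)\<rfloor> = m \<longleftrightarrow> - pi + 2 * pi * real_of_int m \<le> a \<and> a < pi + 2 * pi * real_of_int m"
  by (auto simp: floor_eq_iff pos_le_divide_eq pos_divide_less_eq algebra_simps)

lemma lat_add: "lat (a + b) = lat a + lat b"
  by (simp add: lat_def vec_eq_iff algebra_simps)

lemma wrap_eqI: "x \<in> fcell (\<chi> i. - pi) \<Longrightarrow> wrap x = x"
proof -
  assume x: "x \<in> fcell (\<chi> i. - pi)"
  have "\<lfloor>(x $ i + pi) / (2 * pi)\<rfloor> = 0" for i
    using x by (simp add: fcell_def floor_wrap_eq)
  then show ?thesis by (simp add: wrap_def vec_eq_iff)
qed

lemma wrap_eq_lat: "\<exists>m. wrap x = x + lat m"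
  by (rule exI[of _ "\<chi> i. - \<lfloor>(x $ i + pi) / (2 * pi)\<rfloor>"]) (simp add: wrap_def lat_def vec_eq_iff)

lemma wrap_in_fcell: "wrap x \<in> fcell (\<chi> i. - pi)"
proof -
  have "- pi \<le> a - 2 * pi * real_of_int \<lfloor>(a + pi) / (2 * pi)\<rfloor> \<and> a - 2 * pi * real_of_int \<lfloor>(a + pi) / (2 * pi)\<rfloor> < pi" for a
    using floor_wrap_eq[of a "\<lfloor>(a + pi) / (2 * pi)\<rfloor>"] by auto
  then show ?thesis by (simp add: fcell_def wrap_def)
qed

lemma periodic_wrap: "periodic wrap"
  unfolding periodic_def
proof (intro allI)
  fix x :: "real^2" and i
  obtain m where m: "wrap x = x + lat m" using wrap_eq_lat by blast
  obtain m' where m': "wrap (x + axis i (2 * pi)) = x + axis i (2 * pi) + lat m'" using wrap_eq_lat by blast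
  define e :: "int^2" where "e = axis i 1"
  have e: "axis i (2 * pi) = lat e" by (simp add: e_def lat_def axis_def vec_eq_iff)
  have "x + lat (e + m') \<in> fcell (\<chi> i. - pi)"
    using wrap_in_fcell[of "x + axis i (2 * pi)"] m' by (simp add: e lat_add add.assoc)
  moreover have "x + lat m \<in> fcell (\<chi> i. - pi)" using wrap_in_fcell[of x] m by simp
  ultimately have "m = e + m'" using ex1_lat_fcell by blast
  then have "lat m = lat e + lat m'" by (simp add: lat_add)
  with m m' show "wrap (x + axis i (2 * pi)) = wrap x" unfolding e by (simp add: add.assoc)
qed

lemma wrap_measurable [measurable]: "wrap \<in> borel_measurable borel"
proof -
  have "wrap = (\<lambda>x. (x $ 1 - 2 * pi * real_of_int \<lfloor>(x $ 1 + pi) / (2 * pi)\<rfloor>) *\<^sub>R axis 1 1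
      + (x $ 2 - 2 * pi * real_of_int \<lfloor>(x $ 2 + pi) / (2 * pi)\<rfloor>) *\<^sub>R axis 2 1)"
    by (simp add: fun_eq_iff vec_eq_iff forall_2 wrap_def axis_def)
  moreover have "(\<lambda>x::real^2. (x $ 1 - 2 * pi * real_of_int \<lfloor>(x $ 1 + pi) / (2 * pi)\<rfloor>) *\<^sub>R axis 1 1
      + (x $ 2 - 2 * pi * real_of_int \<lfloor>(x $ 2 + pi) / (2 * pi)\<rfloor>) *\<^sub>R axis 2 1 :: real^2) \<in> borel_measurable borel"
    by measurable
  ultimately show ?thesis by simp
qed

text \<open>Where \<^const>\<open>wrap\<close> jumps, a function supported in a disk of radius less than \<open>\<pi>\<close> vanishes; so its
  periodic extension is locally a translate of the function.\<close>

lemma wrap_locally_translation: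
  fixes F :: "real^2 \<Rightarrow> 'a::zero"
  assumes r0: "0 < r0" "r0 < pi" and F: "\<And>y. norm y > r0 \<Longrightarrow> F y = 0"
    and y: "dist y y0 < (pi - r0) / 2"
  shows "F (wrap y) = F (y - (y0 - wrap y0))"
proof -
  define z where "z = y - (y0 - wrap y0)"
  have ci: "\<bar>v $ i\<bar> \<le> norm v" for v :: "real^2" and i using component_le_norm_cart[of v i] by simp
  have zi: "\<bar>z $ i - wrap y0 $ i\<bar> < (pi - r0) / 2" for i
    using ci[of "y - y0" i] y by (simp add: z_def dist_norm)
  have w0: "- pi \<le> wrap y0 $ i" "wrap y0 $ i < pi" for i
    using wrap_in_fcell[of y0] by (auto simp: fcell_def)
  obtain m where m: "wrap y0 = y0 + lat m" using wrap_eq_lat by blast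
  then have "z = y + lat m" by (simp add: z_def)
  then have wz: "wrap z = wrap y" by (simp add: periodic_lat[OF periodic_wrap])
  show ?thesis
  proof (cases "z \<in> fcell (\<chi> i. - pi)")
    case True
    from wrap_eqI[OF True] have "F (wrap y) = F z" unfolding wz by simp
    then show ?thesis unfolding z_def .
  next
    case False
    then obtain i where i: "z $ i < - pi \<or> pi \<le> z $ i" by (auto simp: fcell_def not_le not_less)
    have "pi \<le> \<bar>z $ i\<bar>" using i by auto
    then have Fz: "F z = 0" using ci[of z i] r0 by (intro F) linarith
    have near: "wrap y0 $ i - (pi - r0) / 2 < z $ i" "z $ i < wrap y0 $ i + (pi - r0) / 2"
      using zi[of i] unfolding abs_less_iff by linarith+
    have "\<bar>wrap z $ i\<bar> > r0"
    proof (cases "z $ i < - pi")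
      case True
      then have "\<lfloor>(z $ i + pi) / (2 * pi)\<rfloor> = - 1"
        using zi[of i] w0[of i] r0 pi_gt3 unfolding floor_wrap_eq by (auto simp: abs_less_iff)
      then have "wrap z $ i = z $ i + 2 * pi" by (simp add: wrap_def)
      then have "wrap z $ i > r0" using near w0[of i] r0 by argo
      then show ?thesis by simp
    next
      case False
      then have "\<lfloor>(z $ i + pi) / (2 * pi)\<rfloor> = 1"
        using i zi[of i] w0[of i] r0 pi_gt3 unfolding floor_wrap_eq by (auto simp: abs_less_iff)
      then have "wrap z $ i = z $ i - 2 * pi" by (simp add: wrap_def)
      then have "wrap z $ i < - r0" using near w0[of i] r0 by argo
      then show ?thesis by simp
    qed
    then have "F (wrap z) = 0" using ci[of "wrap z" i] by (intro F) linarith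
    then have "F (wrap y) = F z" unfolding wz Fz .
    then show ?thesis unfolding z_def .
  qed
qed

text \<open>The radius \<open>r0 < \<pi>\<close> keeps the pulse inside one fundamental cell.\<close>

locale pulse_profile =
  fixes \<Theta> :: "real \<Rightarrow> real" and r0 :: real
  assumes r0: "0 < r0" "r0 < pi"
    and \<Theta>_smooth: "smooth_on UNIV \<Theta>"
    and \<Theta>_left: "\<And>z. z \<le> 0 \<Longrightarrow> \<Theta> z = 0"
    and \<Theta>_right: "\<And>z. z \<ge> 1 \<Longrightarrow> \<Theta> z = 1"
begin

lemma Theta_derivative: "(\<Theta> has_real_derivative deriv \<Theta> z) (at z)"
proof -
  have "C_on (Suc 0) UNIV \<Theta>" using \<Theta>_smooth by (simp add: smooth_on_def)
  then have "\<Theta> differentiable (at z)" by simp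
  then show ?thesis using DERIV_deriv_iff_real_differentiable by blast
qed

lemma Theta_derivative2: "(deriv \<Theta> has_real_derivative deriv (deriv \<Theta>) z) (at z)"
proof -
  have "C_on (Suc (Suc 0)) UNIV \<Theta>" using \<Theta>_smooth unfolding smooth_on_def by blast
  then have "C_on (Suc 0) UNIV (\<lambda>x. frechet_derivative \<Theta> (at x) 1)"
    unfolding C_on.simps(2)[of "Suc 0"] by blast
  moreover have "frechet_derivative \<Theta> (at x) 1 = deriv \<Theta> x" for x
    using frechet_derivative_at[OF Theta_derivative[of x, unfolded has_field_derivative_def], symmetric] by simp
  ultimately have "deriv \<Theta> differentiable (at z)" by simp
  then show ?thesis using DERIV_deriv_iff_real_differentiable by blast
qed

lemma log_cutoff_eq:
  assumes "L > 0" "r > 0"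
  shows "log_cutoff \<Theta> r0 L r = \<Theta> (ln (r0 / r) / L)"
proof (cases "r < r0")
  case False
  then have "ln (r0 / r) / L \<le> 0" using assms r0 by (simp add: divide_le_0_iff ln_le_zero_iff)
  then show ?thesis using False assms \<Theta>_left by (simp add: log_cutoff_def)
qed (use assms in \<open>simp add: log_cutoff_def\<close>)

lemma log_cutoff_core:
  assumes "L > 0" "0 \<le> r" "r < r0 * exp (- L)"
  shows "log_cutoff \<Theta> r0 L r = 1"
proof (cases "r = 0")
  case False
  then have "exp L < r0 / r" using assms by (simp add: exp_minus field_simps)
  then have "L < ln (r0 / r)" using False assms r0 by (metis divide_pos_pos exp_gt_zero less_le ln_exp ln_less_cancel_iff)
  then have "ln (r0 / r) / L \<ge> 1" using assms by simp
  then show ?thesis using log_cutoff_eq[of L r] False assms \<Theta>_right by simp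
qed (simp add: log_cutoff_def)

lemma stream_nth: "stream \<Theta> r0 A L y = A * y $ 2 * log_cutoff \<Theta> r0 L (norm y)"
proof -
  have "rot dir = - axis 2 1" by (simp add: vec_eq_iff forall_2 dir_def axis_def)
  then have "rot dir \<bullet> y = - (y $ 2)" by (simp add: inner_axis')
  then show ?thesis by (simp add: stream_def)
qed

lemma stream_core:
  assumes "L > 0" "norm y < r0 * exp (- L)"
  shows "stream \<Theta> r0 A L y = A * y $ 2"
  using log_cutoff_core[OF assms(1) norm_ge_zero assms(2)] by (simp add: stream_nth)

lemma stream_outer:
  assumes "norm y > r0"
  shows "stream \<Theta> r0 A L y = 0"
  using assms r0 by (simp add: stream_def log_cutoff_def)

text \<open>Writing the logarithm of the norm through \<open>y \<bullet> y\<close> exhibits the stream function as a composition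
  of smooth functions away from the origin.\<close>

lemma stream_eq:
  assumes "L > 0" "y \<noteq> 0"
  shows "stream \<Theta> r0 A L y = A * y $ 2 * \<Theta> ((ln r0 - ln (y \<bullet> y) / 2) / L)"
proof -
  have n: "norm y > 0" using assms by simp
  have "ln (norm y) = ln (y \<bullet> y) / 2"
    unfolding norm_eq_sqrt_inner by (rule ln_sqrt) (use assms(2) in simp)
  then have "ln (r0 / norm y) = ln r0 - ln (y \<bullet> y) / 2" using n r0 by (simp add: ln_div)
  then show ?thesis using log_cutoff_eq[OF assms(1) n] by (simp only: stream_nth)
qed

end

locale pulse_coeff = pulse_profile +
  fixes \<sigma> :: real and n :: nat
  assumes \<sigma>: "\<sigma> > 0"
begin

abbreviation A where "A \<equiv> A_n \<sigma> n"
abbreviation L where "L \<equiv> L_n \<sigma> n"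
abbreviation \<delta> where "\<delta> \<equiv> delta_n n"

lemma delta_pos: "\<delta> > 0" by (simp add: delta_n_def)

lemma A_ge_1: "t > - \<delta> \<Longrightarrow> A t \<ge> 1"
  using \<sigma> by (simp add: A_n_def)

lemma L_ge_1: "t > - \<delta> \<Longrightarrow> L t \<ge> 1"
  using A_ge_1[of t] one_le_power[of "A t" 2] by (simp add: L_n_def add_increasing)

lemma A_antimono: "- \<delta> < s \<Longrightarrow> s \<le> t \<Longrightarrow> A t \<le> A s"
proof -
  assume s: "- \<delta> < s" "s \<le> t"
  have "2 / (\<sigma> * (t + \<delta>)) \<le> 2 / (\<sigma> * (s + \<delta>))"
    using s \<sigma> by (intro divide_left_mono mult_left_mono mult_pos_pos) auto
  then show ?thesis unfolding A_n_def by linarith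
qed

lemma L_antimono: "- \<delta> < s \<Longrightarrow> s \<le> t \<Longrightarrow> L t \<le> L s"
proof -
  assume s: "- \<delta> < s" "s \<le> t"
  have "(A t)\<^sup>2 \<le> (A s)\<^sup>2"
    using A_antimono[OF s] A_ge_1[of t] s by (intro power_mono) auto
  then show ?thesis unfolding L_n_def by linarith
qed

text \<open>The amplitude has its pole at \<open>t = - \<delta>\<close>, so the formulas extend the coefficient smoothly across
  \<open>t = 0\<close>.\<close>

definition halfspace :: "(real \<times> (real^2)) set" where "halfspace = {- \<delta><..} \<times> UNIV"

lemma open_halfspace: "open halfspace"
  unfolding halfspace_def by (intro open_Times) auto

lemma C_on_A: "open U \<Longrightarrow> U \<subseteq> halfspace \<Longrightarrow> C_on k U (\<lambda>p. A (fst p))"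
proof -
  assume U: "open U" "U \<subseteq> halfspace"
  have "C_on k U fst" by (rule C_on_bounded_linear[OF U(1) bounded_linear_fst])
  then have C: "C_on k U (\<lambda>p. \<sigma> * (fst p + \<delta>))" by (intro C_on_mult C_on_add C_on_const U(1))
  have "C_on k U (\<lambda>p. inverse (\<sigma> * (fst p + \<delta>)))"
    by (rule C_on_compose[OF U(1) C_on_inverse C]) (use U(2) \<sigma> in \<open>auto simp: halfspace_def\<close>)
  then have "C_on k U (\<lambda>p. 1 + 2 * inverse (\<sigma> * (fst p + \<delta>)))"
    by (intro C_on_add C_on_mult C_on_const U(1))
  then show ?thesis unfolding A_n_def divide_inverse .
qed

lemma C_on_L: "open U \<Longrightarrow> U \<subseteq> halfspace \<Longrightarrow> C_on k U (\<lambda>p. L (fst p))"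
  unfolding L_n_def power2_eq_square
  by (rule C_on_add[OF _ C_on_const C_on_mult[OF _ C_on_A C_on_A]])

definition psi :: "real \<times> (real^2) \<Rightarrow> real" where
  "psi p = stream \<Theta> r0 (A (fst p)) (L (fst p)) (snd p)"

lemma C_on_snd_nth: "open U \<Longrightarrow> C_on k U (\<lambda>p::real \<times> (real^2). snd p $ i)"
  by (rule C_on_bounded_linear[OF _ bounded_linear_compose[OF bounded_linear_vec_nth bounded_linear_snd]])

text \<open>Away from the origin the stream function is a smooth expression in time and space. Near the origin
  the cut-off equals \<open>1\<close> in a disk whose radius \<open>r0 e\<^sup>-\<^sup>L\<^sup>(\<^sup>t\<^sup>)\<close> increases with time; so it is bounded below
  on a neighbourhood of each point of the time axis, and there the stream function is linear in space.\<close>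

lemma C_on_psi: "C_on k halfspace psi"
proof (rule C_on_local)
  fix p :: "real \<times> (real^2)" assume p: "p \<in> halfspace"
  obtain t y where p_eq: "p = (t, y)" by fastforce
  then have t: "t > - \<delta>" using p by (simp add: halfspace_def)
  show "\<exists>V. open V \<and> p \<in> V \<and> C_on k V psi"
  proof (cases "y = 0")
    case True
    define t1 where "t1 = (t - \<delta>) / 2"
    have t1: "- \<delta> < t1" "t1 < t" using t by (auto simp: t1_def)
    define V where "V = {t1<..} \<times> ball (0::real^2) (r0 * exp (- L t1))"
    have V: "open V" "p \<in> V" "V \<subseteq> halfspace"
      using t1 True r0 by (auto simp: V_def p_eq halfspace_def intro!: open_Times)
    have "C_on k V psi"
    proof (rule C_on_cong[OF V(1)])
      show "C_on k V (\<lambda>p. A (fst p) * snd p $ 2)"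
        by (intro C_on_mult C_on_A C_on_snd_nth V)
      fix q assume q: "q \<in> V"
      then have "L (fst q) \<le> L t1" using t1 by (intro L_antimono) (auto simp: V_def)
      then have "r0 * exp (- L t1) \<le> r0 * exp (- L (fst q))" using r0 by simp
      then show "A (fst q) * snd q $ 2 = psi q"
        unfolding psi_def using q L_ge_1[of "fst q"] t1
        by (intro stream_core[symmetric]) (auto simp: V_def)
    qed
    with V show ?thesis by blast
  next
    case False
    define V :: "(real \<times> (real^2)) set" where "V = {- \<delta><..} \<times> - {0}"
    have V: "open V" "p \<in> V" "V \<subseteq> halfspace"
      using t False by (auto simp: V_def p_eq halfspace_def intro!: open_Times)
    have C_Theta: "C_on k UNIV \<Theta>" using \<Theta>_smooth by (simp add: smooth_on_def)
    have C_snd: "C_on k V snd" by (intro C_on_bounded_linear V bounded_linear_snd)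
    have C_inv: "C_on k V (\<lambda>p. inverse (L (fst p)))"
      by (rule C_on_compose[OF V(1) C_on_inverse C_on_L[OF V(1,3)]])
         (use L_ge_1 in \<open>force simp: V_def\<close>)
    have C_ln: "C_on k V (\<lambda>p. ln (snd p \<bullet> snd p))"
      by (rule C_on_compose[OF V(1) C_on_ln C_on_bilinear[OF V(1) bounded_bilinear_inner C_snd C_snd]])
         (auto simp: V_def)
    have "C_on k V psi"
    proof (rule C_on_cong[OF V(1)])
      show "C_on k V (\<lambda>p. A (fst p) * snd p $ 2 * \<Theta> ((ln r0 + (- 1 / 2) * ln (snd p \<bullet> snd p)) * inverse (L (fst p))))"
        by (intro C_on_mult C_on_A C_on_snd_nth V C_on_compose[OF V(1) C_Theta] C_on_add C_on_const C_ln C_inv) auto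
      fix q assume q: "q \<in> V"
      then have Lq: "L (fst q) > 0" "snd q \<noteq> 0" using L_ge_1[of "fst q"] by (auto simp: V_def)
      have "(ln r0 + (- 1 / 2) * X) * inverse l = (ln r0 - X / 2) / l" for X l :: real
        by (cases "l = 0") (simp_all add: field_simps)
      then show "A (fst q) * snd q $ 2 * \<Theta> ((ln r0 + (- 1 / 2) * ln (snd q \<bullet> snd q)) * inverse (L (fst q))) = psi q"
        unfolding psi_def stream_eq[OF Lq] by simp
    qed
    with V show ?thesis by blast
  qed
qed

text \<open>The pulse before its periodic extension and its motion.\<close>

definition field :: "real \<Rightarrow> real^2 \<Rightarrow> real^2" where
  "field t y = rot (grad (stream \<Theta> r0 (A t) (L t)) y)"

lemma stream_has_derivative:
  assumes "t > - \<delta>"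
  shows "(stream \<Theta> r0 (A t) (L t) has_derivative (\<lambda>w. frechet_derivative psi (at (t, y)) (0, w))) (at y)"
proof -
  have "(psi has_derivative frechet_derivative psi (at (t, y))) (at (t, y))"
    by (rule C_on_Suc_D[OF C_on_psi[of "Suc 0"]]) (use assms in \<open>simp add: halfspace_def\<close>)
  moreover have "((\<lambda>y. (t, y)) has_derivative (\<lambda>w. (0, w))) (at y)"
    by (rule has_derivative_Pair) (rule has_derivative_const has_derivative_ident)+
  ultimately have "((\<lambda>y. psi (t, y)) has_derivative (\<lambda>w. frechet_derivative psi (at (t, y)) (0, w))) (at y)"
    by (rule has_derivative_compose[rotated])
  then show ?thesis by (simp add: psi_def)
qed

lemma partial_stream:
  "t > - \<delta> \<Longrightarrow> partial i (stream \<Theta> r0 (A t) (L t)) y = frechet_derivative psi (at (t, y)) (0, axis i 1)"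
  unfolding partial_def frechet_derivative_at[OF stream_has_derivative, symmetric] ..

lemma field_eq:
  "field t y = partial 2 (stream \<Theta> r0 (A t) (L t)) y *\<^sub>R axis 1 1 + (- 1 * partial 1 (stream \<Theta> r0 (A t) (L t)) y) *\<^sub>R axis 2 1"
  by (simp add: field_def grad_def vec_eq_iff forall_2 axis_def)

lemma C_on_field: "C_on k halfspace (\<lambda>p. field (fst p) (snd p))"
proof (rule C_on_cong[OF open_halfspace])
  have C: "C_on k halfspace (\<lambda>p. frechet_derivative psi (at p) v)" for v
    using C_on_psi[of "Suc k"] unfolding C_on.simps(2)[of k] by blast
  show "C_on k halfspace (\<lambda>p. frechet_derivative psi (at p) (0, axis 2 1) *\<^sub>R axis 1 1
      + (- 1 * frechet_derivative psi (at p) (0, axis 1 1)) *\<^sub>R axis 2 1)"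
    by (intro C_on_add C_on_scaleR C_on_mult C_on_const C open_halfspace)
  fix p assume "p \<in> halfspace"
  then have "fst p > - \<delta>" by (auto simp: halfspace_def)
  then show "frechet_derivative psi (at p) (0, axis 2 1) *\<^sub>R axis 1 1
      + (- 1 * frechet_derivative psi (at p) (0, axis 1 1)) *\<^sub>R axis 2 1 = field (fst p) (snd p)"
    by (simp add: field_eq partial_stream)
qed

lemma field_outer: "norm y > r0 \<Longrightarrow> field t y = 0"
proof -
  assume y: "norm y > r0"
  have "open {x :: real^2. norm x > r0}" by (intro open_Collect_less continuous_intros)
  then have "partial i (stream \<Theta> r0 (A t) (L t)) y = partial i (\<lambda>x. 0) y" for i
    by (rule partial_cong) (use y stream_outer in auto)
  then show ?thesis by (simp add: field_eq partial_def frechet_derivative_const)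
qed

lemma field_core:
  assumes "t > - \<delta>" "norm y < r0 * exp (- L t)"
  shows "field t y = A t *\<^sub>R dir"
proof -
  have d: "((\<lambda>x :: real^2. A t * x $ 2) has_derivative (\<lambda>x. A t * x $ 2)) (at y)"
    by (intro bounded_linear_imp_has_derivative bounded_linear_mult_right[THEN bounded_linear_compose] bounded_linear_vec_nth)
  have "partial i (stream \<Theta> r0 (A t) (L t)) y = partial i (\<lambda>x. A t * x $ 2) y" for i
    by (rule partial_cong[of "ball 0 (r0 * exp (- L t))"])
       (use assms L_ge_1[of t] stream_core[of "L t"] in auto)
  then show ?thesis
    by (simp add: field_eq partial_def frechet_derivative_at[OF d, symmetric] axis_def dir_def vec_eq_iff)
qed

lemma u_n_eq: "u_n \<Theta> r0 \<sigma> x0 n t x = field t (wrap (x - (x0 + t *\<^sub>R dir)))"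
  by (simp add: u_n_def pulse_def field_def)

text \<open>Near each point the coefficient is a translate of \<^const>\<open>field\<close> by a fixed lattice vector.\<close>

lemma u_n_locally:
  assumes "dist (x - (x0 + t *\<^sub>R dir)) y0 < (pi - r0) / 2"
  shows "u_n \<Theta> r0 \<sigma> x0 n t x = field t (x - (x0 + t *\<^sub>R dir) - (y0 - wrap y0))"
  unfolding u_n_eq by (rule wrap_locally_translation[OF r0 _ assms]) (rule field_outer)

lemma C_on_u_n: "C_on k halfspace (\<lambda>p. u_n \<Theta> r0 \<sigma> x0 n (fst p) (snd p))"
proof (rule C_on_local)
  fix p :: "real \<times> (real^2)" assume p: "p \<in> halfspace"
  define y :: "real \<times> (real^2) \<Rightarrow> real^2" where "y q = snd q - (x0 + fst q *\<^sub>R dir)" for q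
  define c where "c = y p - wrap (y p)"
  define V where "V = halfspace \<inter> y -` ball (y p) ((pi - r0) / 2)"
  have "continuous_on UNIV y" unfolding y_def by (intro continuous_intros)
  then have V: "open V" "p \<in> V" "V \<subseteq> halfspace"
    using p r0 open_halfspace by (auto simp: V_def intro!: open_Int open_vimage)
  have C: "C_on k V (\<lambda>q. (fst q, y q - c))"
  proof (rule C_on_cong[OF V(1)])
    have bl: "bounded_linear (\<lambda>q :: real \<times> (real^2). (fst q, snd q + (- 1) *\<^sub>R fst q *\<^sub>R dir))"
      by (intro bounded_linear_Pair bounded_linear_add bounded_linear_fst bounded_linear_snd
          bounded_linear_scaleR_right[THEN bounded_linear_compose] bounded_linear_scaleR_left[THEN bounded_linear_compose])
    show "C_on k V (\<lambda>q. (fst q, snd q + (- 1) *\<^sub>R fst q *\<^sub>R dir) + (0, - x0 - c))"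
      by (intro C_on_add[OF V(1)] C_on_bounded_linear[OF V(1) bl] C_on_const V)
  qed (simp add: y_def algebra_simps)
  have "C_on k V (\<lambda>q. u_n \<Theta> r0 \<sigma> x0 n (fst q) (snd q))"
  proof (rule C_on_cong[OF V(1)])
    show "C_on k V (\<lambda>q. (\<lambda>p. field (fst p) (snd p)) (fst q, y q - c))"
      by (rule C_on_compose[OF V(1) C_on_field C]) (use V(3) in \<open>auto simp: halfspace_def\<close>)
    fix q assume "q \<in> V"
    then have "dist (snd q - (x0 + fst q *\<^sub>R dir)) (y p) < (pi - r0) / 2"
      by (auto simp: V_def y_def dist_commute)
    from u_n_locally[OF this] show "(\<lambda>p. field (fst p) (snd p)) (fst q, y q - c) = u_n \<Theta> r0 \<sigma> x0 n (fst q) (snd q)"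
      by (simp add: y_def c_def)
  qed
  with V show "\<exists>V. open V \<and> p \<in> V \<and> C_on k V (\<lambda>p. u_n \<Theta> r0 \<sigma> x0 n (fst p) (snd p))" by blast
qed

lemma periodic_u_n: "periodic (u_n \<Theta> r0 \<sigma> x0 n t)"
proof -
  have "wrap (x + axis i (2 * pi) - (x0 + t *\<^sub>R dir)) = wrap (x - (x0 + t *\<^sub>R dir))" for x i
    unfolding diff_conv_add_uminus by (rule periodic_add[OF periodic_wrap])
  then show ?thesis by (simp add: periodic_def u_n_eq)
qed

lemma smooth_coeff_u_n: "smooth_coeff T (u_n \<Theta> r0 \<sigma> x0 n)"
proof -
  have "smooth_on halfspace (\<lambda>p. u_n \<Theta> r0 \<sigma> x0 n (fst p) (snd p))"
    using C_on_u_n by (simp add: smooth_on_def)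
  then show ?thesis
    unfolding smooth_coeff_def using periodic_u_n open_halfspace delta_pos
    by (intro conjI ballI exI[of _ halfspace] exI[of _ "\<lambda>p. u_n \<Theta> r0 \<sigma> x0 n (fst p) (snd p)"])
       (auto simp: halfspace_def)
qed

lemma continuous_on_u_n: "continuous_on ({0..T} \<times> UNIV) (\<lambda>(t, x). u_n \<Theta> r0 \<sigma> x0 n t x)"
proof -
  have "continuous_on halfspace (\<lambda>p. u_n \<Theta> r0 \<sigma> x0 n (fst p) (snd p))"
    using C_on_u_n[of 0] by simp
  then show ?thesis
    unfolding split_beta by (rule continuous_on_subset) (use delta_pos in \<open>auto simp: halfspace_def\<close>)
qed

end

section \<open>The coefficients tend to zero\<close>

lemma ex_dyadic_shell:
  fixes r0 \<rho> e :: real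
  assumes "0 < \<rho>" "\<rho> \<le> r0" "r0 / 2 ^ N \<le> \<rho>"
  shows "\<exists>k\<le>N. \<rho> \<le> r0 / 2 ^ k \<and> r0 / 2 ^ Suc k < \<rho>"
proof -
  define k where "k = (LEAST k. r0 / 2 ^ Suc k < \<rho>)"
  have "r0 > 0" using assms by linarith
  then have "r0 / 2 ^ Suc N < r0 / 2 ^ N" by (simp add: divide_strict_left_mono)
  then have N: "r0 / 2 ^ Suc N < \<rho>" using assms by linarith
  have k: "r0 / 2 ^ Suc k < \<rho>" unfolding k_def by (rule LeastI[of "\<lambda>k. r0 / 2 ^ Suc k < \<rho>", OF N])
  have kN: "k \<le> N" unfolding k_def by (rule Least_le[of "\<lambda>k. r0 / 2 ^ Suc k < \<rho>", OF N])
  have "\<rho> \<le> r0 / 2 ^ k"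
  proof (cases k)
    case (Suc m)
    then have "\<not> r0 / 2 ^ Suc m < \<rho>" using not_less_Least[of m "\<lambda>k. r0 / 2 ^ Suc k < \<rho>"] k_def by simp
    then show ?thesis using Suc by simp
  qed (use assms in simp)
  with k kN show ?thesis by blast
qed

text \<open>The indicator function of a disk on the torus.\<close>

definition disk :: "real^2 \<Rightarrow> real \<Rightarrow> real^2 \<Rightarrow> real" where
  "disk c s x = (if norm (wrap (x - c)) \<le> s then 1 else 0)"

lemma disk_measurable [measurable]: "disk c s \<in> borel_measurable borel"
  unfolding disk_def[abs_def] by measurable

lemma disk_integrable: "set_integrable lborel cell (disk c s)"
proof (rule set_integrable_bound[OF set_integrable_cell_const[of 1]])
  show "set_borel_measurable lborel cell (disk c s)" unfolding set_borel_measurable_def by measurable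
qed (auto simp: disk_def)

text \<open>After moving the centre to the origin of the cell \<open>[-\<pi>, \<pi>)\<^sup>2\<close>, the disk lies in a square of side
  \<open>2 s\<close>.\<close>

lemma integral_disk_le:
  assumes s: "s \<ge> 0"
  shows "(LINT x:cell|lborel. disk c s x) \<le> 4 * s\<^sup>2"
proof -
  have p: "periodic (disk 0 s)" using periodic_wrap by (simp add: periodic_def disk_def)
  have "(LINT x:cell|lborel. disk c s x) = (LINT x:cell|lborel. disk 0 s (x + - c))"
    by (simp add: disk_def)
  also have "\<dots> = (LINT x:cell|lborel. disk 0 s x)"
    by (rule integral_cell_shift_nonneg[OF _ p]) (auto simp: disk_def)
  also have "\<dots> = enn2real (\<integral>\<^sup>+x. ennreal (disk 0 s x) * indicator cell x \<partial>lborel)"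
    unfolding set_lebesgue_integral_def
    by (subst integral_eq_nn_integral) (auto simp: disk_def indicator_def intro!: arg_cong[where f=enn2real] nn_integral_cong)
  finally have eq: "(LINT x:cell|lborel. disk c s x)
      = enn2real (\<integral>\<^sup>+x. ennreal (disk 0 s x) * indicator cell x \<partial>lborel)" .
  have "(\<integral>\<^sup>+x. ennreal (disk 0 s x) * indicator cell x \<partial>lborel)
      = (\<integral>\<^sup>+x. ennreal (disk 0 s x) * indicator (fcell (\<chi> i. - pi)) x \<partial>lborel)"
    by (rule nn_integral_cell_fcell) (use p in \<open>auto simp: periodic_def\<close>)
  also have "\<dots> \<le> (\<integral>\<^sup>+x. indicator (cbox (\<chi> i. - s) (\<chi> i. s) :: (real^2) set) x \<partial>lborel)"
  proof (intro nn_integral_mono)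
    fix x :: "real^2"
    have "x \<in> cbox (\<chi> i. - s) (\<chi> i. s)" if "norm x \<le> s"
    proof -
      have "\<bar>x $ i\<bar> \<le> s" for i using component_le_norm_cart[of x i] that by simp
      then show ?thesis by (auto simp: mem_box_cart abs_le_iff minus_le_iff)
    qed
    then show "ennreal (disk 0 s x) * indicator (fcell (\<chi> i. - pi)) x \<le> indicator (cbox (\<chi> i. - s) (\<chi> i. s)) x"
      by (auto simp: disk_def indicator_def wrap_eqI)
  qed
  also have "\<dots> = ennreal (4 * s\<^sup>2)"
  proof -
    have "emeasure lborel (cbox (\<chi> i. - s) (\<chi> i. s) :: (real^2) set) = ennreal (\<Prod>i\<in>(UNIV :: 2 set). s - - s)"
      using s by (subst emeasure_lborel_cbox_eq)
        (auto simp: Basis_vec_def inner_axis prod.UNION_disjoint axis_eq_axis UNIV_2)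
    then show ?thesis by (simp add: UNIV_2 power2_eq_square)
  qed
  finally show ?thesis unfolding eq by (rule enn2real_leI[rotated]) simp
qed

context pulse_coeff
begin

lemma field_differentiable:
  assumes t: "t > - \<delta>"
  shows "field t differentiable (at y)"
proof -
  have "((\<lambda>p. field (fst p) (snd p)) has_derivative frechet_derivative (\<lambda>p. field (fst p) (snd p)) (at (t, y))) (at (t, y))"
    by (rule C_on_Suc_D[OF C_on_field[of "Suc 0"]]) (use t in \<open>simp add: halfspace_def\<close>)
  moreover have "((\<lambda>y. (t, y)) has_derivative (\<lambda>w. (0, w))) (at y)"
    by (rule has_derivative_Pair) (rule has_derivative_const has_derivative_ident)+
  ultimately have "((\<lambda>y. (\<lambda>p. field (fst p) (snd p)) (t, y)) has_derivative
      (\<lambda>w. frechet_derivative (\<lambda>p. field (fst p) (snd p)) (at (t, y)) (0, w))) (at y)"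
    by (rule has_derivative_compose[rotated])
  then show ?thesis by (auto simp: differentiable_def)
qed

text \<open>The integrand of the squared \<open>H\<^sup>1\<close> norm of the pulse.\<close>

definition energy :: "real \<Rightarrow> real^2 \<Rightarrow> real" where
  "energy t y = (norm (field t y))\<^sup>2 + (\<Sum>i\<in>UNIV. (norm (partial i (field t) y))\<^sup>2)"

lemma energy_outer: "norm y > r0 \<Longrightarrow> energy t y = 0"
proof -
  assume y: "norm y > r0"
  have "open {x :: real^2. norm x > r0}" by (intro open_Collect_less continuous_intros)
  then have "partial i (field t) y = partial i (\<lambda>x. 0) y" for i
    by (rule partial_cong) (use y field_outer in auto)
  then have "partial i (field t) y = 0" for i
    by (simp add: partial_def frechet_derivative_const)
  then show ?thesis using field_outer[OF y] by (simp add: energy_def)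
qed

lemma energy_core:
  assumes t: "t > - \<delta>" and y: "norm y < r0 * exp (- L t)"
  shows "energy t y = (A t)\<^sup>2"
proof -
  have "partial i (field t) y = partial i (\<lambda>x. A t *\<^sub>R dir) y" for i
    by (rule partial_cong[of "ball 0 (r0 * exp (- L t))"]) (use y field_core[OF t] in auto)
  then have "partial i (field t) y = 0" for i
    by (simp add: partial_def frechet_derivative_const)
  moreover have "norm (A t *\<^sub>R dir) = A t" using A_ge_1[OF t] by (simp add: dir_def)
  ultimately show ?thesis using field_core[OF t y] by (simp add: energy_def)
qed

context
  fixes t :: real
  assumes t: "t > - \<delta>"
begin

text \<open>The argument of \<open>\<Theta>\<close> in the logarithmic cut-off, as a function of the coordinates.\<close>

definition zeta :: "real \<Rightarrow> real \<Rightarrow> real" where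
  "zeta a b = (ln r0 - ln (a\<^sup>2 + b\<^sup>2) / 2) / L t"

lemma Lt: "L t \<ge> 1" by (rule L_ge_1[OF t])
lemma At: "A t \<ge> 1" by (rule A_ge_1[OF t])

lemma zeta_derivative:
  assumes "a\<^sup>2 + b\<^sup>2 > 0"
  shows "((\<lambda>a. zeta a b) has_real_derivative - a / (L t * (a\<^sup>2 + b\<^sup>2))) (at a)"
    "((\<lambda>b. zeta a b) has_real_derivative - b / (L t * (a\<^sup>2 + b\<^sup>2))) (at b)"
  unfolding zeta_def using assms Lt
  by (auto intro!: derivative_eq_intros simp: divide_simps)

lemma Theta_zeta_derivative:
  assumes "a\<^sup>2 + b\<^sup>2 > 0"
  shows "((\<lambda>a. \<Theta> (zeta a b)) has_real_derivative deriv \<Theta> (zeta a b) * (- a / (L t * (a\<^sup>2 + b\<^sup>2)))) (at a)"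
    "((\<lambda>b. \<Theta> (zeta a b)) has_real_derivative deriv \<Theta> (zeta a b) * (- b / (L t * (a\<^sup>2 + b\<^sup>2)))) (at b)"
    "((\<lambda>a. deriv \<Theta> (zeta a b)) has_real_derivative deriv (deriv \<Theta>) (zeta a b) * (- a / (L t * (a\<^sup>2 + b\<^sup>2)))) (at a)"
    "((\<lambda>b. deriv \<Theta> (zeta a b)) has_real_derivative deriv (deriv \<Theta>) (zeta a b) * (- b / (L t * (a\<^sup>2 + b\<^sup>2)))) (at b)"
  using DERIV_chain2[OF Theta_derivative zeta_derivative(1)[OF assms]] DERIV_chain2[OF Theta_derivative zeta_derivative(2)[OF assms]]
    DERIV_chain2[OF Theta_derivative2 zeta_derivative(1)[OF assms]] DERIV_chain2[OF Theta_derivative2 zeta_derivative(2)[OF assms]]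
  by auto

text \<open>The partial derivatives of the stream function off the origin.\<close>

definition "psi1 a b = - A t * deriv \<Theta> (zeta a b) * (b * a / (L t * (a\<^sup>2 + b\<^sup>2)))"
definition "psi2 a b = A t * \<Theta> (zeta a b) - A t * deriv \<Theta> (zeta a b) * (b\<^sup>2 / (L t * (a\<^sup>2 + b\<^sup>2)))"

lemma stream_formula: "y \<noteq> 0 \<Longrightarrow> stream \<Theta> r0 (A t) (L t) y = A t * y $ 2 * \<Theta> (zeta (y $ 1) (y $ 2))"
  using stream_eq[of "L t" y "A t"] Lt norm_sq[of y] by (simp add: zeta_def power2_norm_eq_inner)

lemma field_formula:
  assumes y: "y \<noteq> 0"
  shows "field t y $ 1 = psi2 (y $ 1) (y $ 2)" "field t y $ 2 = - psi1 (y $ 1) (y $ 2)"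
proof -
  have d: "stream \<Theta> r0 (A t) (L t) differentiable (at y)"
    using stream_has_derivative[OF t] by (auto simp: differentiable_def)
  note pc = partial_of_components[OF d y stream_formula]
  note s = sum_sq_pos[OF y]
  have "partial 1 (stream \<Theta> r0 (A t) (L t)) y = psi1 (y $ 1) (y $ 2)"
    by (rule pc(1), assumption, rule DERIV_cong[OF DERIV_cmult[OF Theta_zeta_derivative(1)[OF s]]])
       (simp add: psi1_def)
  moreover have "partial 2 (stream \<Theta> r0 (A t) (L t)) y = psi2 (y $ 1) (y $ 2)"
    by (rule pc(2), assumption, rule DERIV_cong[OF DERIV_mult[OF DERIV_cmult_Id Theta_zeta_derivative(2)[OF s]]])
       (simp add: psi2_def power2_eq_square)
  ultimately show "field t y $ 1 = psi2 (y $ 1) (y $ 2)" "field t y $ 2 = - psi1 (y $ 1) (y $ 2)"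
    by (simp_all add: field_eq axis_def)
qed

text \<open>In polar form with direction \<open>(\<alpha>, \<beta>)\<close> every second derivative of the stream function is
  \<open>A/(L \<rho>)\<close> times a bounded trigonometric polynomial.\<close>

lemma psi_derivatives:
  assumes y: "a = \<rho> * \<alpha>" "b = \<rho> * \<beta>" "\<alpha>\<^sup>2 + \<beta>\<^sup>2 = 1" "\<rho> > 0"
  defines "p \<equiv> deriv \<Theta> (zeta a b)" and "q \<equiv> deriv (deriv \<Theta>) (zeta a b)" and "m \<equiv> A t / (L t * \<rho>)"
  shows "((\<lambda>a. psi1 a b) has_real_derivative m * (q * (\<beta> * \<alpha>\<^sup>2) / L t - p * \<beta> + 2 * p * (\<beta> * \<alpha>\<^sup>2))) (at a)"
    "((\<lambda>b. psi1 a b) has_real_derivative m * (q * (\<alpha> * \<beta>\<^sup>2) / L t - p * \<alpha> + 2 * p * (\<alpha> * \<beta>\<^sup>2))) (at b)"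
    "((\<lambda>a. psi2 a b) has_real_derivative m * (q * (\<alpha> * \<beta>\<^sup>2) / L t - p * \<alpha> + 2 * p * (\<alpha> * \<beta>\<^sup>2))) (at a)"
    "((\<lambda>b. psi2 a b) has_real_derivative m * (q * (\<beta> * \<beta>\<^sup>2) / L t - 3 * p * \<beta> + 2 * p * (\<beta> * \<beta>\<^sup>2))) (at b)"
proof -
  have s: "a\<^sup>2 + b\<^sup>2 = \<rho>\<^sup>2"
    using y(3) unfolding y(1,2) power_mult_distrib by (simp flip: distrib_left)
  then have s0: "a\<^sup>2 + b\<^sup>2 > 0" using y(4) by simp
  note T = Theta_zeta_derivative[OF s0]
  have L0: "L t \<noteq> 0" using Lt by linarith
  note nz = y(4) L0 s0
  have Q: "((\<lambda>a. b * a / (L t * (a\<^sup>2 + b\<^sup>2))) has_real_derivative b / (L t * \<rho>\<^sup>2) - b * a * (2 * a) / (L t * \<rho>^4)) (at a)"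
    "((\<lambda>b. b * a / (L t * (a\<^sup>2 + b\<^sup>2))) has_real_derivative a / (L t * \<rho>\<^sup>2) - b * a * (2 * b) / (L t * \<rho>^4)) (at b)"
    "((\<lambda>a. b\<^sup>2 / (L t * (a\<^sup>2 + b\<^sup>2))) has_real_derivative - (b\<^sup>2 * (2 * a) / (L t * \<rho>^4))) (at a)"
    "((\<lambda>b. b\<^sup>2 / (L t * (a\<^sup>2 + b\<^sup>2))) has_real_derivative 2 * b / (L t * \<rho>\<^sup>2) - b\<^sup>2 * (2 * b) / (L t * \<rho>^4)) (at b)"
  proof -
    have den: "((\<lambda>a. L t * (a\<^sup>2 + b\<^sup>2)) has_real_derivative L t * (2 * a)) (at a)"
      "((\<lambda>b. L t * (a\<^sup>2 + b\<^sup>2)) has_real_derivative L t * (2 * b)) (at b)"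
      by (auto intro!: derivative_eq_intros)
    have den0: "L t * (a\<^sup>2 + b\<^sup>2) \<noteq> 0" unfolding s using y(4) L0 by simp
    have sqr: "((\<lambda>b. b\<^sup>2) has_real_derivative 2 * b) (at b)"
      by (auto intro!: derivative_eq_intros)
    note simps = field_simps power2_eq_square power4_eq_xxxx
    show "((\<lambda>a. b * a / (L t * (a\<^sup>2 + b\<^sup>2))) has_real_derivative b / (L t * \<rho>\<^sup>2) - b * a * (2 * a) / (L t * \<rho>^4)) (at a)"
      by (rule DERIV_cong[OF DERIV_divide[OF DERIV_cmult_Id den(1) den0]]) (unfold s, use y(4) L0 in \<open>simp add: simps\<close>)
    show "((\<lambda>b. b * a / (L t * (a\<^sup>2 + b\<^sup>2))) has_real_derivative a / (L t * \<rho>\<^sup>2) - b * a * (2 * b) / (L t * \<rho>^4)) (at b)"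
      by (rule DERIV_cong[OF DERIV_divide[OF DERIV_cmult_right[OF DERIV_ident] den(2) den0]]) (unfold s, use y(4) L0 in \<open>simp add: simps\<close>)
    show "((\<lambda>a. b\<^sup>2 / (L t * (a\<^sup>2 + b\<^sup>2))) has_real_derivative - (b\<^sup>2 * (2 * a) / (L t * \<rho>^4))) (at a)"
      by (rule DERIV_cong[OF DERIV_divide[OF DERIV_const den(1) den0]]) (unfold s, use y(4) L0 in \<open>simp add: simps\<close>)
    show "((\<lambda>b. b\<^sup>2 / (L t * (a\<^sup>2 + b\<^sup>2))) has_real_derivative 2 * b / (L t * \<rho>\<^sup>2) - b\<^sup>2 * (2 * b) / (L t * \<rho>^4)) (at b)"
      by (rule DERIV_cong[OF DERIV_divide[OF sqr den(2) den0]]) (unfold s, use y(4) L0 in \<open>simp add: simps\<close>)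
  qed
  show "((\<lambda>a. psi1 a b) has_real_derivative m * (q * (\<beta> * \<alpha>\<^sup>2) / L t - p * \<beta> + 2 * p * (\<beta> * \<alpha>\<^sup>2))) (at a)"
    unfolding psi1_def
    by (rule DERIV_cong[OF DERIV_mult[OF DERIV_cmult[OF T(3)] Q(1)]])
       (unfold s, fold p_def q_def, unfold y(1,2) m_def,
         use y(4) L0 in \<open>simp add: field_simps power2_eq_square power4_eq_xxxx\<close>)
  show "((\<lambda>b. psi1 a b) has_real_derivative m * (q * (\<alpha> * \<beta>\<^sup>2) / L t - p * \<alpha> + 2 * p * (\<alpha> * \<beta>\<^sup>2))) (at b)"
    unfolding psi1_def
    by (rule DERIV_cong[OF DERIV_mult[OF DERIV_cmult[OF T(4)] Q(2)]])
       (unfold s, fold p_def q_def, unfold y(1,2) m_def,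
         use y(4) L0 in \<open>simp add: field_simps power2_eq_square power4_eq_xxxx\<close>)
  show "((\<lambda>a. psi2 a b) has_real_derivative m * (q * (\<alpha> * \<beta>\<^sup>2) / L t - p * \<alpha> + 2 * p * (\<alpha> * \<beta>\<^sup>2))) (at a)"
    unfolding psi2_def
    by (rule DERIV_cong[OF DERIV_diff[OF DERIV_cmult[OF T(1)] DERIV_mult[OF DERIV_cmult[OF T(3)] Q(3)]]])
       (unfold s, fold p_def q_def, unfold y(1,2) m_def,
         use y(4) L0 in \<open>simp add: field_simps power2_eq_square power4_eq_xxxx\<close>)
  show "((\<lambda>b. psi2 a b) has_real_derivative m * (q * (\<beta> * \<beta>\<^sup>2) / L t - 3 * p * \<beta> + 2 * p * (\<beta> * \<beta>\<^sup>2))) (at b)"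
    unfolding psi2_def
    by (rule DERIV_cong[OF DERIV_diff[OF DERIV_cmult[OF T(2)] DERIV_mult[OF DERIV_cmult[OF T(4)] Q(4)]]])
       (unfold s, fold p_def q_def, unfold y(1,2) m_def,
         use y(4) L0 in \<open>simp add: field_simps power2_eq_square power4_eq_xxxx\<close>)
qed

text \<open>With \<open>m = A / (L \<rho>)\<close>, the derivatives of the field are bounded by \<open>4 m C\<close>, one of them by \<open>6 m C\<close>.
  The field itself has no factor \<open>1 / \<rho>\<close>, but \<open>\<Theta> (zeta) \<le> C ln (r0 / \<rho>) / L \<le> C r0 / (L \<rho>)\<close> and
  \<open>\<rho> \<le> r0 \<le> 4\<close> bound its components by \<open>4 m C\<close> and \<open>8 m C\<close>. The squares add up to
  \<open>3 \<cdot> 16 + 36 + 16 + 64 = 164\<close>.\<close>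

lemma energy_annulus:
  assumes range: "\<And>z. \<Theta> z \<in> {0..1}"
    and C_deriv: "\<And>z. \<bar>deriv \<Theta> z\<bar> + \<bar>deriv (deriv \<Theta>) z\<bar> \<le> C"
    and linear: "\<And>z. 0 \<le> z \<Longrightarrow> z \<le> 1 \<Longrightarrow> \<Theta> z \<le> C * z"
    and y: "r0 * exp (- L t) \<le> norm y" "norm y \<le> r0"
  shows "energy t y \<le> 164 * (A t * C / (L t * norm y))\<^sup>2"
proof -
  define \<rho> where "\<rho> = norm y"
  have \<rho>: "\<rho> > 0" using y(1) r0 unfolding \<rho>_def by (meson exp_gt_zero less_le_trans mult_pos_pos)
  then have y0: "y \<noteq> 0" by (auto simp: \<rho>_def)
  define \<alpha> \<beta> where "\<alpha> = y $ 1 / \<rho>" and "\<beta> = y $ 2 / \<rho>"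
  have ab: "y $ 1 = \<rho> * \<alpha>" "y $ 2 = \<rho> * \<beta>" using \<rho> by (auto simp: \<alpha>_def \<beta>_def)
  have ab1: "\<alpha>\<^sup>2 + \<beta>\<^sup>2 = 1"
  proof -
    have "\<alpha>\<^sup>2 + \<beta>\<^sup>2 = ((y $ 1)\<^sup>2 + (y $ 2)\<^sup>2) / \<rho>\<^sup>2"
      by (simp add: \<alpha>_def \<beta>_def power_divide add_divide_distrib)
    also have "\<dots> = 1" unfolding norm_sq[symmetric] \<rho>_def[symmetric] using \<rho> by simp
    finally show ?thesis .
  qed
  have ab2: "\<bar>\<alpha>\<bar> \<le> 1" "\<bar>\<beta>\<bar> \<le> 1"
  proof -
    have "\<alpha>\<^sup>2 \<le> 1" "\<beta>\<^sup>2 \<le> 1" using ab1 zero_le_power2[of \<alpha>] zero_le_power2[of \<beta>] by linarith+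
    then show "\<bar>\<alpha>\<bar> \<le> 1" "\<bar>\<beta>\<bar> \<le> 1" by (simp_all add: abs_square_le_1)
  qed
  let ?a = "y $ 1" let ?b = "y $ 2"
  define p q where "p = deriv \<Theta> (zeta ?a ?b)" and "q = deriv (deriv \<Theta>) (zeta ?a ?b)"
  have pq: "\<bar>p\<bar> \<le> C" "\<bar>q\<bar> \<le> C"
    using C_deriv[of "zeta ?a ?b"] unfolding p_def q_def by linarith+
  then have C0: "C \<ge> 0" by linarith
  have L0: "L t > 0" using Lt by linarith
  have A0: "A t > 0" using At by linarith
  define m where "m = A t / (L t * \<rho>)"
  have m0: "m > 0" using L0 A0 \<rho> by (simp add: m_def)
  have r04: "r0 \<le> 4" using r0 pi_less_4 by linarith
  have \<rho>r: "\<rho> \<le> r0" using y(2) by (simp add: \<rho>_def)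
  note D = psi_derivatives[OF ab ab1 \<rho>, folded p_def q_def m_def]
  have f1: "(\<lambda>x. field t x $ 1) differentiable (at y)" "(\<lambda>x. field t x $ 2) differentiable (at y)"
    by (rule partial_nth(1)[OF field_differentiable[OF t]])+
  have "partial 1 (field t) y $ 1 = m * (q * (\<alpha> * \<beta>\<^sup>2) / L t - p * \<alpha> + 2 * p * (\<alpha> * \<beta>\<^sup>2))"
    "partial 2 (field t) y $ 1 = m * (q * (\<beta> * \<beta>\<^sup>2) / L t - 3 * p * \<beta> + 2 * p * (\<beta> * \<beta>\<^sup>2))"
    "partial 1 (field t) y $ 2 = - (m * (q * (\<beta> * \<alpha>\<^sup>2) / L t - p * \<beta> + 2 * p * (\<beta> * \<alpha>\<^sup>2)))"
    "partial 2 (field t) y $ 2 = - (m * (q * (\<alpha> * \<beta>\<^sup>2) / L t - p * \<alpha> + 2 * p * (\<alpha> * \<beta>\<^sup>2)))"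
    unfolding partial_nth(2)[OF field_differentiable[OF t]]
    by (rule partial_of_components(1)[OF f1(1) y0 field_formula(1)]
          partial_of_components(2)[OF f1(1) y0 field_formula(1)]
          partial_of_components(1)[OF f1(2) y0 field_formula(2)]
          partial_of_components(2)[OF f1(2) y0 field_formula(2)];
        (assumption | rule D(3) D(4) DERIV_minus[OF D(1)] DERIV_minus[OF D(2)]))+
  note P = this
  have three: "\<bar>u * (v * w\<^sup>2)\<bar> \<le> C" if "\<bar>u\<bar> \<le> C" "\<bar>v\<bar> \<le> 1" "\<bar>w\<bar> \<le> 1" for u v w :: real
  proof -
    have "\<bar>v\<bar> * \<bar>w\<bar>\<^sup>2 \<le> 1 * 1" using that by (intro mult_mono) (auto simp: abs_square_le_1)
    then have "\<bar>u\<bar> * (\<bar>v\<bar> * \<bar>w\<bar>\<^sup>2) \<le> C * 1" using that C0 by (intro mult_mono) auto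
    then show ?thesis by (simp add: abs_mult)
  qed
  have two: "\<bar>u * v\<bar> \<le> C" if "\<bar>u\<bar> \<le> C" "\<bar>v\<bar> \<le> 1" for u v :: real
    using mult_mono[OF that] C0 by (simp add: abs_mult)
  have divL: "\<bar>x / L t\<bar> \<le> C" if "\<bar>x\<bar> \<le> C" for x
  proof -
    have "\<bar>x\<bar> / L t \<le> C / 1" using that Lt C0 by (intro frac_le) auto
    then show ?thesis using L0 by (simp add: abs_divide)
  qed
  have comb: "\<bar>X - Y + 2 * Z\<bar> \<le> 4 * C" "\<bar>X - 3 * Y + 2 * Z\<bar> \<le> 6 * C"
    if "\<bar>X\<bar> \<le> C" "\<bar>Y\<bar> \<le> C" "\<bar>Z\<bar> \<le> C" for X Y Z
    using that by linarith+
  have e1: "\<bar>q * (v * w\<^sup>2) / L t - p * u + 2 * p * (v * w\<^sup>2)\<bar> \<le> 4 * C"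
    if "\<bar>u\<bar> \<le> 1" "\<bar>v\<bar> \<le> 1" "\<bar>w\<bar> \<le> 1" for u v w
    using comb(1)[OF divL[OF three[OF pq(2) that(2,3)]] two[OF pq(1) that(1)] three[OF pq(1) that(2,3)]]
    by (simp only: mult.assoc)
  have e2: "\<bar>q * (v * w\<^sup>2) / L t - 3 * p * u + 2 * p * (v * w\<^sup>2)\<bar> \<le> 6 * C"
    if "\<bar>u\<bar> \<le> 1" "\<bar>v\<bar> \<le> 1" "\<bar>w\<bar> \<le> 1" for u v w
    using comb(2)[OF divL[OF three[OF pq(2) that(2,3)]] two[OF pq(1) that(1)] three[OF pq(1) that(2,3)]]
    by (simp only: mult.assoc)
  have sq: "(m * x)\<^sup>2 \<le> c\<^sup>2 * (m * C)\<^sup>2" if "\<bar>x\<bar> \<le> c * C" for x c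
  proof -
    have "\<bar>x\<bar>\<^sup>2 \<le> (c * C)\<^sup>2" using that by (intro power_mono) auto
    then have "m\<^sup>2 * x\<^sup>2 \<le> m\<^sup>2 * (c * C)\<^sup>2" by (intro mult_left_mono) auto
    then show ?thesis by (simp add: power_mult_distrib mult_ac)
  qed
  have part: "(norm (partial 1 (field t) y))\<^sup>2 \<le> 32 * (m * C)\<^sup>2" "(norm (partial 2 (field t) y))\<^sup>2 \<le> 52 * (m * C)\<^sup>2"
    unfolding norm_sq P power2_minus
    using sq[OF e1[OF ab2(1) ab2(1) ab2(2)]] sq[OF e2[OF ab2(2) ab2(2) ab2(2)]] sq[OF e1[OF ab2(2) ab2(2) ab2(1)]]
    by simp_all
  have "zeta ?a ?b = ln (r0 / \<rho>) / L t"
  proof -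
    have "ln ((y $ 1)\<^sup>2 + (y $ 2)\<^sup>2) = 2 * ln \<rho>"
      unfolding norm_sq[symmetric] \<rho>_def[symmetric] using \<rho> by (simp add: ln_realpow)
    then show ?thesis using \<rho> r0 by (simp add: zeta_def ln_div)
  qed
  moreover have "0 \<le> ln (r0 / \<rho>)" "ln (r0 / \<rho>) \<le> L t"
  proof -
    show "0 \<le> ln (r0 / \<rho>)" using \<rho> \<rho>r by (intro ln_ge_zero) simp
    have "r0 / \<rho> \<le> exp (L t)"
      using y(1) \<rho> by (simp add: \<rho>_def[symmetric] exp_minus field_simps)
    then show "ln (r0 / \<rho>) \<le> L t" using \<rho> r0 by (metis divide_pos_pos exp_gt_zero ln_exp ln_le_cancel_iff)
  qed
  ultimately have z: "0 \<le> zeta ?a ?b" "zeta ?a ?b \<le> 1" "zeta ?a ?b \<le> (r0 / \<rho>) / L t"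
    using L0 divide_right_mono[OF ln_bound[of "r0 / \<rho>"], of "L t"] \<rho> r0
    by (simp_all only: divide_nonneg_pos divide_le_eq_1_pos divide_pos_pos less_imp_le)
  have T: "\<Theta> (zeta ?a ?b) \<le> C * ((r0 / \<rho>) / L t)"
    using linear[OF z(1,2)] mult_left_mono[OF z(3) C0] by linarith
  have ps1: "psi1 ?a ?b = - (m * \<rho> * (p * (\<alpha> * \<beta>)))"
    and ps2: "psi2 ?a ?b = A t * \<Theta> (zeta ?a ?b) - m * \<rho> * (p * (1 * \<beta>\<^sup>2))"
  proof -
    have s: "?a\<^sup>2 + ?b\<^sup>2 = \<rho>\<^sup>2" using norm_sq[of y] by (simp add: \<rho>_def)
    have "?b * ?a / (L t * \<rho>\<^sup>2) = \<alpha> * \<beta> / L t" "?b\<^sup>2 / (L t * \<rho>\<^sup>2) = \<beta>\<^sup>2 / L t"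
      unfolding ab using \<rho> L0 by (simp_all add: field_simps power2_eq_square)
    then show "psi1 ?a ?b = - (m * \<rho> * (p * (\<alpha> * \<beta>)))"
      "psi2 ?a ?b = A t * \<Theta> (zeta ?a ?b) - m * \<rho> * (p * (1 * \<beta>\<^sup>2))"
      unfolding psi1_def psi2_def s m_def p_def[symmetric] using \<rho> by (simp_all add: mult_ac)
  qed
  have b1: "\<bar>\<rho> * (p * (\<alpha> * \<beta>))\<bar> \<le> 4 * C"
  proof -
    have "\<bar>\<alpha> * \<beta>\<bar> \<le> 1 * 1" unfolding abs_mult using ab2 by (intro mult_mono) auto
    then have "\<rho> * \<bar>p * (\<alpha> * \<beta>)\<bar> \<le> 4 * C" using two[OF pq(1)] \<rho> \<rho>r r04 by (intro mult_mono) auto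
    then show ?thesis using \<rho> by (simp add: abs_mult)
  qed
  have b2: "\<bar>\<rho> * (p * (1 * \<beta>\<^sup>2))\<bar> \<le> 4 * C"
  proof -
    have "\<rho> * \<bar>p * (1 * \<beta>\<^sup>2)\<bar> \<le> 4 * C"
      using three[OF pq(1), of 1 \<beta>] ab2 \<rho> \<rho>r r04 by (intro mult_mono) auto
    then show ?thesis using \<rho> by (simp add: abs_mult)
  qed
  have "(psi1 ?a ?b)\<^sup>2 \<le> 4\<^sup>2 * (m * C)\<^sup>2"
    using sq[OF b1] unfolding ps1 by (simp add: mult.assoc)
  moreover have "(psi2 ?a ?b)\<^sup>2 \<le> 8\<^sup>2 * (m * C)\<^sup>2"
  proof -
    have "A t * \<Theta> (zeta ?a ?b) \<le> A t * (C * ((r0 / \<rho>) / L t))"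
      using T A0 by (intro mult_left_mono) auto
    also have "\<dots> = m * (C * r0)" by (simp add: m_def)
    also have "\<dots> \<le> m * (4 * C)" using r04 C0 m0 by (intro mult_left_mono) (auto simp: mult.commute mult_left_mono)
    finally have "\<bar>A t * \<Theta> (zeta ?a ?b)\<bar> \<le> m * (4 * C)"
      using A0 range[of "zeta ?a ?b"] by (simp add: abs_mult)
    moreover have "\<bar>m * (\<rho> * (p * (1 * \<beta>\<^sup>2)))\<bar> \<le> m * (4 * C)"
      unfolding abs_mult[of m] using b2 m0 by simp
    ultimately have "\<bar>psi2 ?a ?b\<bar> \<le> 8 * (m * C)"
      unfolding ps2 by (simp add: mult.assoc abs_le_iff)
    then have "\<bar>psi2 ?a ?b\<bar>\<^sup>2 \<le> (8 * (m * C))\<^sup>2" by (intro power_mono) auto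
    then show ?thesis by (simp add: power_mult_distrib)
  qed
  ultimately have "(norm (field t y))\<^sup>2 \<le> 80 * (m * C)\<^sup>2"
    unfolding norm_sq field_formula[OF y0] by simp
  with part have "energy t y \<le> 164 * (m * C)\<^sup>2" unfolding energy_def sum_2 by linarith
  then show ?thesis by (simp add: m_def \<rho>_def)
qed

end

end

context pulse_coeff
begin

text \<open>The weight \<open>1 / \<rho>\<^sup>2\<close> is bounded by a sum of step functions over dyadic disks; at each point of the
  annulus one summand suffices, the one with \<open>r0 / 2\<^sup>k\<^sup>+\<^sup>1 < \<rho> \<le> r0 / 2\<^sup>k\<close>. Since \<open>e \<le> 4\<close>, the first
  \<open>2 \<lceil>L\<rceil> + 1\<close> disks reach down to the core. This avoids polar coordinates.\<close>

lemma energy_le_disks: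
  assumes t: "t > - \<delta>" and range: "\<And>z. \<Theta> z \<in> {0..1}"
    and C_deriv: "\<And>z. \<bar>deriv \<Theta> z\<bar> + \<bar>deriv (deriv \<Theta>) z\<bar> \<le> C"
    and linear: "\<And>z. 0 \<le> z \<Longrightarrow> z \<le> 1 \<Longrightarrow> \<Theta> z \<le> C * z"
  shows "energy t y \<le> 164 * (A t * C / L t)\<^sup>2 *
      (\<Sum>k\<le>2 * nat \<lceil>L t\<rceil>. (2 * 2 ^ k / r0)\<^sup>2 * (if norm y \<le> r0 / 2 ^ k then 1 else 0))
    + (A t)\<^sup>2 * (if norm y \<le> r0 * exp (- L t) then 1 else 0)"
    (is "_ \<le> ?K * (\<Sum>k\<le>?N. ?s k) + ?c")
proof -
  have s0: "?s k \<ge> 0" for k by simp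
  have pos: "?K * (\<Sum>k\<le>?N. ?s k) \<ge> 0" by (intro mult_nonneg_nonneg sum_nonneg s0) auto
  have c0: "?c \<ge> 0" by simp
  have L1: "L t \<ge> 1" by (rule L_ge_1[OF t])
  consider "norm y > r0" | "norm y < r0 * exp (- L t)" | "r0 * exp (- L t) \<le> norm y" "norm y \<le> r0"
    by linarith
  then show ?thesis
  proof cases
    case 1
    then show ?thesis using energy_outer[OF 1, of t] pos c0 by linarith
  next
    case 2
    then show ?thesis using energy_core[OF t 2] pos by simp
  next
    case 3
    have y0: "norm y > 0" using 3(1) r0 by (meson exp_gt_zero less_le_trans mult_pos_pos)
    have "exp (L t) \<le> 2 ^ ?N"
    proof -
      have "exp (L t) \<le> exp (real (nat \<lceil>L t\<rceil>))" using L1 by (simp add: of_nat_ceiling)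
      also have "\<dots> = exp 1 ^ nat \<lceil>L t\<rceil>" by (simp add: exp_of_nat_mult[symmetric])
      also have "\<dots> \<le> 4 ^ nat \<lceil>L t\<rceil>" using exp_le by (intro power_mono) auto
      also have "\<dots> = 2 ^ ?N" by (simp add: power_mult)
      finally show ?thesis .
    qed
    then have "r0 / 2 ^ ?N \<le> r0 / exp (L t)" using r0 by (intro divide_left_mono) auto
    then have "r0 / 2 ^ ?N \<le> norm y" using 3(1) by (simp add: exp_minus divide_inverse)
    from ex_dyadic_shell[OF y0 3(2) this] obtain k
      where k: "k \<le> ?N" "norm y \<le> r0 / 2 ^ k" "r0 / 2 ^ Suc k < norm y" by blast
    have "1 / norm y \<le> 2 * 2 ^ k / r0"
      using k(3) y0 r0 by (simp add: field_simps)
    then have "(1 / norm y)\<^sup>2 \<le> ?s k" using k(2) y0 by (simp only: if_True mult_1_right) (intro power_mono, auto)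
    also have "?s k \<le> (\<Sum>k\<le>?N. ?s k)" by (rule member_le_sum) (use k(1) s0 in auto)
    finally have sum: "(1 / norm y)\<^sup>2 \<le> (\<Sum>k\<le>?N. ?s k)" .
    have "164 * (A t * C / (L t * norm y))\<^sup>2 = ?K * (1 / norm y)\<^sup>2"
      by (simp add: power_divide power_mult_distrib)
    also have "\<dots> \<le> ?K * (\<Sum>k\<le>?N. ?s k)" by (rule mult_left_mono[OF sum]) simp
    finally show ?thesis using energy_annulus[OF t range C_deriv linear 3] c0 by linarith
  qed
qed

text \<open>Every dyadic disk contributes at most \<open>16\<close>, whatever its radius, and there are at most \<open>5 L\<close> of
  them; \<open>164 \<cdot> 16 \<cdot> 5 = 13120\<close>. The core is exponentially small and costs much less than \<open>A\<^sup>2 / L\<close>.\<close>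

lemma integral_energy_le:
  assumes t: "t > - \<delta>" and range: "\<And>z. \<Theta> z \<in> {0..1}"
    and C_deriv: "\<And>z. \<bar>deriv \<Theta> z\<bar> + \<bar>deriv (deriv \<Theta>) z\<bar> \<le> C"
    and linear: "\<And>z. 0 \<le> z \<Longrightarrow> z \<le> 1 \<Longrightarrow> \<Theta> z \<le> C * z"
  shows "(LINT x:cell|lborel. energy t (wrap (x - c))) \<le> (13120 * C\<^sup>2 + 64) * ((A t)\<^sup>2 / L t)"
proof -
  let ?N = "2 * nat \<lceil>L t\<rceil>" and ?K = "164 * (A t * C / L t)\<^sup>2"
  let ?D = "\<lambda>x. ?K * (\<Sum>k\<le>?N. (2 * 2 ^ k / r0)\<^sup>2 * disk c (r0 / 2 ^ k) x) + (A t)\<^sup>2 * disk c (r0 * exp (- L t)) x"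
  have L1: "L t \<ge> 1" by (rule L_ge_1[OF t])
  have iC: "set_integrable lborel cell (\<lambda>x. a * disk c s x)" for a s
    by (intro set_integrable_mult_right disk_integrable)
  have iS: "set_integrable lborel cell (\<lambda>x. \<Sum>k\<le>?N. (2 * 2 ^ k / r0)\<^sup>2 * disk c (r0 / 2 ^ k) x)"
    unfolding set_integrable_def scaleR_sum_right
    by (intro Bochner_Integration.integrable_sum iC[unfolded set_integrable_def])
  have iD: "set_integrable lborel cell ?D"
    by (intro set_integral_add(1)) (use iS disk_integrable in auto)
  have le: "energy t (wrap (x - c)) \<le> ?D x" for x
    using energy_le_disks[OF assms, of "wrap (x - c)"] by (simp add: disk_def)
  have "energy t y \<ge> 0" for y
    unfolding energy_def by (intro add_nonneg_nonneg sum_nonneg) auto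
  then have "0 \<le> ?D x" for x using le[of x] order_trans by blast
  then have "(LINT x:cell|lborel. energy t (wrap (x - c))) \<le> (LINT x:cell|lborel. ?D x)"
    unfolding set_lebesgue_integral_def using iD le
    by (intro integral_mono') (auto simp: set_integrable_def indicator_def)
  also have "\<dots> = ?K * (\<Sum>k\<le>?N. (2 * 2 ^ k / r0)\<^sup>2 * (LINT x:cell|lborel. disk c (r0 / 2 ^ k) x))
      + (A t)\<^sup>2 * (LINT x:cell|lborel. disk c (r0 * exp (- L t)) x)"
  proof -
    have "(LINT x:cell|lborel. (\<Sum>k\<le>?N. (2 * 2 ^ k / r0)\<^sup>2 * disk c (r0 / 2 ^ k) x))
        = (\<Sum>k\<le>?N. (LINT x:cell|lborel. (2 * 2 ^ k / r0)\<^sup>2 * disk c (r0 / 2 ^ k) x))"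
      unfolding set_lebesgue_integral_def scaleR_sum_right
      by (rule Bochner_Integration.integral_sum) (rule iC[unfolded set_integrable_def])
    also have "\<dots> = (\<Sum>k\<le>?N. (2 * 2 ^ k / r0)\<^sup>2 * (LINT x:cell|lborel. disk c (r0 / 2 ^ k) x))"
      by (simp only: set_integral_mult_right)
    finally have S: "(LINT x:cell|lborel. (\<Sum>k\<le>?N. (2 * 2 ^ k / r0)\<^sup>2 * disk c (r0 / 2 ^ k) x))
        = (\<Sum>k\<le>?N. (2 * 2 ^ k / r0)\<^sup>2 * (LINT x:cell|lborel. disk c (r0 / 2 ^ k) x))" .
    show ?thesis
      by (subst set_integral_add(2)) (use iS iC in \<open>simp_all only: set_integral_mult_right S set_integrable_mult_right\<close>)
  qed
  also have "\<dots> \<le> ?K * (\<Sum>k\<le>?N. 16) + (A t)\<^sup>2 * (64 / L t)"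
  proof (intro add_mono mult_left_mono sum_mono)
    fix k
    have "(LINT x:cell|lborel. disk c (r0 / 2 ^ k) x) \<le> 4 * (r0 / 2 ^ k)\<^sup>2"
      using r0 by (intro integral_disk_le) simp
    then have "(2 * 2 ^ k / r0)\<^sup>2 * (LINT x:cell|lborel. disk c (r0 / 2 ^ k) x) \<le> (2 * 2 ^ k / r0)\<^sup>2 * (4 * (r0 / 2 ^ k)\<^sup>2)"
      by (rule mult_left_mono) simp
    also have "\<dots> = 16" using r0 by (simp add: field_simps power2_eq_square)
    finally show "(2 * 2 ^ k / r0)\<^sup>2 * (LINT x:cell|lborel. disk c (r0 / 2 ^ k) x) \<le> 16" .
  next
    have "(LINT x:cell|lborel. disk c (r0 * exp (- L t)) x) \<le> 4 * (r0 * exp (- L t))\<^sup>2"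
      using r0 by (intro integral_disk_le) simp
    also have "\<dots> \<le> 64 * (1 / L t)"
    proof -
      have "r0\<^sup>2 \<le> 4\<^sup>2" using r0 pi_less_4 by (intro power_mono) auto
      moreover have "(exp (- L t))\<^sup>2 \<le> 1 / L t"
      proof -
        have "exp (- L t) * exp (- L t) \<le> 1 * exp (- L t)" using L1 by (intro mult_right_mono) auto
        also have "\<dots> \<le> 1 / L t"
        proof -
          have "L t \<le> exp (L t)" using exp_ge_add_one_self[of "L t"] by linarith
          then have "1 / exp (L t) \<le> 1 / L t" using L1 by (intro frac_le) auto
          then show ?thesis by (simp add: exp_minus inverse_eq_divide)
        qed
        finally show ?thesis by (simp add: power2_eq_square)
      qed
      ultimately have "r0\<^sup>2 * (exp (- L t))\<^sup>2 \<le> 4\<^sup>2 * (1 / L t)" by (intro mult_mono) auto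
      then show ?thesis by (simp add: power_mult_distrib)
    qed
    finally show "(LINT x:cell|lborel. disk c (r0 * exp (- L t)) x) \<le> 64 / L t" by simp
  qed auto
  also have "\<dots> \<le> (13120 * C\<^sup>2 + 64) * ((A t)\<^sup>2 / L t)"
  proof -
    have "real (nat \<lceil>L t\<rceil>) \<le> L t + 1" using L1 by linarith
    moreover have "real ?N = 2 * real (nat \<lceil>L t\<rceil>)" by simp
    ultimately have N5: "real ?N + 1 \<le> 5 * L t" using L1 by linarith
    have "?K * (\<Sum>k\<le>?N. 16) = (164 * 16 * C\<^sup>2 * (A t)\<^sup>2 / (L t)\<^sup>2) * (real ?N + 1)"
      by (simp add: power_divide power_mult_distrib)
    also have "\<dots> \<le> (164 * 16 * C\<^sup>2 * (A t)\<^sup>2 / (L t)\<^sup>2) * (5 * L t)"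
      by (rule mult_left_mono[OF N5]) simp
    also have "\<dots> = 13120 * C\<^sup>2 * ((A t)\<^sup>2 / L t)"
      using L1 by (simp add: power2_eq_square)
    finally have "?K * (\<Sum>k\<le>?N. 16) \<le> 13120 * C\<^sup>2 * ((A t)\<^sup>2 / L t)" .
    moreover have "(A t)\<^sup>2 * (64 / L t) = 64 * ((A t)\<^sup>2 / L t)" by simp
    ultimately show ?thesis unfolding distrib_right by linarith
  qed
  finally show ?thesis .
qed

text \<open>Locally the coefficient is a translate of the field, and partial derivatives commute with
  translations.\<close>

lemma slice_energy:
  assumes t: "t > - \<delta>"
  shows "(norm (u_n \<Theta> r0 \<sigma> x0 n t x))\<^sup>2 + (\<Sum>i\<in>UNIV. (norm (partial i (u_n \<Theta> r0 \<sigma> x0 n t) x))\<^sup>2)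
    = energy t (wrap (x - (x0 + t *\<^sub>R dir)))"
proof -
  define y0 where "y0 = x - (x0 + t *\<^sub>R dir)"
  define d where "d = x0 + t *\<^sub>R dir + (y0 - wrap y0)"
  have xd: "x - d = wrap y0" by (simp add: d_def y0_def)
  have "partial i (u_n \<Theta> r0 \<sigma> x0 n t) x = partial i (field t) (wrap y0)" for i
  proof -
    have "partial i (u_n \<Theta> r0 \<sigma> x0 n t) x = partial i (\<lambda>z. field t (z - d)) x"
    proof (rule partial_cong[of "ball x ((pi - r0) / 2)"])
      fix z assume "z \<in> ball x ((pi - r0) / 2)"
      then have "dist (z - (x0 + t *\<^sub>R dir)) y0 < (pi - r0) / 2"
        by (simp add: y0_def dist_norm norm_minus_commute)
      from u_n_locally[OF this] show "u_n \<Theta> r0 \<sigma> x0 n t z = field t (z - d)"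
        by (simp add: d_def algebra_simps)
    qed (use r0 in auto)
    also have "\<dots> = partial i (field t) (x - d)"
    proof -
      have "(field t has_derivative frechet_derivative (field t) (at (x - d))) (at (x - d))"
        using field_differentiable[OF assms] frechet_derivative_works by blast
      moreover have "((\<lambda>z. z - d) has_derivative (\<lambda>z. z)) (at x)"
        by (auto intro!: derivative_eq_intros)
      ultimately have "((\<lambda>z. field t (z - d)) has_derivative frechet_derivative (field t) (at (x - d))) (at x)"
        by (rule has_derivative_compose[rotated])
      from frechet_derivative_at[OF this] show ?thesis by (simp add: partial_def)
    qed
    finally show ?thesis unfolding xd .
  qed
  then show ?thesis by (simp add: energy_def u_n_eq y0_def)
qed

end

text \<open>The summand \<open>A\<^sup>2\<close> in \<open>L\<close> bounds the quotient by \<open>1\<close> uniformly in \<open>n\<close>, also near \<open>t = 0\<close>, where the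
  amplitudes are large. For fixed \<open>t > 0\<close> the amplitudes stay below \<open>1 + 2 / (\<sigma> t)\<close>, and the summand
  \<open>n\<close> makes the quotient tend to zero.\<close>

lemma integral_amplitude_tendsto:
  assumes \<sigma>: "\<sigma> > 0"
  shows "set_integrable lborel {0..T} (\<lambda>t. (A_n \<sigma> n t)\<^sup>2 / L_n \<sigma> n t)"
    and "(\<lambda>n. LINT t:{0..T}|lborel. (A_n \<sigma> n t)\<^sup>2 / L_n \<sigma> n t) \<longlonglongrightarrow> 0"
proof -
  have m [measurable]: "(\<lambda>t. (A_n \<sigma> n t)\<^sup>2 / L_n \<sigma> n t) \<in> borel_measurable borel" for n
    unfolding L_n_def A_n_def by measurable
  have b: "0 \<le> (A_n \<sigma> n t)\<^sup>2 / L_n \<sigma> n t" "(A_n \<sigma> n t)\<^sup>2 / L_n \<sigma> n t \<le> 1" for n t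
  proof -
    have Ln: "(A_n \<sigma> n t)\<^sup>2 \<le> L_n \<sigma> n t" by (simp add: L_n_def)
    then have L0: "0 \<le> L_n \<sigma> n t" using zero_le_power2 order_trans by blast
    then show "0 \<le> (A_n \<sigma> n t)\<^sup>2 / L_n \<sigma> n t" by simp
    show "(A_n \<sigma> n t)\<^sup>2 / L_n \<sigma> n t \<le> 1"
      using Ln L0 by (cases "L_n \<sigma> n t = 0") (simp_all add: divide_le_eq_1)
  qed
  have one: "set_integrable lborel {0..T} (\<lambda>t. 1 :: real)"
    unfolding set_integrable_def by (intro integrable_scaleR_left integrable_real_indicator)
      (simp_all add: emeasure_lborel_Icc_eq)
  show "set_integrable lborel {0..T} (\<lambda>t. (A_n \<sigma> n t)\<^sup>2 / L_n \<sigma> n t)" for n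
  proof (rule set_integrable_bound[OF one])
    show "set_borel_measurable lborel {0..T} (\<lambda>t. (A_n \<sigma> n t)\<^sup>2 / L_n \<sigma> n t)"
      unfolding set_borel_measurable_def by measurable
    have "norm ((A_n \<sigma> n t)\<^sup>2 / L_n \<sigma> n t) \<le> norm (1 :: real)" for t
      using b[of n t] by (simp only: real_norm_def abs_of_nonneg abs_one)
    then show "AE t in lborel. t \<in> {0..T} \<longrightarrow> norm ((A_n \<sigma> n t)\<^sup>2 / L_n \<sigma> n t) \<le> norm (1 :: real)"
      by (intro AE_I2) blast
  qed
  have lim: "(\<lambda>n. (A_n \<sigma> n t)\<^sup>2 / L_n \<sigma> n t) \<longlonglongrightarrow> 0" if t: "t > 0" for t
  proof (rule Lim_null_comparison)
    show "\<forall>\<^sub>F n in sequentially. norm ((A_n \<sigma> n t)\<^sup>2 / L_n \<sigma> n t) \<le> (1 + 2 / (\<sigma> * t))\<^sup>2 * (1 / real n)"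
    proof (intro eventually_sequentiallyI[of 1])
      fix n :: nat assume n: "1 \<le> n"
      have d: "delta_n n > 0" by (simp add: delta_n_def)
      have "2 / (\<sigma> * (t + delta_n n)) \<le> 2 / (\<sigma> * t)"
        using t \<sigma> d by (intro divide_left_mono mult_left_mono mult_pos_pos) auto
      moreover have "0 \<le> A_n \<sigma> n t" using t \<sigma> d by (simp add: A_n_def)
      ultimately have "(A_n \<sigma> n t)\<^sup>2 \<le> (1 + 2 / (\<sigma> * t))\<^sup>2"
        by (intro power_mono) (auto simp: A_n_def)
      then have "(A_n \<sigma> n t)\<^sup>2 / L_n \<sigma> n t \<le> (1 + 2 / (\<sigma> * t))\<^sup>2 / real n"
        using n by (intro frac_le) (auto simp: L_n_def)
      then show "norm ((A_n \<sigma> n t)\<^sup>2 / L_n \<sigma> n t) \<le> (1 + 2 / (\<sigma> * t))\<^sup>2 * (1 / real n)"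
        using b(1)[of n t] by simp
    qed
    show "(\<lambda>n. (1 + 2 / (\<sigma> * t))\<^sup>2 * (1 / real n)) \<longlonglongrightarrow> 0"
      using tendsto_mult_right[OF lim_1_over_n, of "(1 + 2 / (\<sigma> * t))\<^sup>2"] by simp
  qed
  have "(\<lambda>n. LINT t|lborel. indicat_real {0..T} t *\<^sub>R ((A_n \<sigma> n t)\<^sup>2 / L_n \<sigma> n t))
      \<longlonglongrightarrow> integral\<^sup>L lborel (\<lambda>t::real. 0::real)"
  proof (rule integral_dominated_convergence[where w="\<lambda>t. indicat_real {0..T} t *\<^sub>R 1"])
    show "integrable lborel (\<lambda>t. indicat_real {0..T} t *\<^sub>R (1 :: real))"
      using one by (simp add: set_integrable_def)
    have "AE t in lborel. t \<noteq> (0 :: real)" by (rule AE_lborel_singleton)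
    then show "AE t in lborel. (\<lambda>n. indicat_real {0..T} t *\<^sub>R ((A_n \<sigma> n t)\<^sup>2 / L_n \<sigma> n t)) \<longlonglongrightarrow> 0"
    proof eventually_elim
      fix t :: real assume "t \<noteq> 0"
      show "(\<lambda>n. indicat_real {0..T} t *\<^sub>R ((A_n \<sigma> n t)\<^sup>2 / L_n \<sigma> n t)) \<longlonglongrightarrow> 0"
        using lim[of t] \<open>t \<noteq> 0\<close> by (cases "t \<in> {0..T}") auto
    qed
    fix n
    show "(\<lambda>t. indicat_real {0..T} t *\<^sub>R ((A_n \<sigma> n t)\<^sup>2 / L_n \<sigma> n t)) \<in> borel_measurable lborel"
      by measurable
    have "norm (indicat_real {0..T} t *\<^sub>R ((A_n \<sigma> n t)\<^sup>2 / L_n \<sigma> n t)) \<le> indicat_real {0..T} t *\<^sub>R 1" for t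
    proof (cases "t \<in> {0..T}")
      case True
      have "norm ((A_n \<sigma> n t)\<^sup>2 / L_n \<sigma> n t) \<le> 1"
        using b[of n t] by (simp only: real_norm_def abs_of_nonneg)
      then show ?thesis using True by simp
    qed simp
    then show "AE t in lborel. norm (indicat_real {0..T} t *\<^sub>R ((A_n \<sigma> n t)\<^sup>2 / L_n \<sigma> n t)) \<le> indicat_real {0..T} t *\<^sub>R 1"
      by (intro AE_I2)
  qed simp
  then show "(\<lambda>n. LINT t:{0..T}|lborel. (A_n \<sigma> n t)\<^sup>2 / L_n \<sigma> n t) \<longlonglongrightarrow> 0"
    by (simp add: set_lebesgue_integral_def)
qed

context pulse_profile
begin

lemma L2H1_norm_u_n_tendsto:
  assumes \<sigma>: "\<sigma> > 0" and range: "\<And>z. \<Theta> z \<in> {0..1}"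
    and C_deriv: "\<And>z. \<bar>deriv \<Theta> z\<bar> + \<bar>deriv (deriv \<Theta>) z\<bar> \<le> C"
    and linear: "\<And>z. 0 \<le> z \<Longrightarrow> z \<le> 1 \<Longrightarrow> \<Theta> z \<le> C * z"
  shows "(\<lambda>n. L2H1_norm T (u_n \<Theta> r0 \<sigma> x0 n)) \<longlonglongrightarrow> 0"
proof -
  let ?K = "13120 * C\<^sup>2 + 64"
  define I where "I n = (LINT t:{0..T}|lborel. LINT x:cell|lborel.
     (norm (u_n \<Theta> r0 \<sigma> x0 n t x))\<^sup>2 + (\<Sum>i\<in>UNIV. (norm (partial i (u_n \<Theta> r0 \<sigma> x0 n t) x))\<^sup>2))" for n
  define J where "J n = (LINT t:{0..T}|lborel. (A_n \<sigma> n t)\<^sup>2 / L_n \<sigma> n t)" for n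
  have I0: "I n \<ge> 0" for n
    unfolding I_def set_lebesgue_integral_def
    by (intro Bochner_Integration.integral_nonneg scaleR_nonneg_nonneg add_nonneg_nonneg sum_nonneg) auto
  have IJ: "I n \<le> ?K * J n" for n
  proof -
    interpret pulse_coeff \<Theta> r0 \<sigma> n by unfold_locales (rule \<sigma>)
    have t: "t > - delta_n n" if "t \<in> {0..T}" for t using that delta_pos by auto
    have K: "set_integrable lborel {0..T} (\<lambda>t. ?K * ((A_n \<sigma> n t)\<^sup>2 / L_n \<sigma> n t))"
      by (intro set_integrable_mult_right integral_amplitude_tendsto(1)[OF \<sigma>])
    have slice: "(LINT x:cell|lborel. (norm (u_n \<Theta> r0 \<sigma> x0 n t x))\<^sup>2 + (\<Sum>i\<in>UNIV. (norm (partial i (u_n \<Theta> r0 \<sigma> x0 n t) x))\<^sup>2))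
        \<le> ?K * ((A_n \<sigma> n t)\<^sup>2 / L_n \<sigma> n t)" if "t \<in> {0..T}" for t
      unfolding slice_energy[OF t[OF that]]
      by (rule integral_energy_le[OF t[OF that] range C_deriv linear])
    have nn: "0 \<le> ?K * ((A_n \<sigma> n t)\<^sup>2 / L_n \<sigma> n t)" for t
      by (intro mult_nonneg_nonneg divide_nonneg_nonneg) (auto simp: L_n_def intro: add_nonneg_nonneg)
    have "I n \<le> (LINT t:{0..T}|lborel. ?K * ((A_n \<sigma> n t)\<^sup>2 / L_n \<sigma> n t))"
      unfolding I_def set_lebesgue_integral_def[of lborel "{0..T}"]
      by (rule integral_mono') (use K slice nn in \<open>auto simp: set_integrable_def indicator_def\<close>)
    then show ?thesis unfolding J_def by (simp only: set_integral_mult_right)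
  qed
  have "J \<longlonglongrightarrow> 0" unfolding J_def[abs_def] by (rule integral_amplitude_tendsto(2)[OF \<sigma>])
  then have "(\<lambda>n. ?K * J n) \<longlonglongrightarrow> 0" using tendsto_mult_right_zero by blast
  from tendsto_sandwich[OF _ _ tendsto_const this, of I] have "I \<longlonglongrightarrow> 0"
    using I0 IJ by (simp add: always_eventually)
  then have "(\<lambda>n. sqrt (I n)) \<longlonglongrightarrow> sqrt 0" by (rule tendsto_real_sqrt)
  then show ?thesis by (simp add: L2H1_norm_def I_def)
qed

end

section \<open>Resonance\<close>

lemma DERIV_max_power:
  fixes x :: real
  assumes n: "n \<ge> 2"
  shows "((\<lambda>x. max 0 x ^ n) has_real_derivative real n * max 0 x ^ (n - 1)) (at x)"
proof (cases "x = 0")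
  case True
  have lim: "((\<lambda>h. max 0 h ^ n / h) \<longlongrightarrow> 0) (at (0::real))"
  proof (rule Lim_null_comparison)
    show "\<forall>\<^sub>F h in at (0::real). norm (max 0 h ^ n / h) \<le> \<bar>h\<bar> ^ (n - 1)"
    proof (intro eventually_at_filter[THEN iffD2] always_eventually allI impI)
      fix h :: real assume "h \<noteq> 0"
      obtain m where m: "n = Suc m" using n by (cases n) auto
      show "norm (max 0 h ^ n / h) \<le> \<bar>h\<bar> ^ (n - 1)"
        using \<open>h \<noteq> 0\<close> by (cases "h > 0") (auto simp: m max_def)
    qed
    have "((\<lambda>h::real. \<bar>h\<bar> ^ (n - 1)) \<longlongrightarrow> \<bar>0\<bar> ^ (n - 1)) (at 0)" by (intro tendsto_intros)
    moreover have "\<bar>0::real\<bar> ^ (n - 1) = 0" using n by simp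
    ultimately show "((\<lambda>h::real. \<bar>h\<bar> ^ (n - 1)) \<longlongrightarrow> 0) (at 0)" by (simp only:)
  qed
  have z: "(0::real) ^ n = 0" "(0::real) ^ (n - 1) = 0" using n by simp_all
  show ?thesis
    unfolding True DERIV_def using lim
    by (simp only: z max.idem add_0_left diff_zero mult_zero_right)
next
  case False
  show ?thesis
  proof (cases "x > 0")
    case True
    have "((\<lambda>x. x ^ n) has_real_derivative real n * x ^ (n - 1)) (at x)"
      using DERIV_pow[of n x] by simp
    then have "((\<lambda>x. max 0 x ^ n) has_real_derivative real n * x ^ (n - 1)) (at x)"
      by (rule has_field_derivative_transform_within_open[of _ _ _ "{0<..}"]) (use True in auto)
    then show ?thesis using True by simp
  next
    case neg: False
    have "((\<lambda>x. 0) has_real_derivative 0) (at x)" by simp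
    then have "((\<lambda>x. max 0 x ^ n) has_real_derivative 0) (at x)"
      by (rule has_field_derivative_transform_within_open[of _ _ _ "{..<0}"]) (use neg False n in auto)
    moreover have "max 0 x = 0" "(0::real) ^ (n - 1) = 0" using neg n by simp_all
    ultimately show ?thesis by (simp only: mult_zero_right)
  qed
qed

text \<open>The core of \<open>u\<^sub>n\<close> is smallest at \<open>t = 0\<close>, with radius \<open>r0 e\<^sup>-\<^sup>L\<^sup>(\<^sup>0\<^sup>)\<close>. A square whose half side \<open>\<rho>\<close> is half
  of this radius fits into it, and \<open>max 0 (cos s - cos \<rho>)\<^sup>3\<close> is a twice continuously differentiable
  periodic profile supported in \<open>\<bar>s\<bar> < \<rho>\<close> modulo \<open>2\<pi>\<close>.\<close>

lemma (in pulse_coeff) norm_evolution_u_n: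
  assumes S: "contraction_semigroup_generated_by S (maxwell_ohm_graph \<sigma>)" and T: "T > 0"
  shows "norm (evolution S \<sigma> T (u_n \<Theta> r0 \<sigma> x0 n)) \<ge> (T + \<delta>) / (5 * \<delta>)"
proof -
  define \<rho> where "\<rho> = r0 * exp (- L 0) / 2"
  have L0: "L 0 \<ge> 1" using L_ge_1[of 0] delta_pos by simp
  have "r0 * exp (- L 0) \<le> r0 * 1" using r0 L0 by (intro mult_left_mono) auto
  then have "r0 * exp (- L 0) < pi" using r0 by linarith
  then have \<rho>: "0 < \<rho>" "\<rho> < pi" using r0 by (auto simp: \<rho>_def)
  define c0 where "c0 = cos \<rho>"
  define g where "g s = max 0 (cos s - c0)" for s
  define k where "k s = g s ^ 3" for s
  define k' where "k' s = 3 * g s ^ 2 * - sin s" for s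
  define k'' where "k'' s = 6 * g s * (sin s)\<^sup>2 - 3 * g s ^ 2 * cos s" for s
  have g0: "g s \<ge> 0" "g s \<le> 2" for s
  proof -
    have "cos s - cos \<rho> \<le> 2" using cos_le_one[of s] cos_ge_minus_one[of \<rho>] by linarith
    then show "g s \<ge> 0" "g s \<le> 2" by (auto simp: g_def c0_def)
  qed
  have dg: "((\<lambda>s. cos s - c0) has_real_derivative - sin s) (at s)" for s
    by (auto intro!: derivative_eq_intros)
  have d3: "(k has_real_derivative k' s) (at s)" for s
    using DERIV_chain2[OF DERIV_max_power[of 3] dg[of s]] by (simp add: k_def[abs_def] k'_def g_def[abs_def])
  have d2: "((\<lambda>s. g s ^ 2) has_real_derivative 2 * g s * - sin s) (at s)" for s
    using DERIV_chain2[OF DERIV_max_power[of 2] dg[of s]] by (simp add: g_def[abs_def])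
  have dk': "(k' has_real_derivative k'' s) (at s)" for s
    unfolding k'_def[abs_def]
    by (rule DERIV_cong[OF DERIV_mult[OF DERIV_cmult[OF d2] DERIV_minus[OF DERIV_sin]]])
       (simp add: k''_def power2_eq_square algebra_simps)
  have p3: "g s ^ 3 \<le> 8" "g s ^ 2 \<le> 4" for s
    using power_mono[OF g0(2) g0(1), of s 3] power_mono[OF g0(2) g0(1), of s 2] by auto
  have kb: "\<bar>k s\<bar> \<le> 24" "\<bar>k' s\<bar> \<le> 24" "\<bar>k'' s\<bar> \<le> 24" for s
  proof -
    show "\<bar>k s\<bar> \<le> 24" using p3(1)[of s] g0(1)[of s] by (simp add: k_def)
    have "g s ^ 2 * \<bar>sin s\<bar> \<le> 4 * 1" using p3(2)[of s] by (intro mult_mono) auto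
    moreover have "\<bar>k' s\<bar> = 3 * (g s ^ 2 * \<bar>sin s\<bar>)" by (simp add: k'_def abs_mult)
    ultimately show "\<bar>k' s\<bar> \<le> 24" by linarith
    have a: "g s * (sin s)\<^sup>2 \<le> 2 * 1" using g0[of s] by (intro mult_mono) (auto simp: abs_square_le_1)
    have b: "\<bar>g s ^ 2 * cos s\<bar> \<le> 4 * 1" unfolding abs_mult using p3(2)[of s] by (intro mult_mono) auto
    have c: "0 \<le> g s * (sin s)\<^sup>2" using g0(1)[of s] by simp
    have "\<bar>6 * (g s * (sin s)\<^sup>2) - 3 * (g s ^ 2 * cos s)\<bar> \<le> 24" using a b c by linarith
    then show "\<bar>k'' s\<bar> \<le> 24" by (simp add: k''_def mult.assoc)
  qed
  have cos_int: "cos (a + 2 * pi * real_of_int m) = cos a" for a m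
    unfolding cos_add by simp
  have core: "u_n \<Theta> r0 \<sigma> x0 n t x = (1 + 2 / (\<sigma> * (t + \<delta>))) *\<^sub>R dir"
    if t: "t \<in> {0..T}" and c: "cos (x $ 1 - x0 $ 1 - t) > c0" "cos (x $ 2 - x0 $ 2) > c0" for t x
  proof -
    define y where "y = x - (x0 + t *\<^sub>R dir)"
    have y: "y $ 1 = x $ 1 - x0 $ 1 - t" "y $ 2 = x $ 2 - x0 $ 2"
      by (simp_all add: y_def dir_def axis_def)
    obtain m where m: "wrap y = y + lat m" using wrap_eq_lat by blast
    have small: "\<bar>wrap y $ i\<bar> < \<rho>" if "cos (y $ i) > c0" for i
    proof -
      have "cos \<bar>wrap y $ i\<bar> > cos \<rho>"
        using that cos_int[of "y $ i" "m $ i"] by (simp add: m lat_def c0_def)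
      moreover have "\<bar>wrap y $ i\<bar> \<le> pi"
        using wrap_in_fcell[of y] by (auto simp: fcell_def abs_le_iff minus_le_iff less_imp_le)
      ultimately show ?thesis using \<rho> cos_mono_less_eq[of \<rho> "\<bar>wrap y $ i\<bar>"] by simp
    qed
    have "norm (wrap y) \<le> \<bar>wrap y $ 1\<bar> + \<bar>wrap y $ 2\<bar>"
      using norm_le_l1_cart[of "wrap y"] by (simp add: sum_2)
    also have "\<dots> < 2 * \<rho>" using small[of 1] small[of 2] c y by simp
    also have "\<dots> \<le> r0 * exp (- L t)"
    proof -
      have "L t \<le> L 0" using t delta_pos by (intro L_antimono) auto
      then show ?thesis using r0 by (simp add: \<rho>_def)
    qed
    finally have "field t (wrap y) = A t *\<^sub>R dir"
      using t delta_pos by (intro field_core) auto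
    then show ?thesis by (simp add: u_n_eq y_def A_n_def)
  qed
  have per: "g (s + 2 * pi) = g s" for s by (simp add: g_def)
  interpret travelling_core S \<sigma> T "u_n \<Theta> r0 \<sigma> x0 n" x0 \<delta> c0 24 k k' k''
  proof unfold_locales
    show "continuous_on UNIV k''" unfolding k''_def g_def by (intro continuous_intros)
    show "k 0 \<noteq> 0"
      using cos_monotone_0_pi[of 0 \<rho>] \<rho> by (simp add: k_def g_def c0_def)
    show "cos s > c0" if "k s \<noteq> 0" for s
      using that by (auto simp: k_def g_def max_def split: if_splits)
    show "k (s + 2 * pi) = k s" "k' (s + 2 * pi) = k' s" "k'' (s + 2 * pi) = k'' s" for s
      by (simp_all only: k_def k'_def k''_def per sin_periodic cos_periodic)
  qed (rule S \<sigma> T periodic_u_n continuous_on_u_n delta_pos d3 dk' kb core; assumption?)+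
  show ?thesis by (rule norm_evolution_lower_bound)
qed

theorem proposition3p7:
  fixes T \<sigma> r0 C :: real and x0 :: "real^2" and \<Theta> :: "real \<Rightarrow> real"
    and S :: "real \<Rightarrow> H2 \<Rightarrow>\<^sub>L H2"
  assumes T: "T > 0" and \<sigma>: "\<sigma> > 0"
    and r0: "0 < r0" "r0 < pi"
    and \<Theta>_smooth: "smooth_on UNIV \<Theta>"
    and \<Theta>_range: "\<And>z. \<Theta> z \<in> {0..1}"
    and \<Theta>_left: "\<And>z. z \<le> 0 \<Longrightarrow> \<Theta> z = 0"
    and \<Theta>_middle: "\<And>z. 1/4 \<le> z \<Longrightarrow> z \<le> 3/4 \<Longrightarrow> \<Theta> z = z"
    and \<Theta>_right: "\<And>z. z \<ge> 1 \<Longrightarrow> \<Theta> z = 1"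
    and \<Theta>_deriv: "\<And>z. \<bar>deriv \<Theta> z\<bar> + \<bar>deriv (deriv \<Theta>) z\<bar> \<le> C"
    and \<Theta>_linear: "\<And>z. 0 \<le> z \<Longrightarrow> z \<le> 1 \<Longrightarrow> \<Theta> z \<le> C * z"
    and S: "contraction_semigroup_generated_by S (maxwell_ohm_graph \<sigma>)"
  defines "U \<equiv> evolution S \<sigma> T"
    and "u \<equiv> u_n \<Theta> r0 \<sigma> x0"
    and "zero \<equiv> (\<lambda>t x. 0)"
  shows "filterlim (\<lambda>n. norm (U (u n) - U zero)) at_top sequentially \<and>
    (\<exists>X. X \<noteq> 0 \<and>
       (SUP n\<in>{1..}. ereal (norm (blinfun_apply (U (u n)) X - blinfun_apply (U zero) X))) = \<infinity> \<and>
       \<not> (\<forall>e>0. \<exists>d>0. \<forall>v. smooth_coeff T v \<and> L2H1_norm T v < d \<longrightarrow>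
            norm (blinfun_apply (U v) X - blinfun_apply (U zero) X) < e))"
proof -
  interpret P: pulse_profile \<Theta> r0
    by unfold_locales (use r0 \<Theta>_smooth \<Theta>_left \<Theta>_right in auto)
  interpret M: maxwell_ohm S \<sigma> T by unfold_locales (use S \<sigma> T in auto)
  have pc: "pulse_coeff \<Theta> r0 \<sigma>"
    unfolding pulse_coeff_def pulse_coeff_axioms_def using P.pulse_profile_axioms \<sigma> by simp
  have lower: "norm (U (u n) - U zero) \<ge> T / 5 * exp (real n) - 1" for n
  proof -
    have "T / 5 * exp (real n) \<le> (T + delta_n n) / (5 * delta_n n)"
      by (simp add: delta_n_def exp_minus field_simps)
    also have "\<dots> \<le> norm (U (u n))"
      unfolding U_def u_def by (rule pulse_coeff.norm_evolution_u_n[OF pc S T])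
    also have "\<dots> \<le> norm (U (u n) - U zero) + norm (U zero)"
      using norm_triangle_ineq[of "U (u n) - U zero" "U zero"] by simp
    also have "norm (U zero) \<le> 1"
      unfolding U_def zero_def by (rule M.norm_evolution_zero)
    finally show ?thesis by simp
  qed
  have lim: "filterlim (\<lambda>n. norm (U (u n) - U zero)) at_top sequentially"
  proof (rule filterlim_at_top_mono)
    have "filterlim (\<lambda>n. exp (real n)) at_top sequentially"
      by (rule filterlim_compose[OF exp_at_top filterlim_real_sequentially])
    then have "filterlim (\<lambda>n. T / 5 * exp (real n)) at_top sequentially"
      using T by (intro filterlim_tendsto_pos_mult_at_top[OF tendsto_const]) auto
    then have "filterlim (\<lambda>n. - 1 + T / 5 * exp (real n)) at_top sequentially"
      by (rule filterlim_tendsto_add_at_top[OF tendsto_const])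
    then show "filterlim (\<lambda>n. T / 5 * exp (real n) - 1) at_top sequentially" by simp
  qed (use lower in simp)
  \<comment> \<open>The supremum in the statement begins at \<open>n = 1\<close>, hence the shift.\<close>
  have "filterlim (\<lambda>n. norm (U (u (Suc n)) - U zero)) at_top sequentially"
    using lim by (rule filterlim_compose) (rule filterlim_Suc)
  from uniform_boundedness[OF this] obtain X
    where X: "\<And>K. \<exists>n. norm ((U (u (Suc n)) - U zero) X) > K" by blast
  then have big: "\<exists>n. norm (U (u (Suc n)) X - U zero X) > K" for K
    by (simp add: blinfun.diff_left)
  have "X \<noteq> 0" using big[of 0] by (auto simp: blinfun.zero_right)
  moreover have "(SUP n\<in>{1..}. ereal (norm (blinfun_apply (U (u n)) X - blinfun_apply (U zero) X))) = \<infinity>"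
  proof (rule SUP_PInfty)
    fix k :: nat
    obtain n where "norm (U (u (Suc n)) X - U zero X) > real k" using big by blast
    then show "\<exists>i\<in>{1..}. ereal (real k) \<le> ereal (norm (U (u i) X - U zero X))"
      by (intro bexI[of _ "Suc n"]) auto
  qed
  moreover have "\<not> (\<forall>e>0. \<exists>d>0. \<forall>v. smooth_coeff T v \<and> L2H1_norm T v < d \<longrightarrow>
            norm (blinfun_apply (U v) X - blinfun_apply (U zero) X) < e)"
  proof
    assume "\<forall>e>0. \<exists>d>0. \<forall>v. smooth_coeff T v \<and> L2H1_norm T v < d \<longrightarrow>
            norm (blinfun_apply (U v) X - blinfun_apply (U zero) X) < e"
    then obtain d where d: "d > 0"
      "\<And>v. smooth_coeff T v \<Longrightarrow> L2H1_norm T v < d \<Longrightarrow> norm (U v X - U zero X) < 1"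
      using zero_less_one by blast
    have "(\<lambda>n. L2H1_norm T (u n)) \<longlonglongrightarrow> 0"
      unfolding u_def by (rule P.L2H1_norm_u_n_tendsto[OF \<sigma> \<Theta>_range \<Theta>_deriv \<Theta>_linear])
    then have "\<forall>\<^sub>F n in sequentially. L2H1_norm T (u n) < d" using d(1) by (rule order_tendstoD)
    then obtain N where N: "\<And>n. n \<ge> N \<Longrightarrow> L2H1_norm T (u n) < d"
      unfolding eventually_sequentially by blast
    have small: "norm (U (u n) X - U zero X) < 1" if "n \<ge> N" for n
      using d(2)[OF _ N[OF that]] pulse_coeff.smooth_coeff_u_n[OF pc] unfolding u_def by blast
    \<comment> \<open>Continuity at zero bounds all but finitely many of the differences by \<open>1\<close>, and so all of them.\<close>
    define K where "K = 1 + (\<Sum>n\<le>N. norm (U (u n) X - U zero X))"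
    have "norm (U (u n) X - U zero X) \<le> K" for n
    proof (cases "n \<le> N")
      case True
      then have "norm (U (u n) X - U zero X) \<le> (\<Sum>n\<le>N. norm (U (u n) X - U zero X))"
        by (intro member_le_sum) auto
      then show ?thesis by (simp add: K_def)
    next
      case False
      then have "norm (U (u n) X - U zero X) < 1" by (intro small) simp
      moreover have "K \<ge> 1" by (simp add: K_def sum_nonneg)
      ultimately show ?thesis by simp
    qed
    then show False using big[of K] by (metis not_less)
  qed
  ultimately show ?thesis using lim by blast
qed

end
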